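(* Let $p>2$ be a prime, $q=p^n$, $\psi$ a nontrivial additive character of $\mathbb{F}_p$, and let $d$ range over natural numbers with $(d,p)=1$. Let $V$ be a Schwartz function on $\mathbb{R}^2$ whose Fourier transform $\hat V(\eta,\xi)=\frac{1}{4\pi^2}\int\int V(t,u)e^{-i\eta t-i\xi u}\,dt\,du$ is supported on the set $\{|\eta|+|\xi|\le 1\}$. Put $v_{d-1}(t,u)=\sum_{m,n=-\infty}^\infty V((d-1)(t+2\pi m),(d-1)(u+2\pi n))$. For $f\in\mathcal{F}_d$ with normalised zeroes $\rho_j=e^{i\theta_j}$ ($1\le j\le d-1$) of $L_{f,\psi}$ and a real number $\theta$, let $$S^2_\theta(f,\psi)=\sum_{1\le j,k\le d-1,\ j\neq k}v_{d-1}(\theta_j-\theta,\theta_k-\theta).$$ Then for every $\theta$, the average of $S^2_\theta(f,\psi)$ over $f\in\mathcal{F}_d$ (uniform) equals $$\frac{1}{4\pi^2}\int_{-\infty}^\infty\int_{-\infty}^\infty V(t,u)\left(1-\left(\frac{\sin((t-u)/2)}{(t-u)/2}\right)^2\right)dt\,du+o(1)$$ as $d\to\infty$.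
   Context: $\mathcal{F}_d$ denotes the set of polynomials $f=\sum_{i=0}^d a_ix^i\in\mathbb{F}_q[x]$ with $a_d\neq 0$ and $a_i=0$ for every $i\ge 0$ divisible by $p$. For $f\in\mathcal{F}_d$, $L_{f,\psi}(z)=\exp\left(\sum_{r\ge1}\sum_{\alpha\in\mathbb{F}_{q^r}}\psi(\mathrm{Tr}_{\mathbb{F}_{q^r}/\mathbb{F}_p}f(\alpha))z^r/r\right)$ is a polynomial of degree $d-1$ factoring as $\prod_{i=1}^{d-1}(1-q^{1/2}\rho_iz)$ with $|\rho_i|=1$; the $\rho_i$ are its normalised zeroes. *)

theory Defs
  imports "HOL-Analysis.Analysis" "HOL-Computational_Algebra.Computational_Algebra"
begin

text \<open>Finite fields are realised inside a fixed algebraically closed field 'k of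
characteristic p: the field with m = p^k elements is the set of roots of x^m - x.\<close>

definition Fsub :: "nat \<Rightarrow> 'k::field set" where
  "Fsub m = {x. x ^ m = x}"

definition trace_Fp :: "nat \<Rightarrow> nat \<Rightarrow> 'k::field \<Rightarrow> 'k" where
  "trace_Fp p k y = (\<Sum>i<k. y ^ (p ^ i))"

definition nontriv_add_char :: "nat \<Rightarrow> ('k::field \<Rightarrow> complex) \<Rightarrow> bool" where
  "nontriv_add_char p \<psi> \<longleftrightarrow>
     (\<forall>x\<in>Fsub p. \<forall>y\<in>Fsub p. \<psi> (x + y) = \<psi> x * \<psi> y) \<and>
     (\<forall>x\<in>Fsub p. norm (\<psi> x) = 1) \<and>
     (\<exists>x\<in>Fsub p. \<psi> x \<noteq> 1)"

definition family :: "nat \<Rightarrow> nat \<Rightarrow> nat \<Rightarrow> 'k::field poly set" where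
  "family p n d = {f. degree f = d \<and> lead_coeff f \<noteq> 0 \<and>
      (\<forall>i. coeff f i \<in> Fsub (p ^ n)) \<and> (\<forall>i. p dvd i \<longrightarrow> coeff f i = 0)}"

definition char_sum :: "nat \<Rightarrow> nat \<Rightarrow> ('k::field \<Rightarrow> complex) \<Rightarrow> 'k poly \<Rightarrow> nat \<Rightarrow> complex" where
  "char_sum p n \<psi> f r = (\<Sum>\<alpha>\<in>Fsub (p ^ (n * r)). \<psi> (trace_Fp p (n * r) (poly f \<alpha>)))"

definition L_fps :: "nat \<Rightarrow> nat \<Rightarrow> ('k::field \<Rightarrow> complex) \<Rightarrow> 'k poly \<Rightarrow> complex fps" where
  "L_fps p n \<psi> f = fps_exp 1 oo
     Abs_fps (\<lambda>r. if r = 0 then 0 else char_sum p n \<psi> f r / of_nat r)"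

definition norm_zeros :: "nat \<Rightarrow> nat \<Rightarrow> ('k::field \<Rightarrow> complex) \<Rightarrow> 'k poly \<Rightarrow> complex multiset" where
  "norm_zeros p n \<psi> f = (THE R. size R = degree f - 1 \<and>
     L_fps p n \<psi> f = fps_of_poly (\<Prod>\<rho>\<in>#R. [:1, - complex_of_real (sqrt (real (p ^ n))) * \<rho>:]))"

definition zero_list :: "nat \<Rightarrow> nat \<Rightarrow> ('k::field \<Rightarrow> complex) \<Rightarrow> 'k poly \<Rightarrow> complex list" where
  "zero_list p n \<psi> f = (SOME xs. mset xs = norm_zeros p n \<psi> f)"

definition zero_angle :: "nat \<Rightarrow> nat \<Rightarrow> ('k::field \<Rightarrow> complex) \<Rightarrow> 'k poly \<Rightarrow> nat \<Rightarrow> real" where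
  "zero_angle p n \<psi> f j = Arg (zero_list p n \<psi> f ! j)"

definition pdiff :: "bool \<Rightarrow> (real \<times> real \<Rightarrow> complex) \<Rightarrow> real \<times> real \<Rightarrow> complex" where
  "pdiff b g = (\<lambda>(t, u). if b then vector_derivative (\<lambda>s. g (s, u)) (at t)
                          else vector_derivative (\<lambda>s. g (t, s)) (at u))"

fun pdiffs :: "bool list \<Rightarrow> (real \<times> real \<Rightarrow> complex) \<Rightarrow> real \<times> real \<Rightarrow> complex" where
  "pdiffs [] g = g"
| "pdiffs (b # bs) g = pdiff b (pdiffs bs g)"

definition schwartz2 :: "(real \<times> real \<Rightarrow> complex) \<Rightarrow> bool" where
  "schwartz2 V \<longleftrightarrow> (\<forall>bs. (\<forall>x. pdiffs bs V differentiable (at x)) \<and>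
      (\<forall>m::nat. \<exists>C. \<forall>x. (1 + norm x) ^ m * norm (pdiffs bs V x) \<le> C))"

definition fourier2 :: "(real \<times> real \<Rightarrow> complex) \<Rightarrow> real \<Rightarrow> real \<Rightarrow> complex" where
  "fourier2 V \<eta> \<xi> = 1 / (4 * pi\<^sup>2) *
     (LINT x|lborel. V x * exp (- \<i> * (\<eta> * fst x + \<xi> * snd x)))"

definition vper :: "(real \<times> real \<Rightarrow> complex) \<Rightarrow> nat \<Rightarrow> real \<Rightarrow> real \<Rightarrow> complex" where
  "vper V N t u = (\<Sum>\<^sub>\<infinity>(m, k)\<in>(UNIV :: (int \<times> int) set).
      V (real N * (t + 2 * pi * of_int m), real N * (u + 2 * pi * of_int k)))"

definition S2 :: "nat \<Rightarrow> nat \<Rightarrow> ('k::field \<Rightarrow> complex) \<Rightarrow> (real \<times> real \<Rightarrow> complex)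
                   \<Rightarrow> real \<Rightarrow> 'k poly \<Rightarrow> complex" where
  "S2 p n \<psi> V \<theta> f = (let d = degree f in
     (\<Sum>j\<in>{1..d-1}. \<Sum>k\<in>{1..d-1}. if j \<noteq> k then
        vper V (d - 1) (zero_angle p n \<psi> f (j - 1) - \<theta>) (zero_angle p n \<psi> f (k - 1) - \<theta>)
      else 0))"

definition avg_S2 :: "'k itself \<Rightarrow> nat \<Rightarrow> nat \<Rightarrow> ('k::field \<Rightarrow> complex) \<Rightarrow> (real \<times> real \<Rightarrow> complex)
                   \<Rightarrow> real \<Rightarrow> nat \<Rightarrow> complex" where
  "avg_S2 _ p n \<psi> V \<theta> d =
     (\<Sum>f\<in>(family p n d :: 'k poly set). S2 p n \<psi> V \<theta> f) / of_nat (card (family p n d :: 'k poly set))"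

end

theory Submission
  imports Defs
begin

text \<open>
  By Poisson summation, the sum over pairs of zeros is a finite linear combination, over frequencies
  \<open>r\<close>, \<open>s\<close> with \<open>|r| + |s| \<le> d - 1\<close>, of \<open>T r * T s - T (r + s)\<close>, where \<open>T r\<close> is the \<open>r\<close>-th power sum of
  the normalised zeros, that is, a normalised character sum over the field with \<open>q ^ r\<close> elements. In
  that range orthogonality evaluates the average over the family exactly: it counts pairs
  \<open>(\<alpha>, \<beta>)\<close> whose Frobenius orbits (with multiplicities) agree modulo \<open>p\<close> away from 0. The only
  contribution that is not exponentially small comes from \<open>r + s = 0\<close> and conjugate \<open>\<alpha>\<close>, \<open>\<beta>\<close>,
  and gives \<open>|r|\<close>. The resulting sum is a Fejer kernel integrated against \<open>V\<close>, and the Fejer kernel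
  converges to the square of the sine quotient.

  That the zeros have absolute value 1 is proved with a one-variable form of the
  Stepanov--Bombieri argument, together with the evaluation of the leading coefficient of
  the L-polynomial.
\<close>

unbundle no vec_syntax

section \<open>Finite fields and additive characters\<close>

text \<open>The support condition is matched to the family. The leading coefficient of
  \<open>f\<close> cannot be varied freely, so the average tests only power sums of index below
  \<open>d\<close>; a polynomial that isolates one of the at most \<open>r + s\<close> points
  involved and vanishes at 0 has degree at most \<open>r + s\<close>, so \<open>r + s < d\<close>
  suffices. The indices divisible by \<open>p\<close>, absent from the family, cost nothing, because
  Frobenius determines their power sums from smaller ones. Degenerate pairs number about
  \<open>q ^ ((r + s) / 3)\<close> at most, against the normalisation
  \<open>q ^ ((r + s) / 2)\<close>; this is the origin of the rate \<open>q powr (- 1 / 6)\<close>.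

  Absolute value 1 is needed because \<open>zero_angle\<close> keeps only the argument of a zero,
  and because it turns negative powers into conjugates.

  Monic polynomials over the field with \<open>q\<close> elements appear in two guises: as
  Frobenius-stable multisets of roots, where multiplicativity is addition of multisets, and as
  truncated power series with constant term 1, where the coefficients are free and orthogonality
  applies.\<close>

locale add_char =
  fixes p n :: nat and \<psi> :: "'k::alg_closed_field \<Rightarrow> complex"
  assumes p: "prime p" "p > 2" and n: "n \<ge> 1" and CHAR: "CHAR('k) = p"
    and \<psi>: "nontriv_add_char p \<psi>"
begin

abbreviation q where "q \<equiv> p ^ n"

lemma p_ge3: "p \<ge> 3" using p by simp
lemma q_ge3: "q \<ge> 3" using p_ge3 n by (metis One_nat_def Suc_le_D le_trans mult_le_mono1 nat_mult_1 order_trans power_increasing power_one_right numeral_3_eq_3 Suc_leI le_numeral_extra(4) less_le_trans zero_less_Suc)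

lemma of_nat_eq_0: "(of_nat m :: 'k) = 0 \<longleftrightarrow> p dvd m"
  using of_nat_eq_0_iff_char_dvd[where 'a='k] CHAR by simp

lemma frob_add: "((x::'k) + y) ^ (p ^ k) = x ^ (p ^ k) + y ^ (p ^ k)"
  using freshmans_dream'[where 'a='k] p CHAR by simp

lemma frob_sum: "(\<Sum>i\<in>A. f i :: 'k) ^ (p ^ k) = (\<Sum>i\<in>A. f i ^ (p ^ k))"
  using freshmans_dream_sum'[where 'a='k, of "p ^ k" k f A] p CHAR by simp

lemma frob_zero [simp]: "(0::'k) ^ (p ^ k) = 0"
  using p by (simp add: prime_gt_0_nat)

lemma frob_uminus: "(- (x::'k)) ^ (p ^ k) = - (x ^ (p ^ k))"
  using frob_add[of x "-x" k] by (simp add: eq_neg_iff_add_eq_0 add.commute)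

lemma frob_diff: "((x::'k) - y) ^ (p ^ k) = x ^ (p ^ k) - y ^ (p ^ k)"
  using frob_add[of x "-y" k] by (simp add: frob_uminus)

lemma frob_inj: "(x::'k) ^ (p ^ k) = y ^ (p ^ k) \<longleftrightarrow> x = y"
  using frob_diff[of x y k] by (metis frob_zero eq_iff_diff_eq_0 power_eq_0_iff)

lemma power_in_Fsub_iff: "(x::'k) ^ (p ^ j) \<in> Fsub (p ^ k) \<longleftrightarrow> x \<in> Fsub (p ^ k)"
  unfolding Fsub_def using frob_inj[of "x ^ p ^ k" j x] by (simp flip: power_mult add: mult.commute)

lemma Fsub_0 [simp]: "(0::'k) \<in> Fsub (p ^ k)" by (simp add: Fsub_def)
lemma Fsub_1 [simp]: "(1::'k) \<in> Fsub (p ^ k)" by (simp add: Fsub_def)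
lemma Fsub_add: "(x::'k) \<in> Fsub (p ^ k) \<Longrightarrow> y \<in> Fsub (p ^ k) \<Longrightarrow> x + y \<in> Fsub (p ^ k)"
  by (simp add: Fsub_def frob_add)
lemma Fsub_uminus: "(x::'k) \<in> Fsub (p ^ k) \<Longrightarrow> - x \<in> Fsub (p ^ k)"
  by (simp add: Fsub_def frob_uminus)
lemma Fsub_diff: "(x::'k) \<in> Fsub (p ^ k) \<Longrightarrow> y \<in> Fsub (p ^ k) \<Longrightarrow> x - y \<in> Fsub (p ^ k)"
  by (simp add: Fsub_def frob_diff)
lemma Fsub_mult: "(x::'k) \<in> Fsub m \<Longrightarrow> y \<in> Fsub m \<Longrightarrow> x * y \<in> Fsub m"
  by (simp add: Fsub_def power_mult_distrib)
lemma Fsub_divide: "(x::'k) \<in> Fsub m \<Longrightarrow> y \<in> Fsub m \<Longrightarrow> x / y \<in> Fsub m"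
  by (simp add: Fsub_def power_divide)
lemma Fsub_power: "(x::'k) \<in> Fsub m \<Longrightarrow> x ^ j \<in> Fsub m"
  unfolding Fsub_def by (metis (mono_tags, lifting) mem_Collect_eq mult.commute power_mult)
lemma Fsub_sum: "(\<And>i. i \<in> A \<Longrightarrow> f i \<in> Fsub (p ^ k)) \<Longrightarrow> (\<Sum>i\<in>A. f i :: 'k) \<in> Fsub (p ^ k)"
  by (induction A rule: infinite_finite_induct) (auto intro: Fsub_add)

lemma Fsub_iterate: "(x::'k) \<in> Fsub (p ^ k) \<Longrightarrow> x ^ (p ^ (k * j)) = x"
  by (induction j) (simp_all add: Fsub_def power_add power_mult)

lemma Fsub_dvd: "k dvd l \<Longrightarrow> (x::'k) \<in> Fsub (p ^ k) \<Longrightarrow> x \<in> Fsub (p ^ l)"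
  using Fsub_iterate by (auto simp: Fsub_def elim!: dvdE)

lemma Fsub_of_nat: "(of_nat i::'k) \<in> Fsub (p ^ k)"
  by (induction i) (auto intro: Fsub_add)

text \<open>Since \<open>p\<close> divides \<open>m\<close>, the derivative of
  \<open>x ^ m - x\<close> is -1, so no root is repeated.\<close>

lemma card_Fsub:
  assumes k: "k \<ge> 1"
  shows "finite (Fsub (p ^ k) :: 'k set)" "card (Fsub (p ^ k) :: 'k set) = p ^ k"
proof -
  define m where "m = p ^ k"
  define g :: "'k poly" where "g = monom 1 m - monom 1 1"
  have m: "m > 1" using p k unfolding m_def by (metis One_nat_def Suc_le_lessD one_less_power prime_gt_1_nat)
  have "p dvd m" using k by (simp add: m_def dvd_power)
  then have m0: "(of_nat m :: 'k) = 0" by (simp add: of_nat_eq_0)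
  have cg: "coeff g m = 1" using m by (simp add: g_def)
  have dg: "degree g = m"
  proof (rule antisym)
    show "degree g \<le> m" unfolding g_def using m
      by (intro degree_diff_le) (auto intro: order_trans[OF degree_monom_le])
    show "m \<le> degree g" using cg by (intro le_degree) simp
  qed
  have g0: "g \<noteq> 0" using cg by auto
  have lg: "lead_coeff g = 1" using dg cg by simp
  have roots: "Fsub (p ^ k) = {x. poly g x = 0}"
    by (auto simp: Fsub_def g_def poly_monom m_def)
  obtain A where A: "size A = m" "g = (\<Prod>x\<in>#A. [:-x, 1:])"
    using alg_closed_imp_factorization[OF g0] lg dg by auto
  have pd: "poly (pderiv g) a = -1" for a
    by (simp add: g_def pderiv_diff pderiv_monom m0 poly_monom)
  have c1: "count A a \<le> 1" for a
  proof (rule ccontr)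
    assume "\<not> count A a \<le> 1"
    then have "{#a, a#} \<subseteq># A" by (intro mset_subset_eqI) auto
    then obtain B where "A = {#a, a#} + B" by (metis mset_subset_eq_exists_conv)
    then have "g = [:-a, 1:] * ([:-a, 1:] * (\<Prod>x\<in>#B. [:-x, 1:]))" using A by simp
    then have "poly (pderiv g) a = 0" by (simp only: pderiv_mult) (simp add: pderiv_pCons)
    with pd show False by simp
  qed
  have "set_mset A = {x. poly g x = 0}"
    by (auto simp: A(2) poly_prod_mset prod_mset_zero_iff)
  moreover have "size A = card (set_mset A)"
    by (simp add: size_multiset_overloaded_eq)
      (metis c1 card_eq_sum count_greater_zero_iff le_antisym Suc_leI One_nat_def sum.cong)
  ultimately show "card (Fsub (p ^ k) :: 'k set) = p ^ k" using A(1) roots m_def by simp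
  show "finite (Fsub (p ^ k) :: 'k set)" unfolding roots using poly_roots_finite[OF g0] .
qed

lemma trace_Fp_add: "trace_Fp p k ((x::'k) + y) = trace_Fp p k x + trace_Fp p k y"
  by (simp add: trace_Fp_def frob_add sum.distrib)

lemma trace_Fp_0 [simp]: "trace_Fp p k (0::'k) = 0"
  by (simp add: trace_Fp_def)

lemma trace_Fp_in:
  assumes "(x::'k) \<in> Fsub (p ^ k)"
  shows "trace_Fp p k x \<in> Fsub p"
proof -
  have "trace_Fp p k x ^ p ^ 1 = (\<Sum>i<k. x ^ p ^ Suc i)"
    unfolding trace_Fp_def frob_sum by (simp add: mult.commute flip: power_mult)
  also have "\<dots> = (\<Sum>i<Suc k. x ^ p ^ i) - x" by (simp add: sum.lessThan_Suc_shift del: sum.lessThan_Suc)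
  also have "\<dots> = trace_Fp p k x" using assms by (simp add: trace_Fp_def Fsub_def)
  finally show ?thesis by (simp add: Fsub_def)
qed

lemma trace_Fp_scale:
  assumes "(c::'k) \<in> Fsub p"
  shows "trace_Fp p k (c * x) = c * trace_Fp p k x"
proof -
  have "c ^ p ^ i = c" for i using Fsub_iterate[of c 1 i] assms by simp
  then show ?thesis by (simp add: trace_Fp_def power_mult_distrib sum_distrib_left)
qed

text \<open>Transitivity of the trace: a character value over the extension becomes
  \<open>ech\<close> of a sum over a Frobenius orbit, which brings the sums over all fields with
  \<open>q ^ r\<close> elements down to one base field.\<close>

lemma trace_Fp_tower: "trace_Fp p (n * r) (x::'k) = trace_Fp p n (\<Sum>j<r. x ^ (q ^ j))"
proof -
  have "trace_Fp p n (\<Sum>j<r. x ^ (q ^ j)) = (\<Sum>j<r. \<Sum>i<n. x ^ p ^ (j * n + i))"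
    unfolding trace_Fp_def frob_sum
    by (subst sum.swap) (simp add: power_add power_mult[symmetric] mult.commute)
  also have "\<dots> = (\<Sum>i<n * r. x ^ p ^ i)"
  proof (induction r)
    case (Suc r)
    have "(\<Sum>i<n * Suc r. x ^ p ^ i) = (\<Sum>i<n * r. x ^ p ^ i) + (\<Sum>i<n. x ^ p ^ (r * n + i))"
      using sum.nat_group[of "\<lambda>i. x ^ p ^ i" n "Suc r"] sum.nat_group[of "\<lambda>i. x ^ p ^ i" n r]
        sum.shift_bounds_nat_ivl[of "\<lambda>i. x ^ p ^ i" 0 "r * n" n]
      by (simp add: atLeast0LessThan add.commute mult.commute)
    then show ?case using Suc.IH by simp
  qed auto
  finally show ?thesis by (simp add: trace_Fp_def)
qed

text \<open>The trace is a nonzero polynomial map of degree at most \<open>p ^ (n - 1)\<close>, too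
  small to vanish at \<open>q\<close> points.\<close>

lemma trace_Fp_nonzero: "\<exists>b\<in>Fsub q. trace_Fp p n (b::'k) \<noteq> 0"
proof (rule ccontr)
  assume "\<not> ?thesis"
  then have z: "\<And>b::'k. b \<in> Fsub q \<Longrightarrow> trace_Fp p n b = 0" by auto
  define g :: "'k poly" where "g = (\<Sum>i<n. monom 1 (p ^ i))"
  have "coeff g (p ^ (n-1)) = (\<Sum>i<n. if i = n - 1 then 1 else 0)"
    unfolding g_def coeff_sum using p by (intro sum.cong) (auto simp: prime_gt_1_nat)
  also have "\<dots> = 1" using n by simp
  finally have g0: "g \<noteq> 0" by auto
  have "degree g \<le> p ^ (n-1)" unfolding g_def
    using p by (intro degree_sum_le) (auto intro!: order_trans[OF degree_monom_le] power_increasing simp: prime_ge_1_nat)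
  have "Fsub q \<subseteq> {x. poly g x = 0}" using z by (auto simp: g_def poly_sum poly_monom trace_Fp_def)
  then have "q \<le> card {x. poly g x = 0}" using card_Fsub[OF n] poly_roots_finite[OF g0] by (metis card_mono)
  also have "\<dots> \<le> degree g" by (rule card_poly_roots_bound[OF g0])
  also have "\<dots> \<le> p ^ (n-1)" by fact
  also have "\<dots> < p ^ n" using n p by (intro power_strict_increasing) (auto simp: prime_gt_1_nat)
  finally show False by simp
qed

definition ech :: "'k \<Rightarrow> complex" where "ech x = \<psi> (trace_Fp p n x)"

lemma norm_ech: "x \<in> Fsub q \<Longrightarrow> norm (ech x) = 1"
  unfolding ech_def using \<psi> trace_Fp_in unfolding nontriv_add_char_def by blast

lemma ech_add: "x \<in> Fsub q \<Longrightarrow> y \<in> Fsub q \<Longrightarrow> ech (x + y) = ech x * ech y"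
  unfolding ech_def trace_Fp_add using \<psi> trace_Fp_in unfolding nontriv_add_char_def by blast

lemma ech_0 [simp]: "ech 0 = 1"
  using ech_add[of 0 0] norm_ech[of 0] by auto

lemma ech_uminus: "x \<in> Fsub q \<Longrightarrow> ech (- x) = cnj (ech x)"
proof -
  assume x: "x \<in> Fsub q"
  have "ech (-x) * ech x = 1" using ech_add[of "-x" x] x by (simp add: Fsub_uminus)
  moreover have "cnj (ech x) * ech x = 1" using norm_ech[OF x]
    by (metis complex_norm_square mult.commute of_real_1 power_one)
  ultimately show ?thesis using norm_ech[OF x] by (metis mult_cancel_right norm_zero zero_neq_one)
qed

lemma ech_diff: "x \<in> Fsub q \<Longrightarrow> y \<in> Fsub q \<Longrightarrow> ech (x - y) = ech x * cnj (ech y)"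
  using ech_add[of x "-y"] by (simp add: ech_uminus Fsub_uminus)

text \<open>One nonzero trace value and linearity over the prime field make the trace onto. Every
  cancellation by translation below rests on this.\<close>

lemma ech_nontriv:
  assumes "c \<noteq> 0" "c \<in> Fsub q"
  shows "\<exists>b\<in>Fsub q. ech (b * c) \<noteq> 1"
proof -
  obtain b :: 'k where b: "b \<in> Fsub q" "trace_Fp p n b \<noteq> 0" using trace_Fp_nonzero by auto
  obtain y where y: "y \<in> Fsub p" "\<psi> y \<noteq> 1" using \<psi> unfolding nontriv_add_char_def by auto
  define s where "s = y / trace_Fp p n b"
  have s: "s \<in> Fsub p" unfolding s_def by (intro Fsub_divide y trace_Fp_in b)
  then have s': "s \<in> Fsub q" using Fsub_dvd[of 1 n s] n by simp
  have "trace_Fp p n (s * b) = y" using b by (simp add: trace_Fp_scale[OF s]) (simp add: s_def)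
  then have "ech (s * b / c * c) \<noteq> 1" using assms y by (simp add: ech_def)
  then show ?thesis using s' b assms by (intro bexI[of _ "s * b / c"]) (auto intro: Fsub_mult Fsub_divide)
qed

end

section \<open>The square-root bound for character sums\<close>

lemma sum_lessThan_add:
  fixes a b :: nat
  shows "(\<Sum>i<a + b. g i :: 'a::comm_monoid_add) = (\<Sum>i<a. g i) + (\<Sum>i<b. g (i + a))"
  by (induction b) (simp_all add: add_ac)

text \<open>Gaussian elimination, one equation at a time: the last equation serves to eliminate an
  unknown that occurs in it.\<close>

lemma homogeneous_system_solution:
  fixes v :: "'i \<Rightarrow> nat \<Rightarrow> 'a::field"
  assumes "finite I" "card I > M"
  shows "\<exists>c. (\<exists>i\<in>I. c i \<noteq> 0) \<and> (\<forall>j<M. (\<Sum>i\<in>I. c i * v i j) = 0)"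
  using assms
proof (induction M arbitrary: I v)
  case 0
  then have "I \<noteq> {}" by auto
  then show ?case by (intro exI[of _ "\<lambda>_. 1"]) auto
next
  case (Suc M)
  show ?case
  proof (cases "\<forall>i\<in>I. v i M = 0")
    case True
    obtain c where "\<exists>i\<in>I. c i \<noteq> 0" "\<forall>j<M. (\<Sum>i\<in>I. c i * v i j) = 0"
      using Suc.IH[of I v] Suc.prems by auto
    with True show ?thesis by (intro exI[of _ c]) (auto simp: less_Suc_eq)
  next
    case False
    then obtain k where k: "k \<in> I" "v k M \<noteq> 0" by auto
    define u where "u = (\<lambda>i j. v i j - v i M / v k M * v k j)"
    have "card (I - {k}) > M" using Suc.prems k by simp
    then obtain c where c: "\<exists>i\<in>I - {k}. c i \<noteq> 0" "\<And>j. j < M \<Longrightarrow> (\<Sum>i\<in>I - {k}. c i * u i j) = 0"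
      using Suc.IH[of "I - {k}" u] Suc.prems by auto
    define c' where "c' = c (k := - (\<Sum>i\<in>I - {k}. c i * v i M / v k M))"
    have "(\<Sum>i\<in>I. c' i * v i j) = (\<Sum>i\<in>I - {k}. c i * u i j)" for j
    proof -
      have "(\<Sum>i\<in>I. c' i * v i j) = c' k * v k j + (\<Sum>i\<in>I - {k}. c i * v i j)"
        using Suc.prems k by (subst sum.remove[of _ k]) (auto simp: c'_def intro!: sum.cong)
      then show ?thesis
        by (simp add: c'_def u_def algebra_simps sum_subtractf sum_distrib_left sum_distrib_right)
    qed
    moreover have "u i M = 0" for i using k by (simp add: u_def)
    ultimately have "\<forall>j<Suc M. (\<Sum>i\<in>I. c' i * v i j) = 0" using c by (auto simp: less_Suc_eq)
    moreover have "\<exists>i\<in>I. c' i \<noteq> 0" using c by (auto simp: c'_def)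
    ultimately show ?thesis by blast
  qed
qed

lemma poly_linear_dependence:
  fixes P :: "'i \<Rightarrow> 'a::field poly"
  assumes "finite I" "card I > M" and deg: "\<And>i. i \<in> I \<Longrightarrow> degree (P i) < M"
  shows "\<exists>c. (\<exists>i\<in>I. c i \<noteq> 0) \<and> (\<Sum>i\<in>I. smult (c i) (P i)) = 0"
proof -
  obtain c where c: "\<exists>i\<in>I. c i \<noteq> 0" "\<forall>j<M. (\<Sum>i\<in>I. c i * coeff (P i) j) = 0"
    using homogeneous_system_solution[OF assms(1,2), of "\<lambda>i. coeff (P i)"] by auto
  have "coeff (\<Sum>i\<in>I. smult (c i) (P i)) j = 0" for j
  proof (cases "j < M")
    case False
    then have "\<And>i. i \<in> I \<Longrightarrow> coeff (P i) j = 0" using deg by (intro coeff_eq_0) fastforce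
    then show ?thesis by (simp add: coeff_sum)
  qed (use c in \<open>auto simp: coeff_sum\<close>)
  then show ?thesis using c by (intro exI[of _ c]) (auto simp: poly_eq_iff)
qed

text \<open>Among the terms with nonzero coefficient, the one of largest degree has nothing to
  cancel against.\<close>

lemma distinct_degrees_independent:
  fixes P :: "'i \<Rightarrow> 'a::idom poly"
  assumes "finite I" "inj_on (\<lambda>i. degree (P i)) I" "\<And>i. i \<in> I \<Longrightarrow> P i \<noteq> 0"
    and "\<exists>i\<in>I. c i \<noteq> 0"
  shows "(\<Sum>i\<in>I. smult (c i) (P i)) \<noteq> 0"
proof -
  define J where "J = {i\<in>I. c i \<noteq> 0}"
  have J: "finite J" "J \<noteq> {}" using assms by (auto simp: J_def)
  define m where "m = Max ((\<lambda>i. degree (P i)) ` J)"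
  have "m \<in> (\<lambda>i. degree (P i)) ` J" unfolding m_def using J by (intro Max_in) auto
  then obtain k where k: "k \<in> J" "degree (P k) = m" by auto
  have le: "degree (P i) \<le> m" if "i \<in> J" for i using that J unfolding m_def by auto
  have z: "c i * coeff (P i) m = 0" if "i \<in> I" "i \<noteq> k" for i
  proof (cases "c i = 0")
    case False
    then have "i \<in> J" using that by (auto simp: J_def)
    moreover have "degree (P i) \<noteq> m" using that k assms(2) by (auto simp: J_def inj_on_def)
    ultimately show ?thesis using le by (simp add: coeff_eq_0 le_neq_implies_less)
  qed simp
  have kI: "k \<in> I" using k J_def by auto
  have "coeff (\<Sum>i\<in>I. smult (c i) (P i)) m = c k * coeff (P k) m"
    using sum.remove[OF assms(1) kI, of "\<lambda>i. c i * coeff (P i) m"] z by (simp add: coeff_sum)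
  also have "\<dots> \<noteq> 0" using k assms(3)[of k] by (auto simp: J_def)
  finally show ?thesis by auto
qed

context add_char
begin

lemma degree_frob_sum:
  fixes f :: "'k poly"
  assumes "degree f > 0"
  shows "degree (\<Sum>i<Suc b. f ^ p ^ i) = degree f * p ^ b"
proof (induction b)
  case (Suc b)
  have "degree (\<Sum>i<Suc (Suc b). f ^ p ^ i) = degree ((\<Sum>i<Suc b. f ^ p ^ i) + f ^ p ^ Suc b)" by simp
  also have "\<dots> = degree (f ^ p ^ Suc b)"
  proof (rule degree_add_eq_right)
    have "f \<noteq> 0" using assms by auto
    then show "degree (\<Sum>i<Suc b. f ^ p ^ i) < degree (f ^ p ^ Suc b)"
      using assms p Suc.IH by (simp add: degree_power_eq prime_gt_1_nat prime_gt_0_nat)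
  qed
  also have "\<dots> = degree f * p ^ Suc b"
    using assms by (subst degree_power_eq) auto
  finally show ?case .
qed simp

text \<open>With \<open>Q = p ^ Suc b\<close>, \<open>L = p ^ b\<close> and \<open>h = f + f ^ p + \<dots> + f ^ L\<close>, every point of the fibre satisfies
  \<open>(x ^ Q) ^ Q = x\<close> and \<open>h ^ Q = t - h\<close>. Hence the combination \<open>w\<close> of the \<open>x ^ s * (x ^ Q) ^ i * h ^ j\<close> vanishes on
  the fibre as soon as the \<open>Q\<close>-th powers of its coefficients solve a linear system. It is nonzero because
  the degrees \<open>s + L * (i * p + j * d)\<close> with \<open>s < L\<close>, \<open>j < p\<close> are pairwise distinct.\<close>

lemma card_trace_fibre_le:
  fixes f :: "'k poly" and t :: 'k
  assumes d: "degree f > 0" "coprime (degree f) p" and L: "p ^ b > degree f"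
  shows "card {x \<in> Fsub (p ^ (2 * Suc b)). trace_Fp p (2 * Suc b) (poly f x) = t}
           \<le> p ^ Suc b * (p ^ b + 2 * degree f)"
proof -
  define L where "L = p ^ b"
  define Q where "Q = p ^ Suc b"
  define d where "d = degree f"
  \<comment> \<open>There are \<open>Q * (K + 1)\<close> unknowns and
    \<open>Q * (L + d) + K + 1\<close> equations. With \<open>K = L + d\<close> the unknowns win as
    soon as \<open>Q > K + 1\<close>, which follows from \<open>d < L\<close> and
    \<open>p \<ge> 3\<close>.\<close>
  define K where "K = L + d"
  define h where "h = (\<Sum>i<Suc b. f ^ p ^ i)"
  have QL: "Q = p * L" by (simp add: Q_def L_def)
  have L0: "L > 0" "Q > 0" using p by (auto simp: L_def Q_def prime_gt_0_nat)
  have dh: "degree h = d * L" using degree_frob_sum[OF d(1), of b] by (simp add: h_def d_def L_def)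
  have h0: "h \<noteq> 0" using dh d L0 by (auto simp: d_def)
  define I where "I = {..<L} \<times> {..K} \<times> {..<p}"
  define P where "P = (\<lambda>(s, i, j). monom 1 (s * Q + i) * ([:t:] - h) ^ j)"
  have finI: "finite I" by (simp add: I_def)
  have "\<exists>c. (\<exists>i\<in>I. c i \<noteq> 0) \<and> (\<Sum>i\<in>I. smult (c i) (P i)) = 0"
  proof (rule poly_linear_dependence[OF finI, where M = "Q * (L + d) + K + 1"])
    have "3 * L \<le> Q" using p_ge3 QL by simp
    moreover have "L > d" using L by (simp add: L_def d_def)
    ultimately have "Q > K + 1" using L0 unfolding K_def by linarith
    then have "Q * (L + d) + K + 1 < Q * (K + 1)" using L0 L unfolding K_def by simp
    also have "\<dots> = card I" by (simp add: I_def card_cartesian_product QL algebra_simps)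
    finally show "Q * (L + d) + K + 1 < card I" by simp
    show "degree (P x) < Q * (L + d) + K + 1" if "x \<in> I" for x
    proof -
      obtain s i j where x: "x = (s, i, j)" by (cases x) auto
      then have b: "s < L" "i \<le> K" "j < p" using that by (auto simp: I_def)
      have "degree ([:t:] - h) \<le> d * L" using dh by (intro degree_diff_le) auto
      then have "degree (([:t:] - h) ^ j) \<le> d * L * j"
        by (meson degree_power_le mult_le_mono1 order_trans)
      also have "\<dots> \<le> d * L * p" using b by simp
      also have "\<dots> = Q * d" using QL by simp
      finally have "degree (P x) \<le> (s * Q + i) + Q * d" unfolding P_def x
        by (auto intro!: order_trans[OF degree_mult_le] add_mono degree_monom_le)
      also have "s * Q \<le> L * Q" using b by simp
      finally show ?thesis using b by (simp add: algebra_simps)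
    qed
  qed
  then obtain c where c: "\<exists>i\<in>I. c i \<noteq> 0" "(\<Sum>i\<in>I. smult (c i) (P i)) = 0" by auto
  \<comment> \<open>The linear system yields the \<open>Q\<close>-th powers of the coefficients of
    \<open>w\<close>; algebraic closure supplies the coefficients themselves.\<close>
  have "\<exists>u. u ^ Q = c i" for i
    using nth_root_exists[of Q "c i"] L0 by auto
  then obtain u where u: "\<And>i. u i ^ Q = c i" by metis
  define R where "R = (\<lambda>(s, i, j). monom 1 (s + i * Q) * h ^ j)"
  define w where "w = (\<Sum>i\<in>I. smult (u i) (R i))"
  have dR: "degree (R (s, i, j)) = s + L * (i * p + j * d)" for s i j
    unfolding R_def using h0 dh
    by (simp add: degree_mult_eq degree_power_eq degree_monom_eq QL algebra_simps)
  have injR: "inj_on (\<lambda>i. degree (R i)) I"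
  proof (rule inj_onI)
    fix x y assume xy: "x \<in> I" "y \<in> I" "degree (R x) = degree (R y)"
    obtain s i j s' i' j' where x: "x = (s, i, j)" and y: "y = (s', i', j')"
      using prod_cases3 by metis
    have a: "(s, i, j) \<in> I" "(s', i', j') \<in> I"
      and e: "degree (R (s, i, j)) = degree (R (s', i', j'))" using xy by (auto simp: x y)
    have b: "s < L" "s' < L" "j < p" "j' < p" using a by (auto simp: I_def)
    have e': "s + L * (i * p + j * d) = s' + L * (i' * p + j' * d)" using e by (simp only: dR)
    then have "(s + L * (i * p + j * d)) mod L = (s' + L * (i' * p + j' * d)) mod L" by simp
    then have s: "s = s'" using b by simp
    then have ij: "i * p + j * d = i' * p + j' * d" using e' L0 by simp
    \<comment> \<open>Modulo \<open>p\<close> only the terms in \<open>j\<close> remain, and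
      \<open>d\<close> is invertible there; both \<open>j\<close> and \<open>j'\<close> lie below
      \<open>p\<close>.\<close>
    then have "(int j - int j') * int d = (int i' - int i) * int p"
      by (simp add: algebra_simps flip: of_nat_mult of_nat_add)
    then have "int p dvd (int j - int j') * int d" by simp
    then have "int p dvd int j - int j'"
      using d(2) by (simp add: coprime_dvd_mult_left_iff coprime_commute d_def)
    then have j: "j = j'" using b dvd_imp_le_int[of "int j - int j'" "int p"] by (cases "j = j'") (auto simp: abs_if split: if_splits)
    then have "i = i'" using ij p by auto
    then show "x = y" using s j by (simp add: x y)
  qed
  have w0: "w \<noteq> 0" unfolding w_def
  proof (rule distinct_degrees_independent[OF finI injR])
    show "R i \<noteq> 0" if "i \<in> I" for i using h0 by (auto simp: R_def split: prod.splits)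
    show "\<exists>i\<in>I. u i \<noteq> 0" using c u L0 by (metis power_eq_0_iff)
  qed
  have dw: "degree w \<le> p ^ Suc b * (p ^ b + 2 * degree f)" unfolding w_def
  proof (rule degree_sum_le[OF finI])
    fix x assume "x \<in> I"
    then obtain s i j where x: "x = (s, i, j)" and b: "s < L" "i \<le> K" "j < p" by (auto simp: I_def)
    have "degree (smult (u x) (R x)) \<le> s + L * (i * p + j * d)"
      unfolding x using dR by (metis degree_smult_le)
    also have "\<dots> \<le> L + L * (K * p + (p - 1) * d)"
      using b by (intro add_mono mult_mono) auto
    also have "\<dots> = L * (K * p + (p - 1) * d + 1)" by (simp add: algebra_simps)
    also have "\<dots> \<le> L * (K * p + p * d)"
    proof (rule mult_le_mono2)
      have "(p - 1) * d + 1 \<le> p * d" using d p by (cases p) (auto simp: d_def)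
      then show "K * p + (p - 1) * d + 1 \<le> K * p + p * d" by linarith
    qed
    also have "\<dots> = Q * (L + 2 * d)" by (simp add: QL K_def algebra_simps)
    finally show "degree (smult (u x) (R x)) \<le> p ^ Suc b * (p ^ b + 2 * degree f)"
      by (simp add: Q_def L_def d_def)
  qed
  have "{x \<in> Fsub (p ^ (2 * Suc b)). trace_Fp p (2 * Suc b) (poly f x) = t} \<subseteq> {x. poly w x = 0}"
  proof clarify
    fix x assume x: "x \<in> Fsub (p ^ (2 * Suc b))" and t: "t = trace_Fp p (2 * Suc b) (poly f x)"
    have xQ: "(x ^ Q) ^ Q = x" using x unfolding Fsub_def Q_def
      by (simp only: mem_Collect_eq mult_2 power_add power_mult)
    have hx: "poly h x = (\<Sum>i<Suc b. poly f x ^ p ^ i)" unfolding h_def by (simp add: poly_sum)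
    have "t = (\<Sum>i<Suc b + Suc b. poly f x ^ p ^ i)"
      unfolding t trace_Fp_def by (simp add: mult_2)
    also have "\<dots> = poly h x + (\<Sum>i<Suc b. poly f x ^ p ^ (i + Suc b))"
      unfolding hx by (rule sum_lessThan_add)
    also have "(\<Sum>i<Suc b. poly f x ^ p ^ (i + Suc b)) = poly h x ^ Q"
      unfolding hx Q_def frob_sum by (simp only: power_add power_mult)
    finally have hQ: "poly h x ^ Q = t - poly h x" by simp
    have "poly w x ^ Q = (\<Sum>i\<in>I. u i ^ Q * poly (R i) x ^ Q)"
      unfolding w_def poly_sum Q_def frob_sum by (simp add: power_mult_distrib)
    also have "\<dots> = (\<Sum>i\<in>I. c i * poly (P i) x)"
    proof (intro sum.cong refl)
      fix y assume "y \<in> I"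
      obtain s i j where y: "y = (s, i, j)" by (cases y) auto
      have "poly (R y) x ^ Q = (x ^ Q) ^ s * ((x ^ Q) ^ Q) ^ i * (poly h x ^ Q) ^ j"
        by (simp add: y R_def poly_monom power_mult_distrib power_add mult_ac flip: power_mult)
      also have "\<dots> = poly (P y) x"
        unfolding xQ hQ by (simp add: y P_def poly_monom power_add mult_ac flip: power_mult)
      finally show "u y ^ Q * poly (R y) x ^ Q = c y * poly (P y) x" by (simp add: u)
    qed
    also have "\<dots> = poly (\<Sum>i\<in>I. smult (c i) (P i)) x" by (simp add: poly_sum)
    finally show "poly w x = 0" using c by simp
  qed
  then have "card {x \<in> Fsub (p ^ (2 * Suc b)). trace_Fp p (2 * Suc b) (poly f x) = t} \<le> card {x. poly w x = 0}"
    by (intro card_mono poly_roots_finite w0)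
  also have "\<dots> \<le> degree w" by (rule card_poly_roots_bound[OF w0])
  finally show ?thesis using dw by simp
qed

lemma poly_in_Fsub:
  fixes x :: 'k
  shows "(\<And>i. coeff f i \<in> Fsub (p ^ k)) \<Longrightarrow> x \<in> Fsub (p ^ k) \<Longrightarrow> poly f x \<in> Fsub (p ^ k)"
  by (auto simp: poly_altdef intro!: Fsub_sum Fsub_mult Fsub_power)

lemma sum_psi_Fp: "(\<Sum>t\<in>Fsub p. \<psi> t) = 0"
proof -
  obtain y where y: "y \<in> Fsub p" "\<psi> y \<noteq> 1" using \<psi> unfolding nontriv_add_char_def by auto
  have cl: "a + b \<in> Fsub p" "a - b \<in> Fsub p" if "a \<in> Fsub p" "b \<in> Fsub p" for a b :: 'k
    using Fsub_add[of a 1 b] Fsub_diff[of a 1 b] that by auto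
  have "(\<Sum>t\<in>Fsub p. \<psi> t) = (\<Sum>t\<in>Fsub p. \<psi> (t + y))"
    by (rule sum.reindex_bij_witness[where i = "\<lambda>t. t + y" and j = "\<lambda>t. t - y"]) (use y cl in auto)
  also have "\<dots> = (\<Sum>t\<in>Fsub p. \<psi> t) * \<psi> y"
    unfolding sum_distrib_right using \<psi> y by (intro sum.cong) (auto simp: nontriv_add_char_def)
  finally have "(\<Sum>t\<in>Fsub p. \<psi> t) * (1 - \<psi> y) = 0" by (simp add: algebra_simps)
  then show ?thesis using y by simp
qed

text \<open>Upper bounds for the fibres are enough. All \<open>p\<close> fibres share the bound
  \<open>B\<close>, and subtracting \<open>B\<close> from each fibre size does not change the sum
  because the values of \<open>\<psi>\<close> add up to 0. The deficits \<open>B - N t\<close> are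
  nonnegative, so they add up to \<open>p * B\<close> minus the number of points, where the main
  terms cancel.\<close>

lemma norm_char_sum_le:
  fixes f :: "'k poly"
  assumes d: "degree f > 0" "coprime (degree f) p" and L: "p ^ b > degree f"
    and f: "\<And>i. coeff f i \<in> Fsub (p ^ (2 * Suc b))"
  shows "norm (\<Sum>x\<in>Fsub (p ^ (2 * Suc b)). \<psi> (trace_Fp p (2 * Suc b) (poly f x)))
           \<le> 2 * degree f * p * p ^ Suc b"
proof -
  define F where "F = (Fsub (p ^ (2 * Suc b)) :: 'k set)"
  define T where "T = (\<lambda>x. trace_Fp p (2 * Suc b) (poly f x))"
  define N where "N = (\<lambda>t. card {x\<in>F. T x = t})"
  define B where "B = p ^ Suc b * (p ^ b + 2 * degree f)"
  have Fp: "finite (Fsub p :: 'k set)" "card (Fsub p :: 'k set) = p" using card_Fsub[of 1] by auto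
  have F: "finite F" "card F = p ^ (2 * Suc b)" using card_Fsub[of "2 * Suc b"] by (auto simp: F_def)
  have T: "T x \<in> Fsub p" if "x \<in> F" for x unfolding T_def
    using f that by (intro trace_Fp_in poly_in_Fsub) (simp_all only: F_def)
  have NB: "N t \<le> B" for t using card_trace_fibre_le[OF d L] by (simp add: N_def B_def F_def T_def)
  have "(\<Sum>x\<in>F. \<psi> (T x)) = (\<Sum>t\<in>Fsub p. \<Sum>x\<in>{x\<in>F. T x = t}. \<psi> (T x))"
    by (rule sum.group[symmetric]) (use F Fp T in auto)
  also have "\<dots> = (\<Sum>t\<in>Fsub p. of_nat (N t) * \<psi> t)" by (simp add: N_def)
  also have "\<dots> = (\<Sum>t\<in>Fsub p. of_nat (N t) * \<psi> t) - of_nat B * (\<Sum>t\<in>Fsub p. \<psi> t)"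
    by (simp add: sum_psi_Fp)
  also have "\<dots> = (\<Sum>t\<in>Fsub p. (of_nat (N t) - of_nat B) * \<psi> t)"
    by (simp add: sum_distrib_left sum_subtractf algebra_simps)
  finally have "norm (\<Sum>x\<in>F. \<psi> (T x)) \<le> (\<Sum>t\<in>(Fsub p::'k set). real B - real (N t))"
  proof (simp, intro sum_norm_le)
    fix t :: 'k assume t: "t \<in> Fsub p"
    have "norm ((of_nat (N t) - of_nat B) * \<psi> t) = norm (of_real (real (N t) - real B) :: complex)"
      using \<psi> t by (simp add: norm_mult nontriv_add_char_def)
    also have "\<dots> = real B - real (N t)" unfolding norm_of_real using NB[of t] by simp
    finally show "norm ((of_nat (N t) - of_nat B) * \<psi> t) \<le> real B - real (N t)" by simp
  qed
  moreover have "(\<Sum>t\<in>(Fsub p::'k set). N t) = card F"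
    using sum.group[OF F(1) Fp(1), of T "\<lambda>_. 1::nat"] T by (simp add: N_def image_subset_iff)
  moreover have "(\<Sum>t\<in>(Fsub p::'k set). real B - real (N t)) = real p * B - real (\<Sum>t\<in>(Fsub p::'k set). N t)"
    by (simp add: sum_subtractf Fp)
  moreover have "real p * B - real (card F) = 2 * degree f * p * p ^ Suc b"
  proof -
    have "card F = p ^ Suc b * (p * p ^ b)" unfolding F(2) by (simp only: mult_2 power_add power_Suc)
    then show ?thesis unfolding B_def by (simp add: algebra_simps)
  qed
  ultimately show ?thesis unfolding F_def T_def by linarith
qed

end

section \<open>The L-polynomial and its zeros\<close>

definition root_poly :: "'a::field multiset \<Rightarrow> 'a poly" where
  "root_poly M = (\<Prod>x\<in>#M. [:-x, 1:])"

definition recip_poly :: "'a::field multiset \<Rightarrow> 'a poly" where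
  "recip_poly M = (\<Prod>x\<in>#M. [:1, -x:])"

lemma root_poly_nonzero: "root_poly M \<noteq> 0"
  by (auto simp: root_poly_def prod_mset_zero_iff)

lemma proots_root_poly: "proots (root_poly M) = M"
proof (induction M)
  case (add x M)
  have "proots (root_poly (add_mset x M)) = proots ([:-x, 1:] * root_poly M)" by (simp add: root_poly_def)
  also have "\<dots> = {#x#} + M" using add root_poly_nonzero[of M] by (subst proots_mult) auto
  finally show ?case by simp
qed (simp add: root_poly_def)

lemma degree_root_poly: "degree (root_poly M) = size M"
proof (induction M)
  case (add x M)
  have "degree (root_poly (add_mset x M)) = degree ([:-x, 1:] * root_poly M)" by (simp add: root_poly_def)
  also have "\<dots> = Suc (size M)" using add root_poly_nonzero[of M] by (subst degree_mult_eq) auto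
  finally show ?case by simp
qed (simp add: root_poly_def)

lemma reflect_linear_factor: "reflect_poly [:-x, 1:] = [:1, - (x::'a::field):]"
  by (rule poly_eqI) (auto simp: coeff_reflect_poly coeff_pCons split: nat.splits)

lemma recip_poly_eq_reflect: "recip_poly M = reflect_poly (root_poly M)"
proof (induction M)
  case (add x M)
  have "reflect_poly (root_poly (add_mset x M)) = reflect_poly ([:-x, 1:] * root_poly M)"
    by (simp only: root_poly_def image_mset_add_mset prod_mset.add_mset)
  then show ?case using add.IH by (simp only: reflect_poly_mult reflect_linear_factor) (simp add: recip_poly_def)
qed (simp add: root_poly_def recip_poly_def)

lemma coeff_recip_poly:
  "coeff (recip_poly M) i = (if i > size M then 0 else coeff (root_poly M) (size M - i))"
  by (simp add: recip_poly_eq_reflect coeff_reflect_poly degree_root_poly)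

lemma coeff_recip_poly_0 [simp]: "coeff (recip_poly M) 0 = 1"
  by (induction M) (auto simp: recip_poly_def coeff_mult)

text \<open>Equal sizes are required because a root 0 contributes the factor 1 and leaves no trace
  in \<open>recip_poly\<close>.\<close>

lemma recip_poly_inj:
  assumes "size M = size N" "recip_poly M = recip_poly N"
  shows "M = N"
proof -
  have "coeff (root_poly M) j = coeff (root_poly N) j" for j
  proof (cases "j \<le> size M")
    case True
    then show ?thesis using assms coeff_recip_poly[of M "size M - j"] coeff_recip_poly[of N "size M - j"]
      by (simp split: if_splits)
  next
    case False
    then show ?thesis using assms degree_root_poly[of M] degree_root_poly[of N] by (simp add: coeff_eq_0)
  qed
  then have "root_poly M = root_poly N" by (rule poly_eqI)
  then show ?thesis using proots_root_poly by metis
qed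

text \<open>The roots are those of the reversal taken with respect to \<open>m\<close>. If the
  degree of \<open>P\<close> is smaller than \<open>m\<close>, the gap is filled by roots 0.\<close>

lemma recip_poly_exists:
  fixes P :: "'a::alg_closed_field poly"
  assumes "coeff P 0 = 1" "degree P \<le> m"
  shows "\<exists>M. size M = m \<and> recip_poly M = P"
proof -
  define g where "g = (\<Sum>i\<le>m. monom (coeff P (m - i)) i)"
  have cg: "coeff g i = (if i \<le> m then coeff P (m - i) else 0)" for i
    by (simp add: g_def coeff_sum sum.delta')
  have "degree g \<le> m" by (rule degree_le) (simp add: cg)
  moreover have "coeff g m = 1" by (simp add: cg assms)
  ultimately have dg: "degree g = m" by (metis le_antisym le_degree zero_neq_one)
  have "g \<noteq> 0" using \<open>coeff g m = 1\<close> by auto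
  then obtain A where A: "size A = m" "g = root_poly A"
    using alg_closed_imp_factorization[of g] dg \<open>coeff g m = 1\<close> unfolding root_poly_def by auto
  have "recip_poly A = P"
  proof (rule poly_eqI)
    fix i show "coeff (recip_poly A) i = coeff P i"
      using cg[of "m - i"] A assms coeff_eq_0[of P i] by (auto simp: coeff_recip_poly)
  qed
  then show ?thesis using A by auto
qed

text \<open>For a product of factors \<open>1 - x * X\<close> the sign makes the \<open>i\<close>-th
  coefficient, \<open>i > 0\<close>, the power sum of the \<open>x ^ i\<close>. The recursion
  \<open>log_deriv_nth\<close> is Newton's identity in a form without division, hence valid in
  characteristic \<open>p\<close>.\<close>

definition log_deriv :: "'a::field fps \<Rightarrow> 'a fps" where
  "log_deriv C = - (fps_X * fps_deriv C * inverse C)"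

lemma log_deriv_mult_self: "C $ 0 = 1 \<Longrightarrow> log_deriv C * C = - (fps_X * fps_deriv C)"
  by (simp add: log_deriv_def mult.assoc inverse_mult_eq_1)

lemma log_deriv_unique:
  assumes "C $ 0 = (1::'a::field)" "G * C = - (fps_X * fps_deriv C)"
  shows "log_deriv C = G"
proof -
  have "log_deriv C * C = G * C" using assms by (simp add: log_deriv_mult_self)
  moreover have "C \<noteq> 0" using assms by auto
  ultimately show ?thesis by simp
qed

lemma log_deriv_mult:
  assumes "C $ 0 = (1::'a::field)" "D $ 0 = 1"
  shows "log_deriv (C * D) = log_deriv C + log_deriv D"
proof (rule log_deriv_unique)
  have "(log_deriv C + log_deriv D) * (C * D) = (log_deriv C * C) * D + C * (log_deriv D * D)"
    by (simp add: algebra_simps)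
  also have "\<dots> = - (fps_X * fps_deriv (C * D))"
    unfolding log_deriv_mult_self[OF assms(1)] log_deriv_mult_self[OF assms(2)] by (simp add: algebra_simps)
  finally show "(log_deriv C + log_deriv D) * (C * D) = - (fps_X * fps_deriv (C * D))" .
qed (use assms in simp)

lemma log_deriv_1 [simp]: "log_deriv 1 = 0"
  by (simp add: log_deriv_def)

lemma log_deriv_nth:
  assumes "C $ 0 = (1::'a::field)"
  shows "log_deriv C $ k = - of_nat k * C $ k - (\<Sum>i<k. log_deriv C $ i * C $ (k - i))"
proof -
  have "(log_deriv C * C) $ k = (\<Sum>i<k. log_deriv C $ i * C $ (k - i)) + log_deriv C $ k"
    using assms by (simp add: fps_mult_nth atLeast0AtMost flip: lessThan_Suc_atMost)
  moreover have "(fps_X * fps_deriv C) $ k = of_nat k * C $ k"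
    by (cases k) auto
  ultimately show ?thesis using log_deriv_mult_self[OF assms] by (simp add: algebra_simps)
qed

lemma log_deriv_cong:
  assumes "C $ 0 = (1::'a::field)" "D $ 0 = 1" "\<And>i. i \<le> k \<Longrightarrow> C $ i = D $ i"
  shows "log_deriv C $ k = log_deriv D $ k"
  using assms(3)
proof (induction k rule: less_induct)
  case (less k)
  then show ?case unfolding log_deriv_nth[OF assms(1), of k] log_deriv_nth[OF assms(2), of k]
    by (intro arg_cong2[where f = minus] sum.cong) auto
qed

text \<open>In Newton's recursion at index \<open>k\<close>, the coefficient \<open>C $ k\<close>
  enters only through the term with factor \<open>k\<close>, since the term \<open>i = 0\<close>
  vanishes. With \<open>k\<close> the degree of \<open>f\<close>, this is how \<open>p\<close> not
  dividing the degree comes into play.\<close>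

lemma log_deriv_shift:
  assumes "C $ 0 = (1::'a::field)" "D $ 0 = 1" "\<And>i. i < k \<Longrightarrow> C $ i = D $ i"
  shows "log_deriv D $ k = log_deriv C $ k - of_nat k * (D $ k - C $ k)"
proof -
  have "log_deriv C $ i = log_deriv D $ i" if "i < k" for i
    by (rule log_deriv_cong) (use assms that in auto)
  moreover have "C $ (k - i) = D $ (k - i)" if "0 < i" "i < k" for i using assms(3) that by simp
  moreover have "log_deriv C $ 0 = 0" "log_deriv D $ 0 = 0" by (simp_all add: log_deriv_def)
  ultimately have "(\<Sum>i<k. log_deriv C $ i * C $ (k - i)) = (\<Sum>i<k. log_deriv D $ i * D $ (k - i))"
    by (intro sum.cong) (auto, metis gr0I mult_zero_left)
  then show ?thesis unfolding log_deriv_nth[OF assms(1), of k] log_deriv_nth[OF assms(2), of k]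
    by (simp add: algebra_simps)
qed

lemma log_deriv_linear:
  "log_deriv (fps_of_poly [:1, - (a::'a::field):]) = Abs_fps (\<lambda>i. if i = 0 then 0 else a ^ i)"
proof (rule log_deriv_unique)
  have e: "fps_of_poly [:1, -a:] = 1 - fps_const a * fps_X"
    by (simp add: fps_of_poly_pCons fps_of_poly_const algebra_simps flip: fps_const_neg)
  show "Abs_fps (\<lambda>i. if i = 0 then 0 else a ^ i) * fps_of_poly [:1, -a:]
     = - (fps_X * fps_deriv (fps_of_poly [:1, -a:]))"
  proof (rule fps_ext)
    fix i
    show "(Abs_fps (\<lambda>i. if i = 0 then 0 else a ^ i) * fps_of_poly [:1, -a:]) $ i
     = (- (fps_X * fps_deriv (fps_of_poly [:1, -a:]))) $ i"
      unfolding e by (cases i) (auto simp: algebra_simps fps_mult_fps_X_plus_1_nth fps_X_def[symmetric])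
  qed
qed simp

lemma log_deriv_recip_poly:
  assumes "i > 0"
  shows "log_deriv (fps_of_poly (recip_poly M)) $ i = (\<Sum>x\<in>#M. x ^ i)"
proof (induction M)
  case (add x M)
  have "fps_of_poly (recip_poly (add_mset x M)) = fps_of_poly [:1, -x:] * fps_of_poly (recip_poly M)"
    by (simp add: recip_poly_def fps_of_poly_mult)
  then have "log_deriv (fps_of_poly (recip_poly (add_mset x M))) =
      log_deriv (fps_of_poly [:1, -x:]) + log_deriv (fps_of_poly (recip_poly M))"
    by (simp only:) (rule log_deriv_mult, simp_all)
  then show ?case using assms add by (simp add: log_deriv_linear)
qed (simp add: recip_poly_def)

section \<open>Monic polynomials over the field with q elements and the coefficients of L\<close>

context add_char
begin

lemma frob_sum_mset: "(\<Sum>x\<in>#M. g x :: 'k) ^ (p ^ k) = (\<Sum>x\<in>#M. g x ^ (p ^ k))"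
  by (induction M) (simp_all add: frob_add)

text \<open>Reversed monic polynomials of degree \<open>m\<close>, which at the same time represent
  the series with constant term 1 modulo \<open>X ^ (m + 1)\<close>. The coefficients from 1 to
  \<open>m\<close> vary freely, which suits orthogonality.\<close>

definition unit_series :: "nat \<Rightarrow> 'k fps set" where
  "unit_series m = {C. C $ 0 = 1 \<and> (\<forall>i. C $ i \<in> Fsub q) \<and> (\<forall>i>m. C $ i = 0)}"

text \<open>Root multisets of the monic polynomials of degree \<open>m\<close> over the field with
  \<open>q\<close> elements; adding two of them multiplies the polynomials.\<close>

definition stable :: "nat \<Rightarrow> 'k multiset set" where
  "stable m = {M. size M = m \<and> image_mset (\<lambda>x. x ^ q) M = M}"

lemma coeff_recip_poly_frob:
  "coeff (recip_poly (image_mset (\<lambda>x. x ^ q) M)) i = coeff (recip_poly (M :: 'k multiset)) i ^ q"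
proof (induction M arbitrary: i)
  case empty
  then show ?case using q_ge3 by (auto simp: recip_poly_def)
next
  case (add x M)
  have *: "recip_poly (add_mset y N) = recip_poly N - smult y (pCons 0 (recip_poly N))" for y :: 'k and N
    by (simp add: recip_poly_def)
  show ?case using add by (cases i) (simp_all add: * frob_diff power_mult_distrib)
qed

lemma recip_poly_in_unit_series:
  assumes "M \<in> stable m"
  shows "fps_of_poly (recip_poly M) \<in> unit_series m"
proof -
  have "coeff (recip_poly M) i \<in> Fsub q" for i
    using coeff_recip_poly_frob[of M i] assms by (simp add: stable_def Fsub_def)
  moreover have "coeff (recip_poly M) i = 0" if "i > m" for i
    using that assms by (simp add: stable_def coeff_recip_poly)
  ultimately show ?thesis by (simp add: unit_series_def)
qed

text \<open>Applying Frobenius to the roots applies it to the coefficients, and coefficients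
  together with the degree determine the roots. Stable roots and coefficients in the field with
  \<open>q\<close> elements are therefore the same condition.\<close>

lemma bij_stable_unit_series:
  "bij_betw (\<lambda>M. fps_of_poly (recip_poly M)) (stable m) (unit_series m)"
  unfolding bij_betw_def
proof
  show "inj_on (\<lambda>M. fps_of_poly (recip_poly M)) (stable m)"
    by (auto intro!: inj_onI recip_poly_inj simp: stable_def)
  show "(\<lambda>M. fps_of_poly (recip_poly M)) ` stable m = unit_series m"
  proof (intro equalityI subsetI)
    fix C assume C: "C \<in> unit_series m"
    define P where "P = (\<Sum>i\<le>m. monom (C $ i) i)"
    have cP: "coeff P i = C $ i" for i using C
      by (auto simp: P_def coeff_sum sum.delta' unit_series_def)
    have "degree P \<le> m" by (rule degree_le) (use C in \<open>simp add: cP unit_series_def\<close>)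
    moreover have "coeff P 0 = 1" using C by (simp add: cP unit_series_def)
    ultimately obtain M where M: "size M = m" "recip_poly M = P"
      using recip_poly_exists by blast
    have "recip_poly (image_mset (\<lambda>x. x ^ q) M) = recip_poly M"
      by (rule poly_eqI) (use C in \<open>simp add: coeff_recip_poly_frob M cP unit_series_def Fsub_def\<close>)
    then have "image_mset (\<lambda>x. x ^ q) M = M" by (intro recip_poly_inj) auto
    moreover have "fps_of_poly P = C" by (rule fps_ext) (simp add: cP)
    ultimately show "C \<in> (\<lambda>M. fps_of_poly (recip_poly M)) ` stable m"
      using M by (auto simp: stable_def intro!: image_eqI[of _ _ M])
  qed (use recip_poly_in_unit_series in auto)
qed

lemma unit_series_bij:
  "bij_betw (\<lambda>C. \<lambda>i\<in>{1..m}. C $ i) (unit_series m) ({1..m} \<rightarrow>\<^sub>E Fsub q)"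
  by (rule bij_betw_byWitness[where f' = "\<lambda>c. Abs_fps (\<lambda>i. if i = 0 then 1 else if i \<le> m then c i else 0)"])
    (auto simp: unit_series_def fps_eq_iff fun_eq_iff PiE_def extensional_def)

lemma finite_unit_series [simp]: "finite (unit_series m)"
  using bij_betw_finite[OF unit_series_bij, of m] card_Fsub[OF n] by (simp add: finite_PiE)

lemma card_unit_series: "card (unit_series m) = q ^ m"
  using bij_betw_same_card[OF unit_series_bij, of m] card_Fsub[OF n] by (simp add: card_PiE)

lemma finite_stable [simp]: "finite (stable m)"
  using bij_betw_finite[OF bij_stable_unit_series, of m] by simp

lemma log_deriv_in_Fsub:
  assumes "C $ 0 = 1" "\<And>i. C $ i \<in> Fsub q"
  shows "log_deriv (C :: 'k fps) $ k \<in> Fsub q"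
proof (induction k rule: less_induct)
  case (less k)
  then show ?case unfolding log_deriv_nth[OF assms(1), of k]
    using assms by (intro Fsub_diff Fsub_mult Fsub_sum Fsub_uminus Fsub_of_nat) auto
qed

text \<open>By \<open>pairing_recip_poly\<close> this is the sum of \<open>f\<close> over the roots
  when \<open>f\<close> has no constant term. Expressed through \<open>C\<close> it makes sense for
  untruncated products too and turns them into sums.\<close>

definition pairing :: "'k poly \<Rightarrow> 'k fps \<Rightarrow> 'k" where
  "pairing f C = (\<Sum>i\<in>{1..degree f}. coeff f i * log_deriv C $ i)"

definition series_char :: "'k poly \<Rightarrow> 'k fps \<Rightarrow> complex" where
  "series_char f C = ech (pairing f C)"

text \<open>The Dirichlet series form of the L-function, a sum over monic polynomials of degree
  \<open>m\<close>; \<open>L_fps_nth\<close> identifies it with the exponential form.\<close>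

definition L_coeff :: "'k poly \<Rightarrow> nat \<Rightarrow> complex" where
  "L_coeff f m = (\<Sum>C\<in>unit_series m. series_char f C)"

definition mset_char :: "'k poly \<Rightarrow> 'k multiset \<Rightarrow> complex" where
  "mset_char f M = ech (\<Sum>x\<in>#M. poly f x)"

lemma pairing_recip_poly:
  assumes "coeff f 0 = 0"
  shows "pairing f (fps_of_poly (recip_poly M)) = (\<Sum>x\<in>#M. poly f x)"
proof -
  have "poly f x = (\<Sum>i\<in>{1..degree f}. coeff f i * x ^ i)" for x
    using assms unfolding poly_altdef atMost_atLeast0 by (subst sum.atLeast_Suc_atMost) auto
  then have "(\<Sum>x\<in>#M. poly f x) = (\<Sum>x\<in>#M. \<Sum>i\<in>{1..degree f}. coeff f i * x ^ i)" by simp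
  also have "\<dots> = (\<Sum>i\<in>{1..degree f}. \<Sum>x\<in>#M. coeff f i * x ^ i)"
    by (induction M) (simp_all add: sum.distrib)
  also have "\<dots> = pairing f (fps_of_poly (recip_poly M))" unfolding pairing_def
    by (intro sum.cong) (simp_all add: log_deriv_recip_poly sum_mset_distrib_left)
  finally show ?thesis by simp
qed

lemma L_coeff_stable: "coeff f 0 = 0 \<Longrightarrow> L_coeff f m = (\<Sum>M\<in>stable m. mset_char f M)"
  unfolding L_coeff_def mset_char_def series_char_def
  by (subst sum.reindex_bij_betw[OF bij_stable_unit_series, symmetric]) (simp add: pairing_recip_poly)

lemma poly_frob:
  assumes "\<And>i. coeff f i \<in> Fsub q"
  shows "poly f (x :: 'k) ^ q = poly f (x ^ q)"
  unfolding poly_altdef frob_sum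
proof (intro sum.cong refl)
  fix i
  have "coeff f i ^ q = coeff f i" using assms by (simp add: Fsub_def)
  then show "(coeff f i * x ^ i) ^ q = coeff f i * (x ^ q) ^ i"
    by (simp add: power_mult_distrib power_mult[symmetric] mult.commute)
qed

lemma poly_frob_iterate:
  assumes "\<And>i. coeff f i \<in> Fsub q"
  shows "poly f (x :: 'k) ^ q ^ j = poly f (x ^ q ^ j)"
proof (induction j)
  case (Suc j)
  have "poly f x ^ q ^ Suc j = (poly f x ^ q ^ j) ^ q" by (simp only: power_Suc2 power_mult)
  also have "\<dots> = poly f (x ^ q ^ Suc j)"
    unfolding Suc poly_frob[OF assms] by (simp add: mult.commute flip: power_mult)
  finally show ?case .
qed simp

lemma sum_stable_in_Fsub:
  assumes f: "\<And>i. coeff f i \<in> Fsub q" and M: "M \<in> stable m"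
  shows "(\<Sum>x\<in>#M. poly f x) \<in> Fsub q"
proof -
  have "(\<Sum>x\<in>#M. poly f x) ^ q = (\<Sum>x\<in>#M. poly f (x ^ q))"
    by (simp add: frob_sum_mset poly_frob[OF f])
  also have "\<dots> = (\<Sum>x\<in>#image_mset (\<lambda>x. x ^ q) M. poly f x)" by (simp add: multiset.map_comp comp_def)
  finally show ?thesis using M by (simp add: Fsub_def stable_def)
qed

lemma mset_char_add:
  assumes "\<And>i. coeff f i \<in> Fsub q" "M \<in> stable m" "N \<in> stable l"
  shows "mset_char f (M + N) = mset_char f M * mset_char f N"
  unfolding mset_char_def using assms sum_stable_in_Fsub by (simp add: ech_add)

section \<open>Frobenius orbits and Newton's identity for L\<close>

definition orb :: "'k \<Rightarrow> nat \<Rightarrow> 'k multiset" where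
  "orb x r = image_mset (\<lambda>j. x ^ q ^ j) (mset_set {..<r})"

lemma size_orb [simp]: "size (orb x r) = r" by (simp add: orb_def)

lemma orb_Suc: "orb x (Suc r) = add_mset (x ^ q ^ r) (orb x r)"
  by (simp add: orb_def lessThan_Suc)

lemma sum_orb: "(\<Sum>y\<in>#orb x r. g y) = (\<Sum>j<r. g (x ^ q ^ j))"
  by (induction r) (simp_all add: orb_def lessThan_Suc add.commute)

lemma q_power: "q ^ j = p ^ (n * j)" by (simp add: power_mult)

lemma orb_stable:
  assumes "x \<in> Fsub (p ^ (n * r))"
  shows "orb x r \<in> stable r"
proof -
  have "add_mset x (image_mset (\<lambda>y. y ^ q) (orb x r)) = orb x (Suc r)" for r
  proof (induction r)
    case (Suc r)
    have "add_mset x (image_mset (\<lambda>y. y ^ q) (orb x (Suc r)))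
        = add_mset (x ^ q ^ Suc r) (add_mset x (image_mset (\<lambda>y. y ^ q) (orb x r)))"
      by (simp add: orb_Suc mult.commute flip: power_mult)
    then show ?case using Suc by (simp add: orb_Suc)
  qed (simp add: orb_def lessThan_Suc)
  from this[of r] show ?thesis using assms by (simp add: stable_def orb_Suc Fsub_def q_power)
qed

lemma char_sum_orb:
  assumes "\<And>i. coeff f i \<in> Fsub q"
  shows "char_sum p n \<psi> f r = (\<Sum>x\<in>Fsub (p ^ (n * r)). mset_char f (orb x r))"
  unfolding char_sum_def mset_char_def ech_def
  by (simp add: trace_Fp_tower sum_orb poly_frob_iterate[OF assms])

lemma inj_frob: "inj (\<lambda>x::'k. x ^ q)"
  by (intro injI) (simp add: frob_inj)

lemma count_image_mset_inj: "inj f \<Longrightarrow> count (image_mset f M) (f x) = count M x"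
  by (induction M) (auto dest: injD)

lemma count_stable_frob:
  assumes "M \<in> stable m"
  shows "count M (x ^ q ^ j) = count M x"
proof (induction j)
  case (Suc j)
  have "count M ((x ^ q ^ j) ^ q) = count (image_mset (\<lambda>x. x ^ q) M) ((x ^ q ^ j) ^ q)"
    using assms by (simp add: stable_def)
  also have "\<dots> = count M (x ^ q ^ j)"
    using count_image_mset_inj[OF inj_frob, of M "x ^ q ^ j"] by simp
  finally show ?case using Suc by (simp add: mult.commute flip: power_mult)
qed simp

lemma orb_add:
  assumes "x \<in> Fsub (p ^ (n * a))"
  shows "orb x (a + b) = orb x a + orb x b"
proof (induction b)
  case (Suc b)
  have "x ^ q ^ (a + b) = (x ^ q ^ a) ^ q ^ b" by (simp add: power_add power_mult)
  also have "x ^ q ^ a = x" using assms by (simp add: Fsub_def q_power)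
  finally show ?case using Suc by (simp add: orb_Suc)
qed (simp add: orb_def)

lemma Fsub_mono_dvd: "e dvd r \<Longrightarrow> x \<in> Fsub (p ^ (n * e)) \<Longrightarrow> (x::'k) \<in> Fsub (p ^ (n * r))"
  by (rule Fsub_dvd) auto

lemma orb_times:
  assumes "x \<in> Fsub (p ^ (n * e))"
  shows "orb x (e * j) = repeat_mset j (orb x e)"
proof (induction j)
  case (Suc j)
  then show ?case using orb_add[OF assms, of "e * j"] by simp
qed (simp add: orb_def)

text \<open>The degree of \<open>x\<close> over the field with \<open>q\<close> elements; it is 0 when \<open>x\<close> is
  transcendental.\<close>

definition fdeg :: "'k \<Rightarrow> nat" where
  "fdeg x = (if \<exists>r>0. x \<in> Fsub (p ^ (n * r)) then LEAST r. r > 0 \<and> x \<in> Fsub (p ^ (n * r)) else 0)"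

lemma fdeg_props:
  assumes "x \<in> Fsub (p ^ (n * r))" "r > 0"
  shows "fdeg x > 0" "x \<in> Fsub (p ^ (n * fdeg x))" "\<And>s. s > 0 \<Longrightarrow> x \<in> Fsub (p ^ (n * s)) \<Longrightarrow> fdeg x \<le> s"
proof -
  have ex: "\<exists>r>0. x \<in> Fsub (p ^ (n * r))" using assms by blast
  then have e: "fdeg x = (LEAST r. r > 0 \<and> x \<in> Fsub (p ^ (n * r)))" by (simp add: fdeg_def)
  have "fdeg x > 0 \<and> x \<in> Fsub (p ^ (n * fdeg x))"
    unfolding e using ex by (rule LeastI_ex[of "\<lambda>r. r > 0 \<and> x \<in> Fsub (p ^ (n * r))", simplified])
  then show "fdeg x > 0" "x \<in> Fsub (p ^ (n * fdeg x))" by auto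
  show "fdeg x \<le> s" if "s > 0" "x \<in> Fsub (p ^ (n * s))" for s
    unfolding e using that by (intro Least_le) auto
qed

lemma Fsub_iff_fdeg_dvd:
  assumes "x \<in> Fsub (p ^ (n * r))" "r > 0"
  shows "x \<in> Fsub (p ^ (n * s)) \<longleftrightarrow> fdeg x dvd s"
proof
  note e = fdeg_props[OF assms]
  assume x: "x \<in> Fsub (p ^ (n * s))"
  let ?e = "fdeg x"
  have "x ^ q ^ (s div ?e * ?e) = x"
    using Fsub_iterate[OF e(2), of "s div ?e"] by (simp add: q_power mult_ac)
  then have "x ^ q ^ s = x ^ q ^ (s mod ?e)"
    by (metis div_mult_mod_eq power_add power_mult)
  then have "x \<in> Fsub (p ^ (n * (s mod ?e)))" using x by (simp add: Fsub_def q_power)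
  then show "?e dvd s" using e by (metis dvd_eq_mod_eq_0 gr0I leD mod_less_divisor)
qed (use fdeg_props[OF assms] Fsub_mono_dvd in auto)

lemma power_power_split: "i \<le> j \<Longrightarrow> (x::'k) ^ b ^ j = (x ^ b ^ (j - i)) ^ b ^ i"
  by (metis le_add_diff_inverse2 power_add power_mult)

lemma count_orb_fdeg:
  assumes "x \<in> Fsub (p ^ (n * r))" "r > 0"
  shows "count (orb x (fdeg x)) y = (if y \<in># orb x (fdeg x) then 1 else 0)"
proof -
  note e = fdeg_props[OF assms]
  let ?e = "fdeg x"
  have inj: "inj_on (\<lambda>j. x ^ q ^ j) {..<?e}"
  proof (rule linorder_inj_onI)
    fix i j assume ij: "i < j" "i \<in> {..<?e}" "j \<in> {..<?e}"
    show "x ^ q ^ i \<noteq> x ^ q ^ j"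
    proof
      assume eq: "x ^ q ^ i = x ^ q ^ j"
      have "x ^ q ^ j = (x ^ q ^ (j - i)) ^ q ^ i" using ij by (intro power_power_split) simp
      then have "x = x ^ q ^ (j - i)" using eq by (simp add: q_power frob_inj)
      then have "x \<in> Fsub (p ^ (n * (j - i)))" by (simp add: Fsub_def q_power)
      then show False using e(3)[of "j - i"] ij by simp
    qed
  qed auto
  then have "orb x ?e = mset_set ((\<lambda>j. x ^ q ^ j) ` {..<?e})" unfolding orb_def
    by (simp add: image_mset_mset_set)
  then show ?thesis by (simp add: count_mset_set')
qed

lemma self_in_orb: "r > 0 \<Longrightarrow> x \<in># orb x r"
  by (auto simp: orb_def intro!: image_eqI[of _ _ 0])

lemma count_orb_self:
  assumes "x \<in> Fsub (p ^ (n * r))" "r > 0"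
  shows "count (orb x r) x = r div fdeg x"
proof -
  obtain j where j: "r = fdeg x * j" using Fsub_iff_fdeg_dvd[OF assms, of r] assms by auto
  then show ?thesis using fdeg_props[OF assms] count_orb_fdeg[OF assms, of x] self_in_orb[of "fdeg x" x]
    by (simp add: orb_times)
qed

text \<open>If \<open>x\<close> has degree \<open>e\<close>, the admissible \<open>r\<close> are the
  \<open>e * j\<close> with \<open>1 \<le> j \<le> count M x\<close>: the orbit of length
  \<open>e * j\<close> contains each conjugate \<open>j\<close> times, and \<open>M\<close> contains
  all conjugates equally often.\<close>

lemma count_stable_period:
  assumes M: "M \<in> stable m" and x: "x \<in># M"
  shows "card {r\<in>{1..m}. x \<in> Fsub (p ^ (n * r)) \<and> orb x r \<subseteq># M} = count M x"
proof -
  \<comment> \<open>A finite multiset that is closed under Frobenius has only algebraic elements: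
    two iterates of \<open>x\<close> coincide, so \<open>x\<close> lies in a finite field and has
    positive \<open>fdeg\<close>.\<close>
  have "\<not> inj_on (\<lambda>j. x ^ q ^ j) (UNIV :: nat set)"
  proof
    assume "inj_on (\<lambda>j. x ^ q ^ j) (UNIV :: nat set)"
    moreover have "(\<lambda>j. x ^ q ^ j) ` UNIV \<subseteq> set_mset M"
      using count_stable_frob[OF M, of x] x by (auto simp: image_subset_iff count_greater_zero_iff[symmetric] simp del: count_greater_zero_iff)
    ultimately show False using finite_set_mset
      by (metis finite_imageD finite_subset infinite_UNIV_nat)
  qed
  then obtain i j where ij: "i < j" "x ^ q ^ i = x ^ q ^ j"
    unfolding inj_on_def by (metis linorder_neqE_nat)
  have "x ^ q ^ j = (x ^ q ^ (j - i)) ^ q ^ i" using ij by (intro power_power_split) simp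
  then have "x = x ^ q ^ (j - i)" using ij by (simp add: q_power frob_inj)
  then have a: "x \<in> Fsub (p ^ (n * (j - i)))" "j - i > 0" using ij by (simp_all add: Fsub_def q_power)
  note e = fdeg_props[OF a]
  let ?e = "fdeg x"
  have sub: "orb x (?e * j) \<subseteq># M \<longleftrightarrow> j \<le> count M x" for j
  proof
    assume "orb x (?e * j) \<subseteq># M"
    then have "count (orb x (?e * j)) x \<le> count M x" by (rule mset_subset_eq_count)
    then show "j \<le> count M x" using e count_orb_fdeg[OF a, of x] self_in_orb[of ?e x] by (simp add: orb_times)
  next
    assume j: "j \<le> count M x"
    show "orb x (?e * j) \<subseteq># M"
    proof (rule mset_subset_eqI)
      fix y
      have "count M y = count M x" if "y \<in># orb x ?e"
        using that count_stable_frob[OF M] by (auto simp: orb_def)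
      then show "count (orb x (?e * j)) y \<le> count M y"
        using j e count_orb_fdeg[OF a, of y] by (simp add: orb_times)
    qed
  qed
  have "{r\<in>{1..m}. x \<in> Fsub (p ^ (n * r)) \<and> orb x r \<subseteq># M} = (\<lambda>j. ?e * j) ` {1..count M x}"
  proof (intro equalityI subsetI)
    fix r assume r: "r \<in> {r\<in>{1..m}. x \<in> Fsub (p ^ (n * r)) \<and> orb x r \<subseteq># M}"
    then obtain j where j: "r = ?e * j" using Fsub_iff_fdeg_dvd[OF a, of r] by auto
    moreover have "j \<ge> 1" using r j by (cases j) auto
    ultimately show "r \<in> (\<lambda>j. ?e * j) ` {1..count M x}" using r sub[of j] by (intro image_eqI[of _ _ j]) auto
  next
    fix r assume "r \<in> (\<lambda>j. ?e * j) ` {1..count M x}"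
    then obtain j where j: "r = ?e * j" "1 \<le> j" "j \<le> count M x" by (elim imageE) auto
    then have "orb x r \<subseteq># M" using sub by simp
    then have "r \<le> m" using size_mset_mono[of "orb x r" M] M by (simp add: stable_def)
    then show "r \<in> {r\<in>{1..m}. x \<in> Fsub (p ^ (n * r)) \<and> orb x r \<subseteq># M}"
      using \<open>orb x r \<subseteq># M\<close> j e Fsub_iff_fdeg_dvd[OF a, of r] by auto
  qed
  moreover have "inj_on (\<lambda>j. ?e * j) {1..count M x}" using e by (auto intro: inj_onI)
  ultimately show ?thesis by (simp add: card_image)
qed

lemma finite_Fsub: "k > 0 \<Longrightarrow> finite (Fsub (p ^ k) :: 'k set)" using card_Fsub by auto

text \<open>This plays the role of the von Mangoldt identity for the polynomial with root multiset \<open>M\<close>: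
  a pair \<open>(r, x)\<close> stands for a root of a prime together with a power of that prime dividing the
  polynomial.\<close>

lemma sum_suborbits:
  assumes M: "M \<in> stable m"
  shows "(\<Sum>r\<in>{1..m}. card {x\<in>Fsub (p ^ (n * r)). orb x r \<subseteq># M}) = m"
proof -
  have "(\<Sum>r\<in>{1..m}. card {x\<in>Fsub (p ^ (n * r)). orb x r \<subseteq># M})
      = (\<Sum>r\<in>{1..m}. card {x\<in>set_mset M. x \<in> Fsub (p ^ (n * r)) \<and> orb x r \<subseteq># M})"
  proof (intro sum.cong refl arg_cong[of _ _ card])
    fix r assume "r \<in> {1..m}"
    then have "x \<in># orb x r" for x using self_in_orb by simp
    then show "{x\<in>Fsub (p ^ (n * r)). orb x r \<subseteq># M}
        = {x\<in>set_mset M. x \<in> Fsub (p ^ (n * r)) \<and> orb x r \<subseteq># M}"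
      by (auto dest: mset_subset_eqD)
  qed
  also have "\<dots> = (\<Sum>r\<in>{1..m}. \<Sum>x\<in>set_mset M. if x \<in> Fsub (p ^ (n * r)) \<and> orb x r \<subseteq># M then 1 else 0)"
    by (simp add: sum.If_cases Int_def)
  also have "\<dots> = (\<Sum>x\<in>set_mset M. card {r\<in>{1..m}. x \<in> Fsub (p ^ (n * r)) \<and> orb x r \<subseteq># M})"
    by (subst sum.swap) (simp add: sum.If_cases Int_def)
  also have "\<dots> = (\<Sum>x\<in>set_mset M. count M x)"
    using count_stable_period[OF M] by simp
  also have "\<dots> = m" using M by (simp add: stable_def size_multiset_overloaded_eq)
  finally show ?thesis .
qed

text \<open>By \<open>sum_suborbits\<close> the factor \<open>m\<close> counts the pairs
  \<open>(r, x)\<close> whose orbit is contained in \<open>M\<close>. Splitting that orbit off from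
  \<open>M\<close> factors the character. In generating form this equates \<open>z * L' / L\<close>
  with the series of character sums.\<close>

lemma newton_identity:
  assumes f: "\<And>i. coeff f i \<in> Fsub q" "coeff f 0 = 0"
  shows "of_nat m * L_coeff f m = (\<Sum>r\<in>{1..m}. char_sum p n \<psi> f r * L_coeff f (m - r))"
proof -
  have "of_nat m * L_coeff f m
      = (\<Sum>M\<in>stable m. of_nat (\<Sum>r\<in>{1..m}. card {x\<in>Fsub (p ^ (n * r)). orb x r \<subseteq># M}) * mset_char f M)"
    unfolding L_coeff_stable[OF f(2)] sum_distrib_left
    by (intro sum.cong refl) (simp only: sum_suborbits)
  also have "\<dots> = (\<Sum>M\<in>stable m. \<Sum>r\<in>{1..m}. \<Sum>x\<in>Fsub (p ^ (n * r)). if orb x r \<subseteq># M then mset_char f M else 0)"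
    using n by (simp add: sum_distrib_right sum.If_cases Int_def finite_Fsub)
  also have "\<dots> = (\<Sum>r\<in>{1..m}. \<Sum>x\<in>Fsub (p ^ (n * r)). \<Sum>M\<in>stable m. if orb x r \<subseteq># M then mset_char f M else 0)"
    by (subst sum.swap) (intro sum.cong refl sum.swap)
  also have "\<dots> = (\<Sum>r\<in>{1..m}. \<Sum>x\<in>Fsub (p ^ (n * r)). mset_char f (orb x r) * L_coeff f (m - r))"
  proof (intro sum.cong refl)
    fix r and x :: 'k assume r: "r \<in> {1..m}" and x: "x \<in> Fsub (p ^ (n * r))"
    note o = orb_stable[OF x]
    have "(\<Sum>M\<in>stable m. if orb x r \<subseteq># M then mset_char f M else 0)
        = (\<Sum>M\<in>{M\<in>stable m. orb x r \<subseteq># M}. mset_char f M)"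
      by (simp add: sum.If_cases Int_def)
    also have "\<dots> = (\<Sum>N\<in>stable (m - r). mset_char f (orb x r + N))"
    proof (rule sum.reindex_bij_witness[where i = "\<lambda>N. orb x r + N" and j = "\<lambda>M. M - orb x r"])
      fix N assume N: "N \<in> stable (m - r)"
      then show "orb x r + N \<in> {M \<in> stable m. orb x r \<subseteq># M}" using o r by (auto simp: stable_def)
    next
      fix M assume M: "M \<in> {M \<in> stable m. orb x r \<subseteq># M}"
      then obtain N where N: "M = orb x r + N" by (auto simp: mset_subset_eq_exists_conv)
      have "image_mset (\<lambda>x. x ^ q) N = N" using M o N by (simp add: stable_def)
      then show "M - orb x r \<in> stable (m - r)" using M N by (auto simp: stable_def)
    qed auto
    also have "\<dots> = mset_char f (orb x r) * L_coeff f (m - r)"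
      unfolding L_coeff_stable[OF f(2)] sum_distrib_left
      by (intro sum.cong refl mset_char_add[OF f(1) o]) auto
    finally show "(\<Sum>M\<in>stable m. if orb x r \<subseteq># M then mset_char f M else 0)
        = mset_char f (orb x r) * L_coeff f (m - r)" .
  qed
  also have "\<dots> = (\<Sum>r\<in>{1..m}. char_sum p n \<psi> f r * L_coeff f (m - r))"
    by (simp add: char_sum_orb[OF f(1)] sum_distrib_right)
  finally show ?thesis .
qed

lemma L_coeff_0: "L_coeff f 0 = 1"
proof -
  have "unit_series 0 = {1}" by (auto simp: unit_series_def fps_eq_iff)
  then show ?thesis by (simp add: L_coeff_def series_char_def pairing_def)
qed

definition log_L :: "'k poly \<Rightarrow> complex fps" where
  "log_L f = Abs_fps (\<lambda>r. if r = 0 then 0 else char_sum p n \<psi> f r / of_nat r)"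

lemma deriv_L_fps: "fps_deriv (L_fps p n \<psi> f) = L_fps p n \<psi> f * fps_deriv (log_L f)"
  unfolding L_fps_def log_L_def[symmetric]
  by (subst fps_compose_deriv) (auto simp: log_L_def)

lemma L_fps_0: "L_fps p n \<psi> f $ 0 = 1"
  unfolding L_fps_def by simp

text \<open>The exponential series satisfies the recursion of \<open>newton_identity\<close>, as
  \<open>deriv_L_fps\<close> shows on comparing coefficients.\<close>

lemma L_fps_nth:
  assumes f: "\<And>i. coeff f i \<in> Fsub q" "coeff f 0 = 0"
  shows "L_fps p n \<psi> f $ m = L_coeff f m"
proof (induction m rule: less_induct)
  case (less m)
  show ?case
  proof (cases m)
    case 0
    then show ?thesis by (simp add: L_fps_0 L_coeff_0)
  next
    case (Suc k)
    let ?L = "L_fps p n \<psi> f"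
    have "of_nat m * ?L $ m = fps_deriv ?L $ k" by (simp add: Suc)
    also have "\<dots> = (\<Sum>i=0..k. ?L $ i * char_sum p n \<psi> f (m - i))"
      unfolding deriv_L_fps fps_mult_nth by (intro sum.cong) (auto simp: log_L_def Suc Suc_diff_le simp del: of_nat_Suc)
    also have "\<dots> = (\<Sum>r\<in>{1..m}. char_sum p n \<psi> f r * L_coeff f (m - r))"
      by (rule sum.reindex_bij_witness[where i = "\<lambda>r. m - r" and j = "\<lambda>i. m - i"]) (auto simp: Suc less)
    also have "\<dots> = of_nat m * L_coeff f m" using newton_identity[OF f, of m] by simp
    finally show ?thesis using Suc by (simp del: of_nat_Suc)
  qed
qed

end

text \<open>Simultaneous Dirichlet approximation provides large exponents for which all powers point
  close to the positive real axis. Then nothing cancels, and a single element of absolute value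
  above 1 would make the sum exceed any bound.\<close>

lemma bounded_power_sums_imp_norm_le_1:
  fixes B :: "complex multiset"
  assumes "\<And>k. k \<ge> k0 \<Longrightarrow> norm (\<Sum>x\<in>#B. x ^ k) \<le> C" and "b \<in># B"
  shows "norm b \<le> 1"
proof (rule ccontr)
  assume "\<not> norm b \<le> 1"
  then have b: "norm b > 1" by simp
  obtain K where K: "norm b ^ K > 2 * C" using real_arch_pow[OF b] by blast
  \<comment> \<open>The approximation is applied to the arguments multiplied by \<open>m\<close>, so
    that the exponent \<open>m * c\<close> is large enough whatever \<open>c\<close> turns out to
    be.\<close>
  define m where "m = max (max K k0) 1"
  have m: "m \<ge> k0" "m \<ge> K" "m \<ge> 1" by (auto simp: m_def)
  obtain xs where xs: "mset xs = B" using ex_mset by auto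
  define \<theta> where "\<theta> = (\<lambda>i. real m * Arg (xs ! i) / (2 * pi))"
  obtain c r where c: "0 < c" and r: "\<And>i. i < length xs \<Longrightarrow> \<bar>of_int c * \<theta> i - of_int (r i)\<bar> < 1 / real 8"
    using Dirichlet_approx_simult[of 8 "length xs" \<theta>] by (metis zero_less_numeral)
  define k where "k = m * nat c"
  have k: "k \<ge> k0" "k \<ge> K" using m c unfolding k_def
    by (metis One_nat_def Suc_leI le_trans mult.right_neutral mult_le_mono2 zero_less_nat_eq)+
  have re: "Re (x ^ k) \<ge> norm x ^ k / 2" if "x \<in> set xs" for x
  proof -
    have "\<exists>i. i < length xs \<and> xs ! i = x" using that by (simp only: in_set_conv_nth)
    then obtain i where i: "i < length xs" "xs ! i = x" by (elim exE conjE)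
    define \<phi> where "\<phi> = real k * Arg x - 2 * pi * of_int (r i)"
    have "\<phi> = 2 * pi * (of_int c * \<theta> i - of_int (r i))"
    proof -
      have "2 * pi * \<theta> i = real m * Arg x" unfolding \<theta>_def i by simp
      moreover have "real k = real m * of_int c" unfolding k_def using c by simp
      moreover have "2 * pi * (of_int c * \<theta> i - of_int (r i)) = of_int c * (2 * pi * \<theta> i) - 2 * pi * of_int (r i)"
        by (simp only: right_diff_distrib mult_ac)
      ultimately show ?thesis unfolding \<phi>_def by algebra
    qed
    then have "\<bar>\<phi>\<bar> = 2 * pi * \<bar>of_int c * \<theta> i - of_int (r i)\<bar>" by (simp add: abs_mult)
    \<comment> \<open>The precision \<open>1 / 8\<close> keeps the angle within
      \<open>pi / 4\<close>, below \<open>pi / 3\<close>, and there the cosine is at least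
      \<open>1 / 2\<close>.\<close>
    also have "\<dots> \<le> 2 * pi * (1 / 8)" using r[OF i(1)] by (intro mult_left_mono) auto
    finally have "\<bar>\<phi>\<bar> \<le> pi / 3" by simp
    then have "cos (pi / 3) \<le> cos \<bar>\<phi>\<bar>" by (intro cos_monotone_0_pi_le) auto
    then have cos: "cos \<phi> \<ge> 1 / 2" by (simp add: cos_60)
    have "cos (real k * Arg x) = cos \<phi>"
      unfolding \<phi>_def cos_diff using cos_int_2pin[of "r i"] sin_int_2pin[of "r i"] by (simp add: mult.commute)
    moreover have "x ^ k = rcis (norm x ^ k) (real k * Arg x)"
      using DeMoivre2[of "norm x" "Arg x" k] by (simp only: rcis_cmod_Arg)
    ultimately have "Re (x ^ k) = norm x ^ k * cos \<phi>" by (simp only: Re_rcis)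
    moreover have "norm x ^ k * (1 / 2) \<le> norm x ^ k * cos \<phi>" using cos by (intro mult_left_mono) auto
    ultimately show ?thesis by linarith
  qed
  have b': "b \<in> set xs" using assms xs by auto
  have nn: "0 \<le> Re (x ^ k)" if "x \<in> set xs" for x
    using re[OF that] by (meson divide_nonneg_pos norm_ge_zero order_trans zero_le_power zero_less_numeral)
  have "C < norm b ^ K / 2" using K by simp
  also have "\<dots> \<le> norm b ^ k / 2" using b k by (simp add: power_increasing)
  also have "\<dots> \<le> Re (b ^ k)" using re b' by simp
  also have "\<dots> \<le> (\<Sum>x\<leftarrow>xs. Re (x ^ k))"
    by (rule member_le_sum_list) (use b' nn in auto)
  also have "\<dots> = Re (\<Sum>x\<leftarrow>xs. x ^ k)" by (induction xs) auto
  also have "\<dots> \<le> norm (\<Sum>x\<leftarrow>xs. x ^ k)" by (rule complex_Re_le_cmod)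
  also have "(\<Sum>x\<leftarrow>xs. x ^ k) = (\<Sum>x\<in>#B. x ^ k)" using xs by (metis sum_mset_sum_list mset_map)
  also have "norm \<dots> \<le> C" using assms k by simp
  finally show False by simp
qed

section \<open>Vanishing of the high coefficients and absolute value of the last one\<close>

context add_char
begin

lemma unit_series_shift:
  assumes "C \<in> unit_series m" "w \<in> Fsub q" "k \<le> m" "k > 0"
  shows "C + fps_const w * fps_X ^ k \<in> unit_series m"
  using assms by (auto simp: unit_series_def fps_X_power_nth intro: Fsub_add)

lemma unit_series_shift_minus:
  assumes "C \<in> unit_series m" "w \<in> Fsub q" "k \<le> m" "k > 0"
  shows "C - fps_const w * fps_X ^ k \<in> unit_series m"
  using unit_series_shift[of C m "- w" k] assms by (simp add: Fsub_uminus flip: fps_const_neg)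

lemma pairing_in_Fsub:
  assumes "\<And>i. coeff f i \<in> Fsub q" "C \<in> unit_series m"
  shows "pairing f C \<in> Fsub q"
  unfolding pairing_def using assms
  by (intro Fsub_sum Fsub_mult log_deriv_in_Fsub) (auto simp: unit_series_def)

lemma pairing_shift:
  assumes "C $ 0 = 1" "degree f > 0" "D $ 0 = 1" "\<And>i. i < degree f \<Longrightarrow> D $ i = C $ i"
  shows "pairing f D = pairing f C - of_nat (degree f) * lead_coeff f * (D $ degree f - C $ degree f)"
proof -
  let ?d = "degree f"
  have i: "{1..?d} = insert ?d {1..<?d}" using assms by auto
  have "log_deriv D $ i = log_deriv C $ i" if "i < ?d" for i
    by (rule log_deriv_cong) (use assms that in auto)
  then have "pairing f D = lead_coeff f * log_deriv D $ ?d + (\<Sum>i\<in>{1..<?d}. coeff f i * log_deriv C $ i)"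
    unfolding pairing_def i by simp
  moreover have "log_deriv D $ ?d = log_deriv C $ ?d - of_nat ?d * (D $ ?d - C $ ?d)"
    by (rule log_deriv_shift) (use assms in auto)
  moreover have "pairing f C = lead_coeff f * log_deriv C $ ?d + (\<Sum>i\<in>{1..<?d}. coeff f i * log_deriv C $ i)"
    unfolding pairing_def i by simp
  ultimately show ?thesis by (simp only:) (simp add: algebra_simps)
qed

text \<open>Once \<open>m\<close> reaches the degree of \<open>f\<close>, the series coefficient at
  that index is free. Translating it moves the pairing by a nonzero multiple of the shift because
  \<open>p\<close> does not divide the degree, so the sum equals itself times a value other than
  1.\<close>

lemma L_coeff_vanish:
  assumes f: "\<And>i. coeff f i \<in> Fsub q" and d: "degree f > 0" "\<not> p dvd degree f" and m: "m \<ge> degree f"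
  shows "L_coeff f m = 0"
proof -
  let ?d = "degree f"
  define c where "c = - (of_nat ?d * lead_coeff f)"
  have "c \<noteq> 0" using d by (auto simp: c_def of_nat_eq_0)
  moreover have c: "c \<in> Fsub q" unfolding c_def using f by (intro Fsub_uminus Fsub_mult Fsub_of_nat) auto
  ultimately obtain w where w: "w \<in> Fsub q" "ech (w * c) \<noteq> 1" using ech_nontriv by blast
  define s where "s = (\<lambda>v C. C + fps_const (v :: 'k) * fps_X ^ ?d)"
  have "L_coeff f m = (\<Sum>C\<in>unit_series m. series_char f (s w C))"
    unfolding L_coeff_def
    by (rule sum.reindex_bij_witness[where i = "s w" and j = "s (- w)"])
      (use w d m in \<open>auto simp: s_def intro!: unit_series_shift unit_series_shift_minus simp flip: fps_const_neg\<close>)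
  also have "\<dots> = (\<Sum>C\<in>unit_series m. series_char f C * ech (w * c))"
  proof (intro sum.cong refl)
    fix C assume C: "C \<in> unit_series m"
    have "pairing f (s w C) = pairing f C - of_nat ?d * lead_coeff f * (s w C $ ?d - C $ ?d)"
      by (rule pairing_shift) (use C d in \<open>auto simp: s_def unit_series_def fps_X_power_nth\<close>)
    then have "pairing f (s w C) = pairing f C + w * c" by (simp add: s_def c_def fps_X_power_nth)
    then show "series_char f (s w C) = series_char f C * ech (w * c)" unfolding series_char_def
      using pairing_in_Fsub[OF f C] w c by (simp add: ech_add Fsub_mult)
  qed
  also have "\<dots> = L_coeff f m * ech (w * c)" by (simp add: L_coeff_def sum_distrib_right)
  finally have "L_coeff f m * (1 - ech (w * c)) = 0" by (simp add: algebra_simps)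
  then show ?thesis using w by simp
qed

lemma pairing_mult:
  assumes "C $ 0 = 1" "D $ 0 = 1"
  shows "pairing f (C * D) = pairing f C + pairing f D"
  using assms by (simp add: pairing_def log_deriv_mult algebra_simps sum.distrib)

lemma pairing_1 [simp]: "pairing f 1 = 0"
  by (simp add: pairing_def)

lemma series_char_norm:
  assumes "\<And>i. coeff f i \<in> Fsub q" "C \<in> unit_series m"
  shows "series_char f C * cnj (series_char f C) = 1"
  unfolding series_char_def using norm_ech[OF pairing_in_Fsub[OF assms]]
  by (metis complex_norm_square of_real_1 power_one)

lemma series_fst_nth: "C \<in> unit_series m \<Longrightarrow> C $ 0 = 1"
  by (simp add: unit_series_def)

lemma unit_series_trunc_mult:
  assumes "W \<in> unit_series m" "D \<in> unit_series m"
  shows "Abs_fps (\<lambda>i. if i \<le> m then (W * D) $ i else 0) \<in> unit_series m"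
  using assms by (auto simp: unit_series_def fps_mult_nth intro!: Fsub_sum Fsub_mult)

text \<open>Multiplication by \<open>D\<close> in the group of series with constant term 1 modulo
  \<open>X ^ (m + 1)\<close>, carried out on representatives; injectivity suffices on a finite
  set.\<close>

lemma bij_trunc_mult:
  assumes D: "D \<in> unit_series m"
  shows "bij_betw (\<lambda>W. Abs_fps (\<lambda>i. if i \<le> m then (W * D) $ i else 0)) (unit_series m) (unit_series m)"
proof -
  let ?t = "\<lambda>W. Abs_fps (\<lambda>i. if i \<le> m then (W * D) $ i else 0)"
  have inj: "inj_on ?t (unit_series m)"
  proof (rule inj_onI)
    fix W W' assume W: "W \<in> unit_series m" "W' \<in> unit_series m" and eq: "?t W = ?t W'"
    have eq': "(W * D) $ i = (W' * D) $ i" if "i \<le> m" for i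
      using fun_cong[OF arg_cong[OF eq, of fps_nth], of i] that by simp
    have "W $ i = W' $ i" for i
    proof (induction i rule: less_induct)
      case (less i)
      show ?case
      proof (cases "i \<le> m")
        case True
        have "(V * D) $ i = (\<Sum>j<i. V $ j * D $ (i - j)) + V $ i" for V
          using D by (simp add: fps_mult_nth atLeast0AtMost unit_series_def flip: lessThan_Suc_atMost)
        then show ?thesis using eq'[OF True] less by simp
      qed (use W in \<open>auto simp: unit_series_def\<close>)
    qed
    then show "W = W'" by (rule fps_ext)
  qed
  moreover have "?t ` unit_series m = unit_series m"
    by (rule endo_inj_surj[OF _ _ inj]) (use unit_series_trunc_mult D in auto)
  ultimately show ?thesis by (simp add: bij_betw_def)
qed

text \<open>Dividing by \<open>D\<close> turns a series with vanishing \<open>d\<close>-th coefficient into a truncated series \<open>W\<close>, at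
  the cost of the character value at the \<open>d\<close>-th coefficient of \<open>W * D\<close>. That coefficient is a nonconstant
  affine function of \<open>D\<close> unless \<open>W = 1\<close>, so only \<open>W = 1\<close> survives in the square of the absolute value.\<close>

lemma norm_L_coeff_top:
  assumes f: "\<And>i. coeff f i \<in> Fsub q" and d: "degree f > 0" "\<not> p dvd degree f"
  shows "(norm (L_coeff f (degree f - 1)))\<^sup>2 = q ^ (degree f - 1)"
proof -
  let ?d = "degree f"
  define m where "m = ?d - 1"
  define H where "H = unit_series m"
  define c where "c = of_nat ?d * lead_coeff f"
  have c: "c \<noteq> 0" "c \<in> Fsub q" unfolding c_def using d f
    by (auto simp: of_nat_eq_0 intro!: Fsub_mult Fsub_of_nat)
  define t where "t = (\<lambda>W D. Abs_fps (\<lambda>i. if i \<le> m then (W * D) $ i else (0::'k)))"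
  define l where "l = (\<lambda>W D :: 'k fps. (W * D) $ ?d)"
  have l_in: "l W D \<in> Fsub q" if "W \<in> H" "D \<in> H" for W D using that
    by (auto simp: l_def H_def unit_series_def fps_mult_nth intro!: Fsub_sum Fsub_mult)
  \<comment> \<open>The pairing of \<open>W * D\<close> splits by multiplicativity. As
    \<open>m = ?d - 1\<close>, truncation removes just the one coefficient \<open>l W D\<close> that
    the pairing still sees, and this adds \<open>c * l W D\<close>.\<close>
  have chi_t: "series_char f (t W D) * cnj (series_char f D) = series_char f W * ech (c * l W D)"
    if WD: "W \<in> H" "D \<in> H" for W D
  proof -
    have "pairing f (t W D) = pairing f (W * D) - of_nat ?d * lead_coeff f * (t W D $ ?d - (W * D) $ ?d)"
      by (rule pairing_shift) (use WD d in \<open>auto simp: t_def m_def H_def unit_series_def\<close>)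
    also have "\<dots> = pairing f W + pairing f D + c * l W D"
      using WD d by (simp add: pairing_mult H_def series_fst_nth t_def l_def c_def m_def)
    finally have "series_char f (t W D) = series_char f W * series_char f D * ech (c * l W D)"
      unfolding series_char_def using WD c l_in[OF WD] pairing_in_Fsub[OF f, of _ m]
      by (simp add: ech_add Fsub_add Fsub_mult H_def)
    then show ?thesis using series_char_norm[OF f, of D m] WD by (simp add: H_def mult_ac)
  qed
  have inner: "(\<Sum>D\<in>H. ech (c * l W D)) = (if W = 1 then of_nat (q ^ m) else 0)" if W: "W \<in> H" for W
  proof (cases "W = 1")
    case True
    then have "l W D = 0" if "D \<in> H" for D using that d by (auto simp: l_def H_def unit_series_def m_def)
    then show ?thesis using True by (simp add: H_def card_unit_series)
  next
    case False
    then obtain i where "W $ i \<noteq> 1 $ i" by (metis fps_ext)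
    then have i: "W $ i \<noteq> 0" "i > 0" "i \<le> m" using W by (auto simp: H_def unit_series_def) (metis gr0I linorder_not_le)+
    \<comment> \<open>The coefficient of \<open>W * D\<close> at \<open>?d\<close> contains
      \<open>W $ i * D $ k\<close>. Since \<open>0 < i < ?d\<close>, index \<open>k\<close> is a
      free coefficient of \<open>D\<close>.\<close>
    define k where "k = ?d - i"
    have k: "0 < k" "k \<le> m" "?d - k = i" "k < ?d" using i d by (auto simp: k_def m_def)
    have "c * W $ i \<noteq> 0" "c * W $ i \<in> Fsub q" using c i W by (auto simp: H_def unit_series_def intro!: Fsub_mult)
    then obtain w where w: "w \<in> Fsub q" "ech (w * (c * W $ i)) \<noteq> 1" using ech_nontriv by blast
    define s where "s = (\<lambda>v D. D + fps_const (v :: 'k) * fps_X ^ k)"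
    have "(\<Sum>D\<in>H. ech (c * l W D)) = (\<Sum>D\<in>H. ech (c * l W (s w D)))"
      unfolding H_def
      by (rule sum.reindex_bij_witness[where i = "s w" and j = "s (- w)"])
        (use w k in \<open>auto simp: s_def intro!: unit_series_shift unit_series_shift_minus simp flip: fps_const_neg\<close>)
    also have "\<dots> = (\<Sum>D\<in>H. ech (c * l W D) * ech (w * (c * W $ i)))"
    proof (intro sum.cong refl)
      fix D assume D: "D \<in> H"
      have "W * s w D = W * D + fps_const w * (W * fps_X ^ k)" by (simp add: s_def algebra_simps)
      then have "l W (s w D) = l W D + w * W $ i"
        using k by (simp add: l_def fps_X_power_mult_right_nth)
      then have "c * l W (s w D) = c * l W D + w * (c * W $ i)" by (simp add: algebra_simps)
      then show "ech (c * l W (s w D)) = ech (c * l W D) * ech (w * (c * W $ i))"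
        using w l_in[OF W D] c \<open>c * W $ i \<in> Fsub q\<close> by (simp add: ech_add Fsub_mult)
    qed
    also have "\<dots> = (\<Sum>D\<in>H. ech (c * l W D)) * ech (w * (c * W $ i))" by (simp add: sum_distrib_right)
    finally have "(\<Sum>D\<in>H. ech (c * l W D)) * (1 - ech (w * (c * W $ i))) = 0" by (simp add: algebra_simps)
    then show ?thesis using w False by simp
  qed
  have "of_real ((norm (L_coeff f m))\<^sup>2) = L_coeff f m * cnj (L_coeff f m)"
    by (rule complex_norm_square)
  also have "\<dots> = (\<Sum>D\<in>H. L_coeff f m * cnj (series_char f D))"
    by (simp add: L_coeff_def H_def sum_distrib_left)
  also have "\<dots> = (\<Sum>D\<in>H. \<Sum>W\<in>H. series_char f (t W D) * cnj (series_char f D))"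
  proof (intro sum.cong refl)
    fix D assume "D \<in> H"
    then have "L_coeff f m = (\<Sum>W\<in>H. series_char f (t W D))"
      unfolding L_coeff_def H_def t_def by (intro sum.reindex_bij_betw[symmetric] bij_trunc_mult)
    then show "L_coeff f m * cnj (series_char f D) = (\<Sum>W\<in>H. series_char f (t W D) * cnj (series_char f D))"
      by (simp add: sum_distrib_right)
  qed
  also have "\<dots> = (\<Sum>D\<in>H. \<Sum>W\<in>H. series_char f W * ech (c * l W D))"
    by (intro sum.cong refl chi_t)
  also have "\<dots> = (\<Sum>W\<in>H. series_char f W * (\<Sum>D\<in>H. ech (c * l W D)))"
    by (subst sum.swap) (simp add: sum_distrib_left)
  also have "\<dots> = (\<Sum>W\<in>H. if W = 1 then of_nat (q ^ m) else 0)"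
    using inner by (intro sum.cong) (auto simp: series_char_def)
  also have "\<dots> = of_nat (q ^ m)"
  proof -
    have "1 \<in> H" by (simp add: H_def unit_series_def)
    then show ?thesis by (simp add: H_def sum.delta')
  qed
  finally have "complex_of_real ((norm (L_coeff f m))\<^sup>2) = complex_of_real (real (q ^ m))" by simp
  then show ?thesis unfolding of_real_eq_iff m_def .
qed

end

section \<open>Absolute values of the zeros\<close>

lemma prod_mset_le_1:
  fixes M :: "real multiset"
  assumes "\<And>x. x \<in># M \<Longrightarrow> 0 \<le> x \<and> x \<le> 1"
  shows "0 \<le> prod_mset M \<and> prod_mset M \<le> 1"
  using assms by (induction M) (auto intro: mult_le_one)

lemma prod_mset_eq_1_imp:
  fixes M :: "real multiset"
  assumes "\<And>x. x \<in># M \<Longrightarrow> 0 \<le> x \<and> x \<le> 1" "prod_mset M = 1" "x \<in># M"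
  shows "x = 1"
proof -
  obtain N where N: "M = add_mset x N" using assms(3) by (metis multi_member_split)
  have a: "0 \<le> prod_mset N \<and> prod_mset N \<le> 1" using prod_mset_le_1[of N] assms(1) N by auto
  have "1 = x * prod_mset N" using assms(2) N by simp
  also have "\<dots> \<le> x * 1" using a assms(1,3) by (intro mult_left_mono) auto
  finally show ?thesis using assms(1)[OF assms(3)] by simp
qed

lemma sum_mset_divide: "(\<Sum>x\<in>#M. g x / c :: 'a::field) = (\<Sum>x\<in>#M. g x) / c"
  by (induction M) (simp_all add: add_divide_distrib)

context add_char
begin

lemma family_coeffs:
  assumes "f \<in> family p n d"
  shows "\<And>i. coeff f i \<in> Fsub q" "coeff f 0 = (0::'k)" "degree f = d"
  using assms by (auto simp: family_def)

lemma prime_coprime_not_dvd: "coprime d p \<Longrightarrow> \<not> p dvd d"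
  using p by (metis coprime_absorb_right not_prime_unit)

text \<open>The field with \<open>q ^ (2 * k)\<close> elements has square order, with root
  \<open>q ^ k = p ^ Suc b\<close>. The condition on \<open>k\<close> makes \<open>p ^ b\<close>
  larger than the degree.\<close>

lemma char_sum_even_bound:
  assumes f: "f \<in> family p n d" and d: "coprime d p" "d > 0" and k: "k \<ge> d + 1"
  shows "norm (char_sum p n \<psi> f (2 * k)) \<le> 2 * d * p * q ^ k"
proof -
  note fc = family_coeffs[OF f]
  define b where "b = n * k - 1"
  have "k \<le> n * k" using n by simp
  then have b: "n * k = Suc b" "b \<ge> d" using k unfolding b_def by linarith+
  have "d < p ^ d" using p by (intro power_gt_expt) simp
  also have "\<dots> \<le> p ^ b" using b p by (intro power_increasing) (auto simp: prime_ge_1_nat)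
  finally have L: "p ^ b > degree f" using fc by simp
  have nk: "n * (2 * k) = 2 * Suc b" using b by (simp flip: b(1))
  have "coeff f i \<in> Fsub (p ^ (2 * Suc b))" for i
    using fc(1) Fsub_dvd[of n "n * (2 * k)"] unfolding nk[symmetric] by simp
  from norm_char_sum_le[OF _ _ L this]
  have "norm (char_sum p n \<psi> f (2 * k)) \<le> 2 * degree f * p * p ^ Suc b"
    unfolding char_sum_def nk using d fc by simp
  then show ?thesis using fc by (simp only: power_mult[symmetric] b(1))
qed

text \<open>\<open>norm_zeros\<close> is a definite description, so existence and uniqueness of the
  multiset come first. Bounded even power sums prevent any zero from exceeding 1 in absolute value;
  the product of the squared absolute values is 1, so none can fall below.\<close>

lemma norm_zeros_props:
  assumes f: "f \<in> family p n d" and d: "coprime d p" "d > 0"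
  defines "R \<equiv> norm_zeros p n \<psi> f"
  shows "size R = d - 1" "\<And>\<rho>. \<rho> \<in># R \<Longrightarrow> norm \<rho> = 1"
    "\<And>r. r > 0 \<Longrightarrow> (\<Sum>\<rho>\<in>#R. \<rho> ^ r) = - char_sum p n \<psi> f r / of_real (sqrt q ^ r)"
proof -
  note fc = family_coeffs[OF f]
  have nd: "\<not> p dvd degree f" "degree f > 0" using d fc prime_coprime_not_dvd by auto
  define L where "L = L_fps p n \<psi> f"
  define s where "s = complex_of_real (sqrt q)"
  have q0: "q > 0" using q_ge3 by linarith
  have s: "s \<noteq> 0" "norm s = sqrt q" "s ^ 2 = of_nat q" using q0
    by (simp_all add: s_def flip: of_real_power) simp_all
  define P where "P = (\<Sum>i\<le>d - 1. monom (L_coeff f i) i)"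
  have cP: "coeff P i = L_coeff f i" for i
    using L_coeff_vanish[OF fc(1) nd(2,1), of i] d by (auto simp: P_def coeff_sum sum.delta' fc)
  have LP: "L = fps_of_poly P" by (rule fps_ext) (simp add: L_def L_fps_nth fc cP)
  have "degree P \<le> d - 1" unfolding P_def
    by (intro degree_sum_le) (auto intro: order_trans[OF degree_monom_le])
  moreover have "coeff P 0 = 1" by (simp add: cP L_coeff_0)
  ultimately obtain B where B: "size B = d - 1" "recip_poly B = P"
    using recip_poly_exists by blast
  have prod_eq: "(\<Prod>\<rho>\<in>#M. [:1, - complex_of_real (sqrt (real (p ^ n))) * \<rho>:])
      = recip_poly (image_mset (\<lambda>\<rho>. s * \<rho>) M)" for M
    by (simp add: recip_poly_def s_def multiset.map_comp comp_def)
  have R_unique: "M = image_mset (\<lambda>b. b / s) B"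
    if "size M = d - 1" "L_fps p n \<psi> f = fps_of_poly (\<Prod>\<rho>\<in>#M. [:1, - complex_of_real (sqrt (real (p ^ n))) * \<rho>:])" for M
  proof -
    have "recip_poly (image_mset (\<lambda>\<rho>. s * \<rho>) M) = recip_poly B"
      using that LP B unfolding prod_eq L_def by simp
    then have "image_mset (\<lambda>\<rho>. s * \<rho>) M = B" using that B by (intro recip_poly_inj) auto
    then show ?thesis using s by (auto simp: multiset.map_comp comp_def)
  qed
  have "R = image_mset (\<lambda>b. b / s) B" unfolding R_def norm_zeros_def
  proof (rule the_equality)
    show "size (image_mset (\<lambda>b. b / s) B) = degree f - 1 \<and> L_fps p n \<psi> f =
        fps_of_poly (\<Prod>\<rho>\<in>#image_mset (\<lambda>b. b / s) B. [:1, - complex_of_real (sqrt (real (p ^ n))) * \<rho>:])"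
      using B LP s fc unfolding prod_eq L_def by (simp add: multiset.map_comp comp_def)
  qed (use R_unique fc in auto)
  note R = this
  show "size R = d - 1" using R B by simp
  have ps: "(\<Sum>b\<in>#B. b ^ r) = - char_sum p n \<psi> f r" if r: "r > 0" for r
  proof -
    have "log_deriv L = - (fps_X * fps_deriv (log_L f))"
      by (rule log_deriv_unique) (simp_all add: L_def L_fps_0 deriv_L_fps mult_ac)
    then have "log_deriv L $ r = - char_sum p n \<psi> f r"
      using r by (cases r) (auto simp: log_L_def simp del: of_nat_Suc)
    then show ?thesis using log_deriv_recip_poly[OF r, of B] B LP by simp
  qed
  show "(\<Sum>\<rho>\<in>#R. \<rho> ^ r) = - char_sum p n \<psi> f r / of_real (sqrt q ^ r)" if r: "r > 0" for r
  proof -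
    have "(\<Sum>\<rho>\<in>#R. \<rho> ^ r) = (\<Sum>b\<in>#B. b ^ r) / s ^ r"
      unfolding R by (simp add: multiset.map_comp comp_def power_divide sum_mset_divide)
    then show ?thesis using ps[OF r] by (simp add: s_def)
  qed
  have le1: "norm \<rho> \<le> 1" if "\<rho> \<in># R" for \<rho>
  proof -
    \<comment> \<open>The bound concerns extensions of even degree only, so the power sum argument
      is applied to the squares of the zeros.\<close>
    have "norm (\<Sum>x\<in>#image_mset (\<lambda>\<rho>. \<rho>\<^sup>2) R. x ^ k) \<le> 2 * d * p" if k: "k \<ge> d + 1" for k
    proof -
      have "(\<Sum>x\<in>#image_mset (\<lambda>\<rho>. \<rho>\<^sup>2) R. x ^ k) = (\<Sum>b\<in>#B. b ^ (2 * k)) / s ^ (2 * k)"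
        unfolding R by (simp add: multiset.map_comp comp_def power_divide sum_mset_divide
            flip: power_mult)
      then have "norm (\<Sum>x\<in>#image_mset (\<lambda>\<rho>. \<rho>\<^sup>2) R. x ^ k) = norm (char_sum p n \<psi> f (2 * k)) / q ^ k"
        using k ps[of "2 * k"] s(3) by (simp add: norm_divide power_mult norm_power)
      also have "\<dots> \<le> 2 * d * p"
        using char_sum_even_bound[OF f d k] q0 by (simp add: divide_le_eq)
      finally show ?thesis .
    qed
    then have "norm (\<rho>\<^sup>2) \<le> 1"
      by (rule bounded_power_sums_imp_norm_le_1) (use that in auto)
    then show ?thesis by (simp add: norm_power power_le_one_iff)
  qed
  \<comment> \<open>The coefficient of index \<open>d - 1\<close> is up to sign the product of all
    elements of \<open>B\<close>, and \<open>norm_L_coeff_top\<close> gives its absolute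
    value.\<close>
  have "coeff (recip_poly B) (size B) = coeff (root_poly B) 0" by (simp add: coeff_recip_poly)
  also have "\<dots> = (\<Prod>b\<in>#B. - b)" unfolding root_poly_def
    by (induction B) (simp_all add: coeff_mult)
  finally have "L_coeff f (d - 1) = (\<Prod>b\<in>#B. - b)" using B cP by simp
  moreover have "(norm (\<Prod>b\<in>#B. - b))\<^sup>2 = (\<Prod>b\<in>#B. (norm b)\<^sup>2)"
    by (induction B) (simp_all add: norm_mult power_mult_distrib)
  ultimately have "(norm (L_coeff f (d - 1)))\<^sup>2 = (\<Prod>b\<in>#B. (norm b)\<^sup>2)" by simp
  then have "(\<Prod>b\<in>#B. (norm b)\<^sup>2) = real q ^ (d - 1)"
    using norm_L_coeff_top[OF fc(1) nd(2,1)] fc by simp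
  moreover have "(\<Prod>x\<in>#image_mset (\<lambda>\<rho>. (norm \<rho>)\<^sup>2) R. x) = (\<Prod>b\<in>#B. (norm b)\<^sup>2) / real q ^ size B"
    unfolding R using s q0
    by (induction B) (simp_all add: norm_divide power_divide)
  ultimately have pr: "prod_mset (image_mset (\<lambda>\<rho>. (norm \<rho>)\<^sup>2) R) = 1" using B q0 by auto
  show "norm \<rho> = 1" if "\<rho> \<in># R" for \<rho>
  proof -
    have "(norm \<rho>)\<^sup>2 = 1"
      by (rule prod_mset_eq_1_imp[OF _ pr]) (use that le1 in \<open>auto simp: power_le_one_iff\<close>)
    then show ?thesis by (simp add: power2_eq_1_iff) (smt (verit) norm_ge_zero)
  qed
qed

lemma mset_zero_list: "mset (zero_list p n \<psi> f) = norm_zeros p n \<psi> f"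
  unfolding zero_list_def using ex_mset by (rule someI_ex)

end

section \<open>Moments of power sums of the zeros over the family\<close>

lemma card_set_mset_le_size: "card (set_mset A) \<le> size A"
proof (induction A)
  case (add x A)
  then show ?case by (simp add: card_insert_if)
qed simp

context add_char
begin

lemma family_finite: "finite (family p n d :: 'k poly set)"
proof -
  have "inj_on (\<lambda>f. \<lambda>i\<in>{..d}. coeff f i) (family p n d :: 'k poly set)"
  proof (rule inj_onI, rule poly_eqI)
    fix f g :: "'k poly" and i
    assume fg: "f \<in> family p n d" "g \<in> family p n d"
      and eq: "(\<lambda>i\<in>{..d}. coeff f i) = (\<lambda>i\<in>{..d}. coeff g i)"
    show "coeff f i = coeff g i"
      using fun_cong[OF eq, of i] fg by (cases "i \<le> d") (auto simp: family_def coeff_eq_0)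
  qed
  moreover have "(\<lambda>f. \<lambda>i\<in>{..d}. coeff f i) ` (family p n d :: 'k poly set) \<subseteq> {..d} \<rightarrow>\<^sub>E Fsub q"
    by (auto simp: family_def split: if_splits)
  moreover have "finite ({..d} \<rightarrow>\<^sub>E (Fsub q :: 'k set))" using card_Fsub[OF n] by (simp add: finite_PiE)
  ultimately show ?thesis by (meson inj_on_finite)
qed

lemma family_nonempty:
  assumes "coprime d p"
  shows "monom 1 d \<in> (family p n d :: 'k poly set)"
proof -
  have "\<not> p dvd d" using assms prime_coprime_not_dvd by blast
  then show ?thesis by (auto simp: family_def degree_monom_eq)
qed

lemma card_family_pos: "coprime d p \<Longrightarrow> card (family p n d :: 'k poly set) > 0"
  using family_finite family_nonempty by (metis card_gt_0_iff empty_iff)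

text \<open>This is all that power sums of positive index can distinguish in characteristic
  \<open>p\<close>: they ignore 0 and see multiplicities modulo \<open>p\<close>.\<close>

definition mcong :: "'k multiset \<Rightarrow> 'k multiset \<Rightarrow> bool" where
  "mcong M N \<longleftrightarrow> (\<forall>x. x \<noteq> 0 \<longrightarrow> (of_nat (count M x) :: 'k) = of_nat (count N x))"

lemma sum_mset_count_superset:
  assumes "finite S" "set_mset M \<subseteq> S"
  shows "(\<Sum>x\<in>#M. g x :: 'k) = (\<Sum>x\<in>S. of_nat (count M x) * g x)"
  using assms(2)
proof (induction M)
  case (add x M)
  have "(\<Sum>y\<in>S. of_nat (count (add_mset x M) y) * g y)
      = (\<Sum>y\<in>S. (if y = x then g y else 0) + of_nat (count M y) * g y)"
    by (intro sum.cong) (auto simp: algebra_simps)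
  also have "\<dots> = g x + (\<Sum>x\<in>S. of_nat (count M x) * g x)"
    using add.prems assms(1) by (simp add: sum.distrib sum.delta)
  finally show ?case using add by simp
qed simp

text \<open>A nonzero residue of multiplicities at some \<open>a \<noteq> 0\<close> is detected by pairing with a Lagrange
  polynomial without constant term that vanishes at the rest of the support.\<close>

lemma power_sums_detect:
  assumes "\<not> mcong M N" "size M + size N < d"
  shows "\<exists>i. 1 \<le> i \<and> i < d \<and> \<not> p dvd i \<and> (\<Sum>x\<in>#M. x ^ i) \<noteq> (\<Sum>x\<in>#N. x ^ i)"
proof -
  define D where "D = (\<lambda>i. (\<Sum>x\<in>#M. x ^ i) - (\<Sum>x\<in>#N. x ^ i))"
  define S where "S = insert 0 (set_mset M \<union> set_mset N)"
  define k where "k = (\<lambda>x. of_nat (count M x) - of_nat (count N x) :: 'k)"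
  have S: "finite S" "set_mset M \<subseteq> S" "set_mset N \<subseteq> S" by (auto simp: S_def)
  obtain a where a: "a \<noteq> 0" "k a \<noteq> 0" using assms by (auto simp: mcong_def k_def)
  have aS: "a \<in> S"
  proof (rule ccontr)
    assume "a \<notin> S"
    then have "count M a = 0" "count N a = 0" by (simp_all add: S_def not_in_iff)
    then show False using a by (simp add: k_def)
  qed
  define h where "h = (\<Prod>b\<in>S - {a}. [:-b, 1:])"
  have h0: "poly h x = (\<Prod>b\<in>S - {a}. x - b)" for x by (simp add: h_def poly_prod)
  have ha: "poly h a \<noteq> 0" using S by (simp add: h0)
  have hS: "poly h x = 0" if "x \<in> S" "x \<noteq> a" for x using S that by (auto simp: h0 intro!: prod_zero)
  have "degree h = card (S - {a})" unfolding h_def by (subst degree_prod_sum_eq) auto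
  also have "\<dots> \<le> card (set_mset M \<union> set_mset N)" using aS S
    by (simp add: S_def card_insert_if del: set_mset_union)
  also have "\<dots> \<le> size M + size N"
    by (meson add_mono card_Un_le order_trans card_set_mset_le_size)
  finally have dh: "degree h < d" using assms by simp
  have ch0: "coeff h 0 = 0" using hS[of 0] a by (simp add: poly_0_coeff_0 S_def)
  have D: "D i = (\<Sum>x\<in>S. k x * x ^ i)" for i
    using sum_mset_count_superset[OF S(1,2)] sum_mset_count_superset[OF S(1,3)]
    by (simp add: D_def k_def algebra_simps sum_subtractf)
  have "(\<Sum>i\<le>degree h. coeff h i * D i) = (\<Sum>x\<in>S. k x * poly h x)"
    unfolding D poly_altdef sum_distrib_left by (subst sum.swap) (simp add: mult_ac)
  also have "\<dots> = k a * poly h a" using S aS hS by (subst sum.remove[of _ a]) auto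
  finally have "(\<Sum>i\<le>degree h. coeff h i * D i) \<noteq> 0" using a ha by simp
  then obtain i where i: "i \<le> degree h" "coeff h i * D i \<noteq> 0" by (metis (no_types, lifting) atMost_iff sum.neutral)
  then have "i \<noteq> 0" using ch0 by (metis mult_zero_left)
  then have ex: "\<exists>i. 1 \<le> i \<and> i < d \<and> D i \<noteq> 0" using i dh by (intro exI[of _ i]) auto
  \<comment> \<open>The difference at index \<open>p * l\<close> is the \<open>p\<close>-th power of
    the difference at \<open>l\<close>. The least index with a difference is therefore not divisible
    by \<open>p\<close>, so it belongs to a coefficient that the family lets vary.\<close>
  define j where "j = (LEAST i. 1 \<le> i \<and> i < d \<and> D i \<noteq> 0)"
  have j: "1 \<le> j" "j < d" "D j \<noteq> 0" using LeastI_ex[OF ex] by (auto simp: j_def)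
  have "\<not> p dvd j"
  proof
    assume "p dvd j"
    then obtain l where l: "j = p * l" by auto
    then have l1: "1 \<le> l" "l < j" using j p by auto
    have "D j = D l ^ p ^ 1"
      unfolding D_def frob_diff frob_sum_mset by (simp add: l power_mult mult.commute flip: power_mult)
    then have "D l \<noteq> 0" using j p by auto
    then show False using l1 j not_less_Least[of l "\<lambda>i. 1 \<le> i \<and> i < d \<and> D i \<noteq> 0"] by (simp add: j_def)
  qed
  then show ?thesis using j by (auto simp: D_def)
qed

lemma mcong_power_sums:
  assumes "mcong M N" "i > 0"
  shows "(\<Sum>x\<in>#M. x ^ i) = (\<Sum>x\<in>#N. x ^ i)"
proof -
  let ?S = "set_mset M \<union> set_mset N"
  have "(\<Sum>x\<in>?S. of_nat (count M x) * x ^ i) = (\<Sum>x\<in>?S. of_nat (count N x) * x ^ i)"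
  proof (intro sum.cong refl)
    fix x show "of_nat (count M x) * x ^ i = of_nat (count N x) * x ^ i"
      using assms by (cases "x = 0") (auto simp: mcong_def)
  qed
  then show ?thesis
    using sum_mset_count_superset[of ?S M "\<lambda>x. x ^ i"] sum_mset_count_superset[of ?S N "\<lambda>x. x ^ i"] by simp
qed

lemma stable_power_sum: "M \<in> stable m \<Longrightarrow> (\<Sum>x\<in>#M. x ^ i) \<in> Fsub q"
  using sum_stable_in_Fsub[of "monom 1 i" M m] by (simp add: poly_monom)

lemma poly_as_sum_atLeast1:
  assumes "coeff f 0 = (0::'k)"
  shows "(\<Sum>x\<in>#M. poly f x) = (\<Sum>i\<in>{1..degree f}. coeff f i * (\<Sum>x\<in>#M. x ^ i))"
proof -
  have "(\<Sum>x\<in>#M. poly f x) = pairing f (fps_of_poly (recip_poly M))"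
    using pairing_recip_poly[OF assms] by simp
  then show ?thesis by (simp add: pairing_def log_deriv_recip_poly)
qed

text \<open>If some power sum of index \<open>i < d\<close> with \<open>p\<close> not dividing
  \<open>i\<close> differs, the \<open>i\<close>-th coefficient can be translated within the family,
  leaving the leading coefficient alone. The translation multiplies every summand by the same value
  other than 1.\<close>

lemma family_orthogonality:
  assumes d: "coprime d p" and M: "M \<in> stable m1" "N \<in> stable m2" and md: "m1 + m2 < d"
  shows "(\<Sum>f\<in>family p n d. mset_char f M * cnj (mset_char f N))
       = (if mcong M N then of_nat (card (family p n d :: 'k poly set)) else 0)"
proof -
  define D where "D = (\<lambda>i. (\<Sum>x\<in>#M. x ^ i) - (\<Sum>x\<in>#N. x ^ i))"
  have Din: "D i \<in> Fsub q" for i unfolding D_def by (intro Fsub_diff stable_power_sum[OF M(1)] stable_power_sum[OF M(2)])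
  have chi: "mset_char f M * cnj (mset_char f N) = ech (\<Sum>i\<in>{1..d}. coeff f i * D i)"
    if f: "f \<in> family p n d" for f
  proof -
    note fc = family_coeffs[OF f]
    have "(\<Sum>i\<in>{1..d}. coeff f i * D i) = (\<Sum>x\<in>#M. poly f x) - (\<Sum>x\<in>#N. poly f x)"
      by (simp add: D_def poly_as_sum_atLeast1[OF fc(2)] fc(3) algebra_simps sum_subtractf)
    then show ?thesis unfolding mset_char_def using sum_stable_in_Fsub[OF fc(1)] M by (simp add: ech_diff)
  qed
  show ?thesis
  proof (cases "mcong M N")
    case True
    then have "D i = 0" if "i > 0" for i using mcong_power_sums that by (simp add: D_def)
    then have "(\<Sum>f\<in>family p n d. mset_char f M * cnj (mset_char f N)) = (\<Sum>f\<in>(family p n d :: 'k poly set). 1)"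
      by (intro sum.cong) (auto simp: chi)
    then show ?thesis using True by simp
  next
    case False
    have "\<exists>i. 1 \<le> i \<and> i < d \<and> \<not> p dvd i \<and> (\<Sum>x\<in>#M. x ^ i) \<noteq> (\<Sum>x\<in>#N. x ^ i)"
      by (rule power_sums_detect[OF False]) (use M md in \<open>simp add: stable_def\<close>)
    then obtain i where i: "1 \<le> i" "i < d" "\<not> p dvd i" "D i \<noteq> 0" by (auto simp: D_def)
    obtain b where b: "b \<in> Fsub q" "ech (b * D i) \<noteq> 1" using ech_nontriv[OF i(4) Din] by blast
    define s where "s = (\<lambda>v (f :: 'k poly). f + monom v i)"
    have s_in: "s v f \<in> family p n d" if f: "f \<in> family p n d" and v: "v \<in> Fsub q" for v f
    proof -
      note fc = family_coeffs[OF f]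
      have "degree (monom v i) < degree f" using i fc by (intro le_less_trans[OF degree_monom_le]) auto
      then have "degree (s v f) = d" unfolding s_def using fc by (simp add: degree_add_eq_left)
      moreover have "coeff (s v f) j = coeff f j + (if i = j then v else 0)" for j by (simp add: s_def)
      moreover have "lead_coeff f \<noteq> 0" using f by (auto simp: family_def)
      ultimately show ?thesis using f v i fc by (auto simp: family_def intro: Fsub_add)
    qed
    have s_in': "s (- b) f \<in> family p n d" if "f \<in> family p n d" for f
      using s_in[OF that] b by (simp add: Fsub_uminus)
    have s_inv: "s (- b) (s b f) = f" "s b (s (- b) f) = f" for f
      by (simp_all add: s_def add.assoc add_monom)
    let ?X = "\<lambda>f. mset_char f M * cnj (mset_char f N)"
    have "(\<Sum>f\<in>family p n d. ?X f) = (\<Sum>f\<in>family p n d. ?X (s b f))"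
      by (rule sum.reindex_bij_witness[where i = "s b" and j = "s (- b)"])
        (use b s_in s_in' in \<open>auto simp: s_inv\<close>)
    also have "\<dots> = (\<Sum>f\<in>family p n d. ?X f * ech (b * D i))"
    proof (intro sum.cong refl)
      fix f :: "'k poly" assume f: "f \<in> family p n d"
      have "(\<Sum>j\<in>{1..d}. coeff (s b f) j * D j)
          = (\<Sum>j\<in>{1..d}. coeff f j * D j + (if i = j then b * D i else 0))"
        by (intro sum.cong) (auto simp: s_def algebra_simps)
      also have "\<dots> = (\<Sum>j\<in>{1..d}. coeff f j * D j) + b * D i"
        using i by (simp add: sum.distrib sum.delta')
      finally have "ech (\<Sum>j\<in>{1..d}. coeff (s b f) j * D j) = ech (\<Sum>j\<in>{1..d}. coeff f j * D j) * ech (b * D i)"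
        using f b Din by (simp add: ech_add Fsub_mult Fsub_sum family_def)
      then show "?X (s b f) = ?X f * ech (b * D i)" by (simp add: chi f s_in b)
    qed
    also have "\<dots> = (\<Sum>f\<in>family p n d. ?X f) * ech (b * D i)" by (simp add: sum_distrib_right)
    finally have "(\<Sum>f\<in>family p n d. ?X f) * (1 - ech (b * D i)) = 0" by (simp add: algebra_simps)
    then show ?thesis using b False by simp
  qed
qed

definition avg :: "nat \<Rightarrow> ('k poly \<Rightarrow> complex) \<Rightarrow> complex" where
  "avg d g = (\<Sum>f\<in>family p n d. g f) / of_nat (card (family p n d :: 'k poly set))"

lemma avg_sum: "avg d (\<lambda>f. \<Sum>i\<in>A. g i f) = (\<Sum>i\<in>A. avg d (g i))"
  unfolding avg_def by (subst sum.swap) (simp add: sum_divide_distrib)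

lemma avg_cmult: "avg d (\<lambda>f. c * g f) = c * avg d g"
  by (simp add: avg_def sum_distrib_left)

lemma avg_diff: "avg d (\<lambda>f. g f - h f) = avg d g - avg d h"
  by (simp add: avg_def sum_subtractf diff_divide_distrib)

lemma avg_cnj: "avg d (\<lambda>f. cnj (g f)) = cnj (avg d g)"
  by (simp add: avg_def)

lemma avg_const: "coprime d p \<Longrightarrow> avg d (\<lambda>_. c) = c"
  using card_family_pos by (simp add: avg_def)

lemma avg_cong: "(\<And>f. f \<in> family p n d \<Longrightarrow> g f = h f) \<Longrightarrow> avg d g = avg d h"
  by (simp add: avg_def)

lemma avg_orthogonality:
  assumes "coprime d p" "M \<in> stable ma" "N \<in> stable mb" "ma + mb < d"
  shows "avg d (\<lambda>f. mset_char f M * cnj (mset_char f N)) = (if mcong M N then 1 else 0)"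
  unfolding avg_def family_orthogonality[OF assms] using card_family_pos[OF assms(1)] by simp

lemma empty_stable: "{#} \<in> stable 0" by (simp add: stable_def)
lemma mset_char_empty: "mset_char f {#} = 1" by (simp add: mset_char_def)

lemma stable_add: "M \<in> stable a \<Longrightarrow> N \<in> stable b \<Longrightarrow> M + N \<in> stable (a + b)"
  by (simp add: stable_def)

abbreviation Fq where "Fq r \<equiv> (Fsub (p ^ (n * r)) :: 'k set)"

abbreviation CS where "CS f r \<equiv> char_sum p n \<psi> f r"

lemma finite_Fq: "r > 0 \<Longrightarrow> finite (Fq r)" and card_Fq: "r > 0 \<Longrightarrow> card (Fq r) = q ^ r"
  using card_Fsub[of "n * r"] n by (auto simp: power_mult)

lemma avg_char_sum:
  assumes d: "coprime d p" and r: "0 < r" "r < d"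
  shows "avg d (\<lambda>f. CS f r) = of_nat (card {x\<in>Fq r. mcong (orb x r) {#}})"
proof -
  have "avg d (\<lambda>f. CS f r) = avg d (\<lambda>f. \<Sum>x\<in>Fq r. mset_char f (orb x r) * cnj (mset_char f {#}))"
    by (rule avg_cong) (simp add: char_sum_orb family_coeffs mset_char_empty)
  also have "\<dots> = (\<Sum>x\<in>Fq r. if mcong (orb x r) {#} then 1 else 0)"
    unfolding avg_sum using d r empty_stable orb_stable by (intro sum.cong refl avg_orthogonality) auto
  also have "\<dots> = of_nat (card {x\<in>Fq r. mcong (orb x r) {#}})"
    using finite_Fq[OF r(1)] by (simp add: sum.If_cases Int_def)
  finally show ?thesis .
qed

lemma avg_char_sum_mult:
  assumes d: "coprime d p" and r: "0 < r" "0 < s" "r + s < d"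
  shows "avg d (\<lambda>f. CS f r * CS f s)
       = of_nat (card {z\<in>Fq r \<times> Fq s. mcong (orb (fst z) r + orb (snd z) s) {#}})"
proof -
  have "avg d (\<lambda>f. CS f r * CS f s)
      = avg d (\<lambda>f. \<Sum>z\<in>Fq r \<times> Fq s. mset_char f (orb (fst z) r + orb (snd z) s) * cnj (mset_char f {#}))"
  proof (rule avg_cong)
    fix f :: "'k poly" assume f: "f \<in> family p n d"
    have "CS f r * CS f s = (\<Sum>z\<in>Fq r \<times> Fq s. mset_char f (orb (fst z) r) * mset_char f (orb (snd z) s))"
      using family_coeffs[OF f] by (simp add: char_sum_orb sum_product sum.cartesian_product case_prod_beta)
    also have "\<dots> = (\<Sum>z\<in>Fq r \<times> Fq s. mset_char f (orb (fst z) r + orb (snd z) s) * cnj (mset_char f {#}))"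
      using mset_char_add[OF family_coeffs(1)[OF f] orb_stable orb_stable]
      by (intro sum.cong refl) (auto simp: mset_char_empty)
    finally show "CS f r * CS f s = \<dots>" .
  qed
  also have "\<dots> = (\<Sum>z\<in>Fq r \<times> Fq s. if mcong (orb (fst z) r + orb (snd z) s) {#} then 1 else 0)"
    unfolding avg_sum using d r empty_stable orb_stable stable_add
    by (intro sum.cong refl avg_orthogonality[where ma = "r + s" and mb = 0]) auto
  also have "\<dots> = of_nat (card {z\<in>Fq r \<times> Fq s. mcong (orb (fst z) r + orb (snd z) s) {#}})"
    using finite_Fq r by (simp add: sum.If_cases Int_def)
  finally show ?thesis .
qed

lemma avg_char_sum_mult_cnj:
  assumes d: "coprime d p" and r: "0 < r" "0 < s" "r + s < d"
  shows "avg d (\<lambda>f. CS f r * cnj (CS f s))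
       = of_nat (card {z\<in>Fq r \<times> Fq s. mcong (orb (fst z) r) (orb (snd z) s)})"
proof -
  have "avg d (\<lambda>f. CS f r * cnj (CS f s))
      = avg d (\<lambda>f. \<Sum>z\<in>Fq r \<times> Fq s. mset_char f (orb (fst z) r) * cnj (mset_char f (orb (snd z) s)))"
  proof (rule avg_cong)
    fix f :: "'k poly" assume f: "f \<in> family p n d"
    show "CS f r * cnj (CS f s) = (\<Sum>z\<in>Fq r \<times> Fq s. mset_char f (orb (fst z) r) * cnj (mset_char f (orb (snd z) s)))"
      using family_coeffs[OF f] by (simp add: char_sum_orb sum_product sum.cartesian_product case_prod_beta)
  qed
  also have "\<dots> = (\<Sum>z\<in>Fq r \<times> Fq s. if mcong (orb (fst z) r) (orb (snd z) s) then 1 else 0)"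
    unfolding avg_sum using d r orb_stable
    by (intro sum.cong refl avg_orthogonality[where ma = r and mb = s]) auto
  also have "\<dots> = of_nat (card {z\<in>Fq r \<times> Fq s. mcong (orb (fst z) r) (orb (snd z) s)})"
    using finite_Fq r by (simp add: sum.If_cases Int_def)
  finally show ?thesis .
qed

end

section \<open>Counting pairs of orbits that agree modulo p\<close>

context add_char
begin

lemma orb_frob: "orb (x ^ q ^ i) r = image_mset (\<lambda>y. y ^ q ^ i) (orb x r)"
  unfolding orb_def multiset.map_comp comp_def
  by (intro image_mset_cong) (simp add: mult.commute flip: power_mult)

lemma image_frob_stable:
  assumes "M \<in> stable m"
  shows "image_mset (\<lambda>y. y ^ q ^ i) M = M"
proof (induction i)
  case (Suc i)
  have "image_mset (\<lambda>y. y ^ q ^ Suc i) M = image_mset (\<lambda>y. y ^ q) (image_mset (\<lambda>y. y ^ q ^ i) M)"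
    by (simp add: multiset.map_comp comp_def mult.commute flip: power_mult)
  then show ?case using Suc assms by (simp add: stable_def)
qed simp

lemma orb_conj:
  assumes "x \<in> Fq r" "y \<in># orb x r"
  shows "orb y r = orb x r" "y \<in> Fq r"
proof -
  obtain i where i: "y = x ^ q ^ i" using assms(2) by (auto simp: orb_def)
  show "orb y r = orb x r" unfolding i orb_frob by (rule image_frob_stable[OF orb_stable[OF assms(1)]])
  show "y \<in> Fq r" unfolding i q_power using assms(1) power_in_Fsub_iff by blast
qed

text \<open>These are 0 and the elements whose orbit of length \<open>r\<close> repeats each
  conjugate a multiple of \<open>p\<close> times, invisible to all power sums of positive
  index.\<close>

definition bad :: "nat \<Rightarrow> 'k set" where
  "bad r = {x\<in>Fq r. mcong (orb x r) {#}}"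

lemma finite_bad: "r > 0 \<Longrightarrow> finite (bad r)"
  using finite_Fq by (auto simp: bad_def)

text \<open>A nonzero bad element has a degree dividing \<open>r div p\<close>, so it lies in the
  subfield with \<open>q ^ (r div p)\<close> elements, and \<open>p \<ge> 3\<close>. If
  \<open>p\<close> does not divide \<open>r\<close>, only 0 is bad.\<close>

lemma card_bad_le:
  assumes r: "r > 0"
  shows "card (bad r) \<le> q ^ (r div 3)"
proof -
  have q1: "q \<ge> 1" using q_ge3 by linarith
  have key: "p dvd r div fdeg x" if "x \<in> bad r" "x \<noteq> 0" for x
  proof -
    have x: "x \<in> Fq r" "mcong (orb x r) {#}" using that by (auto simp: bad_def)
    then have "of_nat (count (orb x r) x) = (0::'k)" using that by (simp add: mcong_def)
    then show ?thesis using count_orb_self[OF x(1) r] by (simp add: of_nat_eq_0)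
  qed
  show ?thesis
  proof (cases "p dvd r")
    case True
    then have pos: "r div p > 0" using r p by (auto elim!: dvdE simp: prime_gt_0_nat)
    have "bad r \<subseteq> Fq (r div p)"
    proof
      fix x assume b: "x \<in> bad r"
      show "x \<in> Fq (r div p)"
      proof (cases "x = 0")
        case False
        have x: "x \<in> Fq r" using b by (auto simp: bad_def)
        obtain k where k: "r = fdeg x * k" using Fsub_iff_fdeg_dvd[OF x r, of r] x by auto
        have "p dvd k" using key[OF b False] k fdeg_props(1)[OF x r] by simp
        then obtain l where "k = p * l" by auto
        then have "fdeg x dvd r div p" using k p by (simp add: prime_gt_0_nat)
        then show ?thesis using Fsub_iff_fdeg_dvd[OF x r] by blast
      qed simp
    qed
    then have "card (bad r) \<le> q ^ (r div p)"
      using card_Fq[OF pos] finite_Fq[OF pos] by (metis card_mono)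
    also have "\<dots> \<le> q ^ (r div 3)" using p_ge3 q1 by (intro power_increasing div_le_mono2) auto
    finally show ?thesis .
  next
    case False
    have "bad r \<subseteq> {0}"
    proof
      fix x assume b: "x \<in> bad r"
      show "x \<in> {0}"
      proof (rule ccontr)
        assume "x \<notin> {0}"
        then have "p dvd r div fdeg x" using key b by simp
        moreover have "fdeg x dvd r" using Fsub_iff_fdeg_dvd[of x r r] b r by (auto simp: bad_def)
        then have "fdeg x * (r div fdeg x) = r" by simp
        ultimately show False using False by (metis dvd_mult)
      qed
    qed
    then have "card (bad r) \<le> 1" using card_mono[of "{0}" "bad r"] by simp
    also have "1 \<le> q ^ (r div 3)" using q1 by (rule one_le_power)
    finally show ?thesis .
  qed
qed

definition conj_pairs :: "nat \<Rightarrow> ('k \<times> 'k) set" where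
  "conj_pairs g = (SIGMA x:Fq g. set_mset (orb x g))"

lemma card_conj_pairs_le: "g > 0 \<Longrightarrow> card (conj_pairs g) \<le> g * q ^ g"
proof -
  assume g: "g > 0"
  have "card (set_mset (orb x g)) \<le> g" for x using card_set_mset_le_size[of "orb x g"] by simp
  then have "(\<Sum>x\<in>Fq g. card (set_mset (orb x g))) \<le> (\<Sum>x\<in>Fq g. g)" by (intro sum_mono)
  then show ?thesis using finite_Fq[OF g] card_Fq[OF g] by (simp add: conj_pairs_def mult.commute)
qed

lemma finite_conj_pairs: "g > 0 \<Longrightarrow> finite (conj_pairs g)"
  unfolding conj_pairs_def using finite_Fq by auto

text \<open>A common conjugate lies in both fields, hence in the one belonging to the gcd, and
  membership in it is invariant under conjugation.\<close>

lemma conj_pairs_gcd: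
  assumes r: "r > 0" "s > 0" and x: "x \<in> Fq r" and y: "y \<in> Fq s"
    and z: "z \<in># orb x r" "z \<in># orb y s"
  shows "(x, y) \<in> conj_pairs (gcd r s)"
proof -
  define g where "g = gcd r s"
  have g: "g > 0" using r by (simp add: g_def)
  obtain i where i: "z = x ^ q ^ i" using z(1) by (auto simp: orb_def)
  obtain j where j: "z = y ^ q ^ j" using z(2) by (auto simp: orb_def)
  have zr: "z \<in> Fq r" "z \<in> Fq s" using orb_conj(2) x y z by auto
  from zr have "z \<in> Fq g"
    using Fsub_iff_fdeg_dvd[OF zr(1) r(1)] by (auto simp: g_def)
  then have xg: "x \<in> Fq g" unfolding i q_power power_in_Fsub_iff .
  have yg: "y \<in> Fq g" using \<open>z \<in> Fq g\<close> unfolding j q_power power_in_Fsub_iff .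
  \<comment> \<open>Frobenius is inverted by completing its cycle: \<open>g * j - j\<close> further
    steps undo \<open>j\<close> steps, so \<open>y\<close> is reached from \<open>x\<close> by
    forward steps alone.\<close>
  have "y = y ^ q ^ (g * j)" using Fsub_iterate[OF yg, of j] by (simp add: q_power mult.assoc)
  also have "\<dots> = (y ^ q ^ j) ^ q ^ (g * j - j)"
    using power_power_split[of "g * j - j" "g * j" y q] g by simp
  also have "\<dots> = x ^ q ^ (i + (g * j - j))" using i j by (simp add: power_add power_mult)
  finally have yx: "y = x ^ q ^ (i + (g * j - j))" .
  define k where "k = i + (g * j - j)"
  have "x ^ q ^ k = (x ^ q ^ (g * (k div g))) ^ q ^ (k mod g)"
    by (metis div_mult_mod_eq mult.commute power_add power_mult)
  also have "x ^ q ^ (g * (k div g)) = x"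
    using Fsub_iterate[OF xg, of "k div g"] by (simp add: q_power mult.assoc)
  finally have "y = x ^ q ^ (k mod g)" using yx by (simp add: k_def)
  then have "y \<in># orb x g" using g by (auto simp: orb_def)
  then show ?thesis using xg by (simp add: conj_pairs_def g_def)
qed

lemma count_nonzero_imp_mem: "(of_nat (count M z) :: 'k) \<noteq> 0 \<Longrightarrow> z \<in># M"
  using not_in_iff[of z M] by auto

text \<open>A point where one multiplicity is nonzero modulo \<open>p\<close> is such a point for
  the other too, and so lies in both orbits. Asking only for simultaneous vanishing covers equal as
  well as opposite multiplicities.\<close>

lemma common_orbit_element:
  assumes "x \<in> Fq r" "y \<in> Fq s" "\<not> (x \<in> bad r \<and> y \<in> bad s)"
    and c: "\<And>z. z \<noteq> 0 \<Longrightarrow> (of_nat (count (orb x r) z) :: 'k) = 0 \<longleftrightarrow> (of_nat (count (orb y s) z) :: 'k) = 0"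
  obtains z where "z \<noteq> 0" "(of_nat (count (orb x r) z) :: 'k) \<noteq> 0" "z \<in># orb x r" "z \<in># orb y s"
proof -
  have "x \<notin> bad r"
    using assms(1-3) c by (auto simp: bad_def mcong_def)
  then obtain z where z: "z \<noteq> 0" "(of_nat (count (orb x r) z) :: 'k) \<noteq> 0"
    using assms(1) by (auto simp: bad_def mcong_def)
  have "(of_nat (count (orb y s) z) :: 'k) \<noteq> 0" using z c by simp
  then have "z \<in># orb y s" by (rule count_nonzero_imp_mem)
  then show thesis by (rule that[OF z count_nonzero_imp_mem[OF z(2)]])
qed

text \<open>For \<open>r = s\<close> a common conjugate makes the two orbits equal, so their
  multiplicities double; as \<open>p\<close> is odd, a nonzero residue stays nonzero. In the
  remaining case \<open>r \<noteq> s\<close> the gcd is at most a third of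
  \<open>r + s\<close>.\<close>

lemma sum_pairs_subset:
  assumes r: "r > 0" "s > 0"
  shows "{z\<in>Fq r \<times> Fq s. mcong (orb (fst z) r + orb (snd z) s) {#}}
     \<subseteq> bad r \<times> bad s \<union> (if r = s then {} else conj_pairs (gcd r s))"
proof
  fix w assume "w \<in> {z\<in>Fq r \<times> Fq s. mcong (orb (fst z) r + orb (snd z) s) {#}}"
  then obtain x y where w: "w = (x, y)" and x: "x \<in> Fq r" and y: "y \<in> Fq s"
    and c: "mcong (orb x r + orb y s) {#}" by auto
  have cz: "(of_nat (count (orb x r) z) :: 'k) = - of_nat (count (orb y s) z)" if "z \<noteq> 0" for z
    using c that by (simp add: mcong_def eq_neg_iff_add_eq_0)
  show "w \<in> bad r \<times> bad s \<union> (if r = s then {} else conj_pairs (gcd r s))"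
  proof (cases "x \<in> bad r \<and> y \<in> bad s")
    case False
    obtain z where z: "z \<noteq> 0" "(of_nat (count (orb x r) z) :: 'k) \<noteq> 0" "z \<in># orb x r" "z \<in># orb y s"
      by (rule common_orbit_element[OF x y False]) (simp add: cz)
    have "r \<noteq> s"
    proof
      assume rs: "r = s"
      have o: "orb x r = orb z r" "orb y s = orb z r" using orb_conj(1)[OF x z(3)] orb_conj(1)[OF y z(4)] rs by auto
      then have "of_nat (2 * count (orb z r) z) = (0::'k)" using cz[OF z(1)] by simp
      then have "p dvd 2 * count (orb z r) z" using of_nat_eq_0 by blast
      moreover have "\<not> p dvd 2" using p by (auto dest: dvd_imp_le)
      ultimately have "p dvd count (orb z r) z" using p by (simp add: prime_dvd_mult_iff)
      then show False using z o(1) by (simp add: of_nat_eq_0)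
    qed
    then show ?thesis using conj_pairs_gcd[OF r x y z(3,4)] w by simp
  qed (use w in auto)
qed

lemma diff_pairs_subset:
  assumes r: "r > 0" "s > 0"
  shows "{z\<in>Fq r \<times> Fq s. mcong (orb (fst z) r) (orb (snd z) s)}
     \<subseteq> bad r \<times> bad s \<union> conj_pairs (gcd r s)"
proof
  fix w assume "w \<in> {z\<in>Fq r \<times> Fq s. mcong (orb (fst z) r) (orb (snd z) s)}"
  then obtain x y where w: "w = (x, y)" and x: "x \<in> Fq r" and y: "y \<in> Fq s"
    and c: "mcong (orb x r) (orb y s)" by auto
  show "w \<in> bad r \<times> bad s \<union> conj_pairs (gcd r s)"
  proof (cases "x \<in> bad r \<and> y \<in> bad s")
    case False
    obtain z where "z \<in># orb x r" "z \<in># orb y s"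
      by (rule common_orbit_element[OF x y False]) (use c in \<open>simp add: mcong_def\<close>)
    then show ?thesis using conj_pairs_gcd[OF r x y] w by simp
  qed (use w in auto)
qed

lemma card_sum_pairs_le:
  assumes r: "r > 0" "s > 0"
  shows "card {z\<in>Fq r \<times> Fq s. mcong (orb (fst z) r + orb (snd z) s) {#}}
     \<le> q ^ (r div 3) * q ^ (s div 3) + (if r = s then 0 else gcd r s * q ^ gcd r s)"
proof -
  have g: "gcd r s > 0" using r by simp
  have "card {z\<in>Fq r \<times> Fq s. mcong (orb (fst z) r + orb (snd z) s) {#}}
      \<le> card (bad r \<times> bad s \<union> (if r = s then {} else conj_pairs (gcd r s)))"
    by (intro card_mono sum_pairs_subset r) (use finite_bad r finite_conj_pairs[OF g] in auto)
  also have "\<dots> \<le> card (bad r) * card (bad s) + card (if r = s then {} else conj_pairs (gcd r s))"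
    using card_Un_le by (metis card_cartesian_product)
  also have "\<dots> \<le> q ^ (r div 3) * q ^ (s div 3) + (if r = s then 0 else gcd r s * q ^ gcd r s)"
    using card_bad_le r card_conj_pairs_le[OF g] by (intro add_mono mult_mono) auto
  finally show ?thesis .
qed

lemma card_diff_pairs_le:
  assumes r: "r > 0" "s > 0"
  shows "card {z\<in>Fq r \<times> Fq s. mcong (orb (fst z) r) (orb (snd z) s)}
     \<le> q ^ (r div 3) * q ^ (s div 3) + gcd r s * q ^ gcd r s"
proof -
  have g: "gcd r s > 0" using r by simp
  have "card {z\<in>Fq r \<times> Fq s. mcong (orb (fst z) r) (orb (snd z) s)}
      \<le> card (bad r \<times> bad s \<union> conj_pairs (gcd r s))"
    by (intro card_mono diff_pairs_subset r) (use finite_bad r finite_conj_pairs[OF g] in auto)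
  also have "\<dots> \<le> card (bad r) * card (bad s) + card (conj_pairs (gcd r s))"
    using card_Un_le by (metis card_cartesian_product)
  also have "\<dots> \<le> q ^ (r div 3) * q ^ (s div 3) + gcd r s * q ^ gcd r s"
    using card_bad_le r card_conj_pairs_le[OF g] by (intro add_mono mult_mono) auto
  finally show ?thesis .
qed

text \<open>An element of full degree \<open>r\<close> pairs with each of its \<open>r\<close>
  distinct conjugates. The elements of lower degree lie in subfields with at most
  \<open>q ^ (r div 2)\<close> elements each.\<close>

lemma card_diff_pairs_ge:
  assumes r: "r > 0"
  shows "r * q ^ r \<le> card {z\<in>Fq r \<times> Fq r. mcong (orb (fst z) r) (orb (snd z) r)} + r\<^sup>2 * q ^ (r div 2)"
proof -
  have q1: "q \<ge> 1" using q_ge3 by linarith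
  define small where "small = {x\<in>Fq r. fdeg x < r}"
  have fin: "finite (Fq r)" using finite_Fq r by blast
  have fdiv: "fdeg x dvd r" "fdeg x > 0" if "x \<in> Fq r" for x
    using that Fsub_iff_fdeg_dvd[OF that r, of r] fdeg_props(1)[OF that r] by auto
  have "small \<subseteq> (\<Union>e\<in>{1..r div 2}. Fq e)"
  proof
    fix x assume "x \<in> small"
    then have x: "x \<in> Fq r" "fdeg x < r" by (auto simp: small_def)
    obtain k where k: "r = fdeg x * k" using fdiv x by blast
    then have "k \<noteq> 0" "k \<noteq> 1" using x r by auto
    then have "2 * fdeg x \<le> r" using k by (simp add: mult.commute)
    then show "x \<in> (\<Union>e\<in>{1..r div 2}. Fq e)"
      using fdiv[OF x(1)] fdeg_props(2)[OF x(1) r] by (intro UN_I[of "fdeg x"]) auto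
  qed
  then have "card small \<le> card (\<Union>e\<in>{1..r div 2}. Fq e)"
    by (intro card_mono) (auto intro!: finite_Fq)
  also have "\<dots> \<le> (\<Sum>e\<in>{1..r div 2}. card (Fq e))" by (intro card_UN_le) simp
  also have "\<dots> \<le> (\<Sum>e\<in>{1..r div 2}. q ^ (r div 2))"
    by (intro sum_mono) (use q1 card_Fq in \<open>auto intro!: power_increasing\<close>)
  also have "\<dots> \<le> r * q ^ (r div 2)" by simp
  finally have small: "card small \<le> r * q ^ (r div 2)" .
  have "(SIGMA x:(Fq r - small). set_mset (orb x r)) \<subseteq> {z\<in>Fq r \<times> Fq r. mcong (orb (fst z) r) (orb (snd z) r)}"
  proof
    fix w assume "w \<in> (SIGMA x:(Fq r - small). set_mset (orb x r))"
    then obtain x y where w: "w = (x, y)" "x \<in> Fq r" "y \<in># orb x r" by auto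
    then show "w \<in> {z\<in>Fq r \<times> Fq r. mcong (orb (fst z) r) (orb (snd z) r)}"
      using orb_conj[OF w(2,3)] by (simp add: mcong_def)
  qed
  then have "card (SIGMA x:(Fq r - small). set_mset (orb x r))
      \<le> card {z\<in>Fq r \<times> Fq r. mcong (orb (fst z) r) (orb (snd z) r)}"
    by (intro card_mono) (use fin in auto)
  moreover have "card (SIGMA x:(Fq r - small). set_mset (orb x r)) = (\<Sum>x\<in>Fq r - small. card (set_mset (orb x r)))"
    using fin by simp
  moreover have "(\<Sum>x\<in>Fq r - small. card (set_mset (orb x r))) = (\<Sum>x\<in>Fq r - small. r)"
  proof (intro sum.cong refl)
    fix x assume "x \<in> Fq r - small"
    then have x: "x \<in> Fq r" "fdeg x = r"
      using fdiv dvd_imp_le[of "fdeg x" r] r by (force simp: small_def)+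
    have "size (orb x r) = (\<Sum>y\<in>set_mset (orb x r). count (orb x r) y)" by (simp only: size_multiset_overloaded_eq)
    also have "\<dots> = card (set_mset (orb x r))" using count_orb_fdeg[OF x(1) r] x(2) by simp
    finally show "card (set_mset (orb x r)) = r" by simp
  qed
  moreover have "card (Fq r - small) = q ^ r - card small"
    using fin card_Fq[OF r] by (subst card_Diff_subset) (auto simp: small_def)
  ultimately have "(q ^ r - card small) * r \<le> card {z\<in>Fq r \<times> Fq r. mcong (orb (fst z) r) (orb (snd z) r)}"
    by simp
  moreover have "r * q ^ r \<le> (q ^ r - card small) * r + r * card small"
  proof -
    have "r * q ^ r \<le> r * ((q ^ r - card small) + card small)" by (intro mult_le_mono2) simp
    then show ?thesis by (simp only: add_mult_distrib2 mult.commute[of r])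
  qed
  moreover have "r * card small \<le> r\<^sup>2 * q ^ (r div 2)"
    using small by (simp add: power2_eq_square mult.assoc)
  ultimately show ?thesis by linarith
qed

end

section \<open>Averages of the normalised power sums\<close>

lemma quadratic_times_geometric_bounded:
  fixes x :: real
  assumes "0 < x" "x < 1"
  shows "\<exists>C. \<forall>k::nat. (1 + real k)\<^sup>2 * x ^ k \<le> C"
proof -
  \<comment> \<open>Writing \<open>x\<close> as \<open>z * z\<close> gives each of the two linear
    factors a geometric factor of its own.\<close>
  define z where "z = sqrt x"
  have z: "0 < z" "z < 1" "z * z = x" using assms by (auto simp: z_def)
  have "(\<lambda>k. real k * z ^ k + z ^ k) \<longlonglongrightarrow> 0 + 0"
    using z by (intro tendsto_add powser_times_n_limit_0 LIMSEQ_power_zero) auto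
  then have "Bseq (\<lambda>k. real k * z ^ k + z ^ k)" using convergent_imp_Bseq convergent_def by blast
  then obtain C where C: "\<And>k. norm (real k * z ^ k + z ^ k) \<le> C" by (auto simp: Bseq_def)
  have "(1 + real k)\<^sup>2 * x ^ k \<le> C\<^sup>2" for k
  proof -
    have "(1 + real k)\<^sup>2 * x ^ k = (real k * z ^ k + z ^ k)\<^sup>2"
      by (simp add: z(3)[symmetric] power_mult_distrib power2_eq_square algebra_simps)
    also have "\<dots> \<le> C\<^sup>2" using C[of k] z by (intro power_mono) auto
    finally show ?thesis .
  qed
  then show ?thesis by blast
qed

lemma sum_mset_cnj: "(\<Sum>x\<in>#M. cnj (g x)) = cnj (\<Sum>x\<in>#M. g x)"
  by (induction M) auto

lemma six_div_three_le: "6 * (r div 3 + s div 3) + (r + s) \<le> 3 * (r + s)" for r s :: nat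
proof -
  have "6 * (a + b) + (r + s) \<le> 3 * (r + s)" if "3 * a \<le> r" "3 * b \<le> s" for a b
    using that by presburger
  then show ?thesis by simp
qed

context add_char
begin

lemma p_pos [simp]: "0 < p" using p by simp

lemma q_gt_1: "1 < real q"
proof -
  have "1 < q" using q_ge3 by linarith
  then show ?thesis by (metis of_nat_1 of_nat_less_iff)
qed

definition zsum :: "'k poly \<Rightarrow> int \<Rightarrow> complex" where
  "zsum f r = (\<Sum>\<rho>\<in>#norm_zeros p n \<psi> f. \<rho> powi r)"

lemma zsum_pos:
  assumes "f \<in> family p n d" "coprime d p" "d > 0" "r > 0"
  shows "zsum f (int r) = - CS f r / of_real (sqrt q ^ r)"
  using norm_zeros_props(3)[OF assms] by (simp add: zsum_def)

lemma zsum_uminus: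
  assumes "f \<in> family p n d" "coprime d p" "d > 0"
  shows "zsum f (- r) = cnj (zsum f r)"
proof -
  have "\<rho> powi (- r) = cnj (\<rho> powi r)" if "\<rho> \<in># norm_zeros p n \<psi> f" for \<rho>
  proof -
    have "norm (\<rho> powi r) = 1" using norm_zeros_props(2)[OF assms that] by (simp add: norm_power_int)
    then have "inverse (\<rho> powi r) = cnj (\<rho> powi r)"
      by (metis complex_norm_square inverse_unique of_real_1 power_one)
    then show ?thesis by (simp add: power_int_minus)
  qed
  then have "zsum f (- r) = (\<Sum>\<rho>\<in>#norm_zeros p n \<psi> f. cnj (\<rho> powi r))"
    unfolding zsum_def by (intro arg_cong[of _ _ sum_mset] image_mset_cong) auto
  also have "\<dots> = cnj (zsum f r)" unfolding zsum_def by (rule sum_mset_cnj)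
  finally show ?thesis .
qed

lemma zsum_0:
  assumes "f \<in> family p n d" "coprime d p" "d > 0"
  shows "zsum f 0 = of_nat (d - 1)"
  using norm_zeros_props(1)[OF assms] by (simp add: zsum_def)

abbreviation yq :: real where "yq \<equiv> real q powr (- 1 / 6)"

text \<open>The hypothesis says \<open>m \<le> k / 3\<close>, and
  \<open>k / 3 - k / 2 = - k / 6\<close> is the exponent in \<open>yq ^ k\<close>. Counts of size
  \<open>q ^ m\<close> are thus small after normalisation.\<close>

lemma q_power_ratio:
  assumes "6 * m + k \<le> 3 * k"
  shows "real (q ^ m) / sqrt q ^ k \<le> yq ^ k"
proof -
  have q0: "real q > 1" by (rule q_gt_1)
  have "real (q ^ m) = real q powr m" using q0 by (simp add: powr_realpow)
  moreover have "sqrt q ^ k = real q powr (k / 2)" using q0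
    by (simp add: powr_half_sqrt[symmetric] powr_powr flip: powr_realpow)
  moreover have "yq ^ k = real q powr (- k / 6)" using q0
    by (simp add: powr_powr flip: powr_realpow)
  moreover have "real m - k / 2 \<le> - k / 6" using assms by linarith
  ultimately show ?thesis using q0 by (simp add: powr_diff[symmetric])
qed

lemma sqrt_q_power_pos: "sqrt q ^ k > 0"
  using q_ge3 by (metis real_sqrt_gt_0_iff of_nat_0_less_iff zero_less_power less_le_trans zero_less_numeral)

lemma yq_pos: "0 < yq" using q_ge3 by (metis powr_gt_zero of_nat_0_less_iff less_le_trans zero_less_numeral less_numeral_extra(3))

lemma avg_zsum_pos:
  assumes d: "coprime d p" and r: "0 < r" "r < d"
  shows "norm (avg d (\<lambda>f. zsum f (int r))) \<le> yq ^ r"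
proof -
  have "avg d (\<lambda>f. zsum f (int r)) = avg d (\<lambda>f. (- 1 / of_real (sqrt q ^ r)) * CS f r)"
    by (rule avg_cong) (use d r zsum_pos in auto)
  also have "\<dots> = (- 1 / of_real (sqrt q ^ r)) * of_nat (card (bad r))"
    unfolding avg_cmult avg_char_sum[OF d r] bad_def ..
  finally have "norm (avg d (\<lambda>f. zsum f (int r))) = real (card (bad r)) / sqrt q ^ r"
    using sqrt_q_power_pos[of r] by (simp add: norm_mult norm_divide norm_power)
  also have "\<dots> \<le> real (q ^ (r div 3)) / sqrt q ^ r"
    using card_bad_le[OF r(1)] sqrt_q_power_pos[of r] by (intro divide_right_mono) (auto simp flip: of_nat_power)
  also have "\<dots> \<le> yq ^ r" by (rule q_power_ratio) linarith
  finally show ?thesis .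
qed

text \<open>Two distinct positive multiples of the gcd add up to at least once plus twice the
  gcd.\<close>

lemma three_gcd_le:
  assumes "(r::nat) \<noteq> s" "r > 0" "s > 0"
  shows "3 * gcd r s \<le> r + s"
proof -
  obtain a b where ab: "r = gcd r s * a" "s = gcd r s * b" by (metis dvdE gcd_dvd1 gcd_dvd2)
  then have "a \<noteq> 0" "b \<noteq> 0" "a \<noteq> b" using assms by (metis mult_0_right less_irrefl)+
  then have "3 \<le> a + b" by linarith
  then have "gcd r s * 3 \<le> gcd r s * (a + b)" by (intro mult_le_mono2)
  then show ?thesis using ab by (metis distrib_left mult.commute)
qed

text \<open>The quadratic factor accommodates both the gcd in front of the number of conjugate pairs
  and the \<open>r^2\<close> of \<open>card_diff_pairs_ge\<close>.\<close>

abbreviation errb :: "nat \<Rightarrow> real" where "errb k \<equiv> (1 + real k)\<^sup>2 * yq ^ k"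

lemma pair_count_bound:
  assumes r: "0 < r" "0 < s" and c: "real c \<le> q ^ (r div 3) * q ^ (s div 3) + (if r = s then 0 else gcd r s * q ^ gcd r s)"
  shows "real c / sqrt q ^ (r + s) \<le> errb (r + s)"
proof -
  let ?D = "sqrt q ^ (r + s)"
  have D: "?D > 0" by (rule sqrt_q_power_pos)
  have y: "0 \<le> yq ^ (r + s)" using yq_pos by simp
  have a: "real (q ^ (r div 3 + s div 3)) / ?D \<le> yq ^ (r + s)" by (rule q_power_ratio[OF six_div_three_le])
  have b: "real (if r = s then 0 else gcd r s * q ^ gcd r s) / ?D \<le> (r + s) * yq ^ (r + s)"
  proof (cases "r = s")
    case False
    note g = three_gcd_le[OF False r]
    have "real (gcd r s * q ^ gcd r s) / ?D = gcd r s * (real (q ^ gcd r s) / ?D)" by simp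
    also have "\<dots> \<le> real (r + s) * yq ^ (r + s)"
      using g D by (intro mult_mono q_power_ratio) auto
    finally show ?thesis using False by simp
  qed (use y in simp)
  have "real c / ?D \<le> (real (q ^ (r div 3 + s div 3)) + real (if r = s then 0 else gcd r s * q ^ gcd r s)) / ?D"
    using c D by (intro divide_right_mono) (auto simp: power_add)
  also have "\<dots> \<le> yq ^ (r + s) + (r + s) * yq ^ (r + s)" using a b by (simp only: add_divide_distrib add_mono)
  also have "\<dots> = (1 + real (r + s)) * yq ^ (r + s)" by (simp add: algebra_simps)
  also have "\<dots> \<le> (1 + real (r + s))\<^sup>2 * yq ^ (r + s)"
    using y by (intro mult_right_mono) (auto simp: power2_eq_square)
  finally show ?thesis .
qed

lemma avg_zsum_mult_pos:
  assumes d: "coprime d p" and r: "0 < r" "0 < s" "r + s < d"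
  shows "norm (avg d (\<lambda>f. zsum f (int r) * zsum f (int s))) \<le> errb (r + s)"
proof -
  let ?c = "card {z\<in>Fq r \<times> Fq s. mcong (orb (fst z) r + orb (snd z) s) {#}}"
  have "avg d (\<lambda>f. zsum f (int r) * zsum f (int s)) = avg d (\<lambda>f. (1 / of_real (sqrt q ^ (r + s))) * (CS f r * CS f s))"
    by (rule avg_cong) (use d r zsum_pos in \<open>auto simp: power_add\<close>)
  also have "\<dots> = (1 / of_real (sqrt q ^ (r + s))) * of_nat ?c"
    unfolding avg_cmult avg_char_sum_mult[OF d r] ..
  finally have "norm (avg d (\<lambda>f. zsum f (int r) * zsum f (int s))) = real ?c / sqrt q ^ (r + s)"
    using sqrt_q_power_pos[of "r + s"] by (simp add: norm_mult norm_divide norm_power)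
  also have "\<dots> \<le> errb (r + s)"
    using card_sum_pairs_le[OF r(1,2)] by (intro pair_count_bound r) (simp only: of_nat_le_iff)
  finally show ?thesis .
qed

text \<open>For \<open>r = s\<close> the normalisation is exactly \<open>q ^ r\<close>, so about
  \<open>r * q ^ r\<close> conjugate pairs produce \<open>r\<close>; the deviation needs counts from
  above and from below. For \<open>r \<noteq> s\<close> an upper bound is enough.\<close>

lemma avg_zsum_mult_neg:
  assumes d: "coprime d p" and r: "0 < r" "0 < s" "r + s < d"
  shows "norm (avg d (\<lambda>f. zsum f (int r) * zsum f (- int s)) - (if r = s then of_nat r else 0)) \<le> errb (r + s)"
proof -
  let ?c = "card {z\<in>Fq r \<times> Fq s. mcong (orb (fst z) r) (orb (snd z) s)}"
  let ?D = "sqrt q ^ (r + s)"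
  have D: "?D > 0" by (rule sqrt_q_power_pos)
  have "avg d (\<lambda>f. zsum f (int r) * zsum f (- int s)) = avg d (\<lambda>f. (1 / of_real ?D) * (CS f r * cnj (CS f s)))"
    by (rule avg_cong) (use d r zsum_pos zsum_uminus in \<open>auto simp: power_add\<close>)
  also have "\<dots> = (1 / of_real ?D) * of_nat ?c"
    unfolding avg_cmult avg_char_sum_mult_cnj[OF d r] ..
  finally have E: "avg d (\<lambda>f. zsum f (int r) * zsum f (- int s)) = of_real (real ?c / ?D)" by simp
  have c: "?c \<le> q ^ (r div 3) * q ^ (s div 3) + gcd r s * q ^ gcd r s" by (rule card_diff_pairs_le[OF r(1,2)])
  show ?thesis
  proof (cases "r = s")
    case False
    have "real ?c / ?D \<le> errb (r + s)"
      by (rule pair_count_bound[OF r(1,2)]) (use c False in \<open>simp only: of_nat_le_iff if_False\<close>)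
    moreover have "real ?c / ?D \<ge> 0" using D by (intro divide_nonneg_pos) auto
    ultimately show ?thesis unfolding E if_not_P[OF False] diff_0_right norm_of_real by linarith
  next
    case True
    have q0: "real q > 1" by (rule q_gt_1)
    have Dq: "?D = real q ^ r"
      using q0 True by (simp add: power_add flip: power_mult_distrib)
    have y: "0 \<le> yq ^ (r + s)" using yq_pos by simp
    have up: "real ?c / ?D - r \<le> errb (r + s)"
    proof -
      have "real ?c \<le> real (q ^ (r div 3 + s div 3)) + r * real q ^ r"
        using c True unfolding of_nat_le_iff[where 'a = real, symmetric] by (simp add: power_add)
      then have "real ?c / ?D \<le> (real (q ^ (r div 3 + s div 3)) + r * real q ^ r) / ?D"
        using D by (intro divide_right_mono) auto
      also have "\<dots> = real (q ^ (r div 3 + s div 3)) / ?D + r" unfolding Dq using q0 by (simp add: add_divide_distrib)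
      also have "real (q ^ (r div 3 + s div 3)) / ?D \<le> yq ^ (r + s)" by (rule q_power_ratio[OF six_div_three_le])
      also have "\<dots> \<le> errb (r + s)" using y mult_right_mono[of 1 "(1 + real (r + s))\<^sup>2" "yq ^ (r + s)"] by (simp add: one_le_power)
      finally show ?thesis by simp
    qed
    have low: "r - real ?c / ?D \<le> errb (r + s)"
    proof -
      have "r * q ^ r \<le> ?c + r\<^sup>2 * q ^ (r div 2)" using card_diff_pairs_ge[OF r(1)] True by simp
      then have "real r * real q ^ r \<le> real ?c + (real r)\<^sup>2 * real (q ^ (r div 2))"
        unfolding of_nat_le_iff[where 'a = real, symmetric] by simp
      then have "real r * real q ^ r / ?D \<le> (real ?c + (real r)\<^sup>2 * real (q ^ (r div 2))) / ?D"
        using D by (intro divide_right_mono) auto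
      moreover have "real r * real q ^ r / ?D = r" unfolding Dq using q0 by simp
      ultimately have "r - real ?c / ?D \<le> (real r)\<^sup>2 * (real (q ^ (r div 2)) / ?D)"
        by (simp add: add_divide_distrib)
      also have "\<dots> \<le> (1 + real (r + s))\<^sup>2 * yq ^ (r + s)"
        using D True by (intro mult_mono q_power_ratio power_mono) auto
      finally show ?thesis .
    qed
    have "norm (of_real a - of_nat r :: complex) = \<bar>a - r\<bar>" for a
    proof -
      have "of_real a - of_nat r = (of_real (a - real r) :: complex)" by simp
      then show ?thesis by (simp only: norm_of_real)
    qed
    moreover have "\<bar>real ?c / ?D - r\<bar> \<le> errb (r + s)"
      by (rule abs_leI[OF up]) (unfold minus_diff_eq, rule low)
    ultimately show ?thesis unfolding E if_P[OF True] by (simp only:)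
  qed
qed

text \<open>The constants are uniform in \<open>d\<close>, which the later summation over
  frequencies requires. Conjugating the average reverses both frequencies and reduces the claim to a
  positive first one.\<close>

lemma avg_zsum_bounds:
  obtains C x where "0 \<le> x" "x < 1" "0 \<le> C"
    "\<And>d r. coprime d p \<Longrightarrow> r \<noteq> 0 \<Longrightarrow> \<bar>r\<bar> < int d \<Longrightarrow>
       norm (avg d (\<lambda>f. zsum f r)) \<le> C * x ^ nat \<bar>r\<bar>"
    "\<And>d r s. coprime d p \<Longrightarrow> r \<noteq> 0 \<Longrightarrow> s \<noteq> 0 \<Longrightarrow> \<bar>r\<bar> + \<bar>s\<bar> < int d \<Longrightarrow>
       norm (avg d (\<lambda>f. zsum f r * zsum f s) - (if r + s = 0 then of_int \<bar>r\<bar> else 0)) \<le> C * x ^ nat (\<bar>r\<bar> + \<bar>s\<bar>)"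
proof -
  \<comment> \<open>This is the square root of \<open>yq\<close>: half of the decay pays for the
    quadratic factor in \<open>errb\<close>.\<close>
  define x where "x = real q powr (- 1 / 12)"
  have q0: "real q > 1" by (rule q_gt_1)
  have x: "0 < x" "x < 1" unfolding x_def using q0 by (auto intro: powr_less_one)
  have yx: "yq = x * x" unfolding x_def by (simp flip: powr_add)
  obtain C where C: "\<And>k::nat. (1 + real k)\<^sup>2 * x ^ k \<le> C" using quadratic_times_geometric_bounded[OF x] by auto
  have C0: "0 \<le> C" using C[of 0] by simp
  have err: "errb k \<le> C * x ^ k" for k
  proof -
    have "errb k = ((1 + real k)\<^sup>2 * x ^ k) * x ^ k" by (simp only: yx power_mult_distrib mult_ac)
    also have "\<dots> \<le> C * x ^ k" using C x by (intro mult_right_mono) auto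
    finally show ?thesis .
  qed
  have one: "yq ^ k \<le> errb k" for k
    using yq_pos mult_right_mono[of 1 "(1 + real k)\<^sup>2" "yq ^ k"] by (simp add: one_le_power)
  have A: "norm (avg d (\<lambda>f. zsum f r)) \<le> C * x ^ nat \<bar>r\<bar>"
    if d: "coprime d p" and r: "r \<noteq> 0" "\<bar>r\<bar> < int d" for d r
  proof -
    obtain m where m: "m > 0" "m < d" "r = int m \<or> r = - int m"
      using r by (cases r rule: int_cases2) auto
    have "avg d (\<lambda>f. zsum f (- int m)) = cnj (avg d (\<lambda>f. zsum f (int m)))"
      unfolding avg_cnj[symmetric] by (rule avg_cong) (use zsum_uminus d m in auto)
    then have "norm (avg d (\<lambda>f. zsum f r)) = norm (avg d (\<lambda>f. zsum f (int m)))" using m by auto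
    also have "\<dots> \<le> C * x ^ m" using avg_zsum_pos[OF d m(1,2)] one[of m] err[of m] by linarith
    finally show ?thesis using m by auto
  qed
  have B: "norm (avg d (\<lambda>f. zsum f r * zsum f s) - (if r + s = 0 then of_int \<bar>r\<bar> else 0)) \<le> C * x ^ nat (\<bar>r\<bar> + \<bar>s\<bar>)"
    if d: "coprime d p" and r: "r \<noteq> 0" "s \<noteq> 0" "\<bar>r\<bar> + \<bar>s\<bar> < int d" for d r s
  proof -
    have pos: "norm (avg d (\<lambda>f. zsum f r * zsum f s) - (if r + s = 0 then of_int \<bar>r\<bar> else 0)) \<le> C * x ^ nat (\<bar>r\<bar> + \<bar>s\<bar>)"
      if rs: "r > 0" "s \<noteq> 0" "\<bar>r\<bar> + \<bar>s\<bar> < int d" for r s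
    proof -
      define a b where "a = nat r" and "b = nat \<bar>s\<bar>"
      have ab: "0 < a" "0 < b" "a + b < d" "r = int a" using rs by (auto simp: a_def b_def)
      have k: "nat (\<bar>r\<bar> + \<bar>s\<bar>) = a + b" using rs by (auto simp: a_def b_def)
      show ?thesis
      proof (cases "s > 0")
        case True
        then have "s = int b" by (simp add: b_def)
        then show ?thesis unfolding k using avg_zsum_mult_pos[OF d ab(1-3)] err[of "a + b"] ab True by simp
      next
        case False
        then have s: "s = - int b" by (simp add: b_def)
        have "(if r + s = 0 then of_int \<bar>r\<bar> else 0) = (if a = b then of_nat a else (0::complex))"
          using ab s by auto
        then show ?thesis unfolding k using avg_zsum_mult_neg[OF d ab(1-3)] err[of "a + b"] ab s by simp
      qed
    qed
    show ?thesis
    proof (cases "r > 0")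
      case False
      then have "- r > 0" using r by simp
      have *: "norm (avg d (\<lambda>f. zsum f (- r) * zsum f (- s)) - (if r + s = 0 then of_int \<bar>r\<bar> else 0))
          \<le> C * x ^ nat (\<bar>r\<bar> + \<bar>s\<bar>)"
      proof -
        have e: "- r + - s = 0 \<longleftrightarrow> r + s = 0" by linarith
        show ?thesis using pos[OF \<open>- r > 0\<close>, of "- s"] r unfolding e abs_minus_cancel by simp
      qed
      have "avg d (\<lambda>f. zsum f (- r) * zsum f (- s)) = cnj (avg d (\<lambda>f. zsum f r * zsum f s))"
        unfolding avg_cnj[symmetric] by (rule avg_cong) (use zsum_uminus d r in auto)
      then have "avg d (\<lambda>f. zsum f (- r) * zsum f (- s)) - (if r + s = 0 then of_int \<bar>r\<bar> else 0)
          = cnj (avg d (\<lambda>f. zsum f r * zsum f s) - (if r + s = 0 then of_int \<bar>r\<bar> else 0))" by auto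
      then show ?thesis using * by (metis complex_mod_cnj)
    next
      case True
      show ?thesis by (rule pos[OF True r(2,3)])
    qed
  qed
  show thesis by (rule that[OF less_imp_le[OF x(1)] x(2) C0 A B])
qed

end

section \<open>Poisson summation on the plane\<close>

lemma abs_components_le_norm: "\<bar>fst y\<bar> \<le> norm y" "\<bar>snd y\<bar> \<le> norm y" for y :: "real \<times> real"
  by (simp_all add: norm_prod_def)

lemma schwartz2_continuous: "schwartz2 V \<Longrightarrow> continuous_on UNIV V"
proof -
  assume "schwartz2 V"
  then have "pdiffs [] V differentiable (at x)" for x unfolding schwartz2_def by blast
  then show ?thesis
    by (metis pdiffs.simps(1) continuous_at_imp_continuous_on differentiable_imp_continuous_within)
qed

text \<open>The weight \<open>(1 + norm x) ^ 4\<close> leaves two powers for each coordinate. In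
  this product form, integrals and lattice sums can be treated one variable at a time.\<close>

lemma schwartz2_decay:
  assumes "schwartz2 V"
  shows "\<exists>C. \<forall>t u. norm (V (t, u)) \<le> C / ((1 + t\<^sup>2) * (1 + u\<^sup>2))"
proof -
  have "\<exists>C. \<forall>x. (1 + norm x) ^ 4 * norm (pdiffs [] V x) \<le> C"
    using assms unfolding schwartz2_def by blast
  then obtain C where C: "\<And>x. (1 + norm x) ^ 4 * norm (V x) \<le> C" by auto
  have "norm (V (t, u)) \<le> C / ((1 + t\<^sup>2) * (1 + u\<^sup>2))" for t u
  proof -
    define r where "r = norm (t, u)"
    have r: "\<bar>t\<bar> \<le> r" "\<bar>u\<bar> \<le> r" "0 \<le> r" unfolding r_def
      using abs_components_le_norm[of "(t, u)"] by auto
    have a: "1 + s\<^sup>2 \<le> (1 + r)\<^sup>2" if "\<bar>s\<bar> \<le> r" for s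
    proof -
      have "s\<^sup>2 \<le> r\<^sup>2" using that r by (metis abs_le_square_iff abs_of_nonneg)
      then show ?thesis using r by (simp add: power2_sum)
    qed
    have "(1 + t\<^sup>2) * (1 + u\<^sup>2) \<le> (1 + r)\<^sup>2 * (1 + r)\<^sup>2" by (intro mult_mono a r) auto
    also have "\<dots> = (1 + r) ^ 4" by (simp flip: power_add)
    finally have "(1 + t\<^sup>2) * (1 + u\<^sup>2) * norm (V (t, u)) \<le> (1 + r) ^ 4 * norm (V (t, u))"
      by (intro mult_right_mono) auto
    also have "\<dots> \<le> C" using C[of "(t, u)"] by (simp add: r_def)
    finally show ?thesis by (simp add: le_divide_eq add_pos_nonneg mult.commute)
  qed
  then show ?thesis by blast
qed

lemma integrable_cauchy_kernel: "integrable lborel (\<lambda>t::real. 1 / (1 + t\<^sup>2))"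
proof -
  have d: "((\<lambda>x. arctan x) has_real_derivative 1 / (1 + x\<^sup>2)) (at x)" for x :: real
    using DERIV_arctan[of x] by (simp add: inverse_eq_divide)
  have "(\<integral>\<^sup>+x. ennreal (1 / (1 + x\<^sup>2)) * indicator {0..} x \<partial>lborel) = ennreal (pi / 2 - arctan 0)"
    by (rule nn_integral_FTC_atLeast) (use d tendsto_arctan_at_top in auto)
  also have "(\<lambda>x::real. ennreal (1 / (1 + x\<^sup>2)) * indicator {0..} x) = (\<lambda>x. ennreal (indicator {0..} x *\<^sub>R (1 / (1 + x\<^sup>2))))"
    by (auto simp: indicator_def)
  finally have fin: "(\<integral>\<^sup>+x. ennreal (indicator {0..} x *\<^sub>R (1 / (1 + x\<^sup>2))) \<partial>lborel) < \<infinity>" by simp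
  have p: "set_integrable lborel {0..} (\<lambda>x::real. 1 / (1 + x\<^sup>2))"
    unfolding set_integrable_def
    by (rule integrableI_nonneg) (use fin in \<open>auto simp: indicator_def\<close>)
  then have "integrable lborel (\<lambda>x::real. indicator {0..} (0 + (-1) * x) *\<^sub>R (1 / (1 + (0 + (-1) * x)\<^sup>2)))"
    unfolding set_integrable_def by (rule lborel_integrable_real_affine) simp
  also have "(\<lambda>x::real. indicator {0..} (0 + (-1) * x) *\<^sub>R (1 / (1 + (0 + (-1) * x)\<^sup>2)))
    = (\<lambda>x. indicator {..0} x *\<^sub>R (1 / (1 + x\<^sup>2)))" by (auto simp: indicator_def)
  finally have m: "set_integrable lborel {..0} (\<lambda>x::real. 1 / (1 + x\<^sup>2))" unfolding set_integrable_def .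
  have "set_integrable lborel ({0..} \<union> {..0}) (\<lambda>x::real. 1 / (1 + x\<^sup>2))"
    by (rule set_integrable_Un[OF p m]) auto
  moreover have "{0..} \<union> {..0} = (UNIV :: real set)" by auto
  ultimately show ?thesis by (simp add: set_integrable_def)
qed

lemma integrable_cauchy_kernel2:
  "integrable lborel (\<lambda>x::real \<times> real. 1 / ((1 + (fst x)\<^sup>2) * (1 + (snd x)\<^sup>2)))"
proof -
  let ?f = "\<lambda>x::real \<times> real. 1 / ((1 + (fst x)\<^sup>2) * (1 + (snd x)\<^sup>2))"
  have "integrable (lborel \<Otimes>\<^sub>M lborel) ?f"
  proof (rule lborel_pair.Fubini_integrable)
    show "?f \<in> borel_measurable (lborel \<Otimes>\<^sub>M lborel)" by measurable
    have i: "integrable lborel (\<lambda>y. ?f (x, y))" for x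
      using integrable_mult_right[OF integrable_cauchy_kernel, of "1 / (1 + x\<^sup>2)"] by simp
    show "AE x in lborel. integrable lborel (\<lambda>y. ?f (x, y))" using i by simp
    have "(\<integral>y. norm (?f (x, y)) \<partial>lborel) = (1 / (1 + x\<^sup>2)) * (\<integral>y. 1 / (1 + y\<^sup>2) \<partial>lborel)" for x
    proof -
      have "norm (?f (x, y)) = 1 / (1 + x\<^sup>2) * (1 / (1 + y\<^sup>2))" for y by (simp add: add_nonneg_nonneg)
      then show ?thesis by (simp only: integral_mult_right_zero)
    qed
    then show "integrable lborel (\<lambda>x. \<integral>y. norm (?f (x, y)) \<partial>lborel)"
      using integrable_mult_left[OF integrable_cauchy_kernel] by simp
  qed
  then show ?thesis by (simp add: lborel_prod)
qed

text \<open>Peetre's inequality, from \<open>y^2 \<le> 2 * (t + y)^2 + 2 * t^2\<close>. With a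
  lattice point for \<open>y\<close> it bounds the shifted function by a lattice weight, at the cost
  of a factor depending on \<open>t\<close> only.\<close>

lemma peetre_real: "1 + y\<^sup>2 \<le> 2 * (1 + t\<^sup>2) * (1 + (t + y)\<^sup>2)" for t y :: real
proof -
  have "y\<^sup>2 + (2 * t + y)\<^sup>2 = 2 * (t + y)\<^sup>2 + 2 * t\<^sup>2" by (simp add: power2_eq_square algebra_simps)
  then have "y\<^sup>2 \<le> 2 * (t + y)\<^sup>2 + 2 * t\<^sup>2" by (smt (verit) zero_le_power2)
  moreover have "0 \<le> t\<^sup>2 * (t + y)\<^sup>2" by simp
  moreover have "2 * (1 + t\<^sup>2) * (1 + (t + y)\<^sup>2) = 2 + 2 * t\<^sup>2 + 2 * (t + y)\<^sup>2 + 2 * (t\<^sup>2 * (t + y)\<^sup>2)"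
    by (simp only: distrib_left distrib_right mult_1_right mult_1_left mult.assoc add_ac)
  ultimately show ?thesis by linarith
qed

lemma summable_on_int_kernel:
  assumes c: "c > (0::real)"
  shows "(\<lambda>m::int. 1 / (1 + (c * of_int m)\<^sup>2)) summable_on UNIV"
proof -
  let ?g = "\<lambda>m::int. 1 / (1 + (c * of_int m)\<^sup>2)"
  have nat: "summable (\<lambda>n::nat. ?g (int n))"
  proof (rule summable_comparison_test)
    show "summable (\<lambda>n. (1 / c\<^sup>2) * inverse (real n ^ 2))"
      by (intro summable_mult inverse_power_summable) simp
    show "\<exists>N. \<forall>n\<ge>N. norm (?g (int n)) \<le> (1 / c\<^sup>2) * inverse (real n ^ 2)"
    proof (intro exI allI impI)
      fix n :: nat assume "1 \<le> n"
      then have "1 / (1 + (c * real n)\<^sup>2) \<le> 1 / (c * real n)\<^sup>2"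
        using c by (intro divide_left_mono) (auto simp: add_pos_nonneg)
      then show "norm (?g (int n)) \<le> (1 / c\<^sup>2) * inverse (real n ^ 2)"
        by (simp add: power_mult_distrib field_simps add_nonneg_nonneg)
    qed
  qed
  have nneg: "0 \<le> ?g m" for m by (simp add: add_nonneg_nonneg)
  have 1: "?g summable_on (range int)"
  proof (subst summable_on_reindex)
    show "(?g \<circ> int) summable_on UNIV"
      using nat nneg by (intro norm_summable_imp_summable_on) (simp add: comp_def)
  qed simp
  have 2: "?g summable_on (range (\<lambda>n. - int n))"
  proof (subst summable_on_reindex)
    show "(?g \<circ> (\<lambda>n. - int n)) summable_on UNIV"
      using nat nneg by (intro norm_summable_imp_summable_on) (simp add: comp_def)
  qed (auto intro: injI)
  have "?g summable_on (range int \<union> range (\<lambda>n. - int n))"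
    using 1 2 nneg summable_on_union by blast
  moreover have "m \<in> range int \<union> range (\<lambda>n. - int n)" for m :: int
    by (cases m rule: int_cases2) auto
  then have "range int \<union> range (\<lambda>n. - int n) = UNIV" by blast
  ultimately show ?thesis by simp
qed

text \<open>Running through the lattice as a sequence makes countable additivity and the Weierstrass
  test applicable to the periodisation.\<close>

definition lattice_enum :: "nat \<Rightarrow> int \<times> int" where
  "lattice_enum = map_prod int_decode int_decode \<circ> prod_decode"

lemma bij_lattice_enum: "bij lattice_enum"
  unfolding lattice_enum_def
  by (intro bij_comp bij_prod_decode) (auto simp: bij_def intro: prod.inj_map inj_int_decode simp: map_prod_surj surj_int_decode)

definition lattice_shift :: "real \<Rightarrow> int \<times> int \<Rightarrow> real \<times> real" where
  "lattice_shift L z = (L * of_int (fst z), L * of_int (snd z))"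

definition lattice_weight :: "real \<Rightarrow> nat \<Rightarrow> real" where
  "lattice_weight L i = (let z = lattice_enum i in
     1 / (1 + (L * of_int (fst z))\<^sup>2) * (1 / (1 + (L * of_int (snd z))\<^sup>2)))"

lemma summable_lattice_weight:
  assumes L: "L > 0"
  shows "summable (lattice_weight L)"
proof -
  let ?g = "\<lambda>m::int. 1 / (1 + (L * of_int m)\<^sup>2)"
  have "(\<lambda>(m, k). ?g m * ?g k) summable_on (SIGMA m:UNIV. (UNIV :: int set))"
  proof (rule summable_on_SigmaI[where g = "\<lambda>m. ?g m * infsum ?g UNIV"])
    show "((\<lambda>k. case (m, k) of (m, k) \<Rightarrow> ?g m * ?g k) has_sum ?g m * infsum ?g UNIV) UNIV" for m
      unfolding prod.case
      by (intro has_sum_cmult_right has_sum_infsum summable_on_int_kernel L)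
    show "(\<lambda>m. ?g m * infsum ?g UNIV) summable_on UNIV"
      by (intro summable_on_cmult_left summable_on_int_kernel L)
  qed (simp add: add_nonneg_nonneg)
  then have "(\<lambda>z. ?g (fst z) * ?g (snd z)) summable_on UNIV" by (simp add: case_prod_beta')
  then have "(\<lambda>i. ?g (fst (lattice_enum i)) * ?g (snd (lattice_enum i))) summable_on UNIV"
    using summable_on_reindex_bij_betw[OF bij_lattice_enum, of "\<lambda>z. ?g (fst z) * ?g (snd z)"] by simp
  then show ?thesis
    unfolding lattice_weight_def Let_def by (rule summable_on_imp_summable)
qed

locale decaying =
  fixes V :: "real \<times> real \<Rightarrow> complex" and C L :: real
  assumes cont: "continuous_on UNIV V"
    and decay: "norm (V (t, u)) \<le> C / ((1 + t\<^sup>2) * (1 + u\<^sup>2))"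
    and L: "L > 0"
begin

lemma C_nonneg: "C \<ge> 0"
  using order_trans[OF norm_ge_zero decay[of 0 0]] by simp

lemma V_measurable [measurable]: "V \<in> borel_measurable borel"
  using cont by (rule borel_measurable_continuous_onI)

lemma integrable_V: "integrable lborel V"
proof (rule Bochner_Integration.integrable_bound)
  show "integrable lborel (\<lambda>x. C * (1 / ((1 + (fst x)\<^sup>2) * (1 + (snd x)\<^sup>2))))"
    by (intro integrable_mult_right integrable_cauchy_kernel2)
  show "AE x in lborel. norm (V x) \<le> norm (C * (1 / ((1 + (fst x)\<^sup>2) * (1 + (snd x)\<^sup>2))))"
    using decay C_nonneg by (intro AE_I2) (auto simp: split_paired_all add_nonneg_nonneg intro: order_trans[OF _ abs_ge_self])
qed (use V_measurable in simp)

abbreviation sh where "sh i \<equiv> lattice_shift L (lattice_enum i)"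

lemma shift_bound:
  "norm (V (y + sh i)) \<le> 4 * C * (1 + (fst y)\<^sup>2) * (1 + (snd y)\<^sup>2) * lattice_weight L i"
proof -
  obtain m k where z: "lattice_enum i = (m, k)" by fastforce
  let ?m = "L * of_int m" and ?k = "L * of_int k"
  have p: "1 + (a::real)\<^sup>2 > 0" for a by (simp add: add_pos_nonneg)
  have q: "1 / (1 + (t + a)\<^sup>2) \<le> 2 * (1 + t\<^sup>2) * (1 / (1 + a\<^sup>2))" for t a :: real
    using peetre_real[of a t] p[of a] p[of "t + a"] by (simp add: field_simps)
  have "norm (V (y + sh i)) \<le> C / ((1 + (fst y + ?m)\<^sup>2) * (1 + (snd y + ?k)\<^sup>2))"
    using decay[of "fst y + ?m" "snd y + ?k"] by (simp add: z lattice_shift_def plus_prod_def)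
  also have "\<dots> = C * (1 / (1 + (fst y + ?m)\<^sup>2) * (1 / (1 + (snd y + ?k)\<^sup>2)))" by simp
  also have "\<dots> \<le> C * ((2 * (1 + (fst y)\<^sup>2) * (1 / (1 + ?m\<^sup>2))) * (2 * (1 + (snd y)\<^sup>2) * (1 / (1 + ?k\<^sup>2))))"
    using p C_nonneg by (intro mult_left_mono mult_mono q) (auto simp: less_imp_le)
  also have "\<dots> = 4 * C * (1 + (fst y)\<^sup>2) * (1 + (snd y)\<^sup>2) * lattice_weight L i"
  proof -
    have "C * ((2 * a * b) * (2 * c * e)) = 4 * C * a * c * (b * e)" for a b c e by simp
    then show ?thesis by (simp only: lattice_weight_def z Let_def fst_conv snd_conv)
  qed
  finally show ?thesis .
qed

lemma summable_shift: "summable (\<lambda>i. norm (V (y + sh i)))"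
proof (rule summable_comparison_test)
  show "summable (\<lambda>i. 4 * C * (1 + (fst y)\<^sup>2) * (1 + (snd y)\<^sup>2) * lattice_weight L i)"
    by (intro summable_mult summable_lattice_weight L)
qed (use shift_bound[of y] in auto)

definition per :: "real \<times> real \<Rightarrow> complex" where
  "per y = (\<Sum>\<^sub>\<infinity>z. V (y + lattice_shift L z))"

lemma per_eq_suminf: "per y = (\<Sum>i. V (y + sh i))"
proof -
  have "per y = (\<Sum>\<^sub>\<infinity>i. V (y + sh i))"
    unfolding per_def by (rule infsum_reindex_bij_betw[OF bij_lattice_enum, symmetric])
  also have "\<dots> = (\<Sum>i. V (y + sh i))"
    by (intro infsumI norm_summable_imp_has_sum summable_shift summable_sums summable_norm_cancel[OF summable_shift])
  finally show ?thesis .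
qed

lemma per_shift: "per (y + lattice_shift L w) = per y"
proof -
  have "per (y + lattice_shift L w) = (\<Sum>\<^sub>\<infinity>z. V (y + lattice_shift L (w + z)))"
    by (simp add: per_def lattice_shift_def algebra_simps)
  also have "\<dots> = per y" unfolding per_def
    by (rule infsum_reindex_bij_betw[where g = "\<lambda>z. w + z" and f = "\<lambda>z. V (y + lattice_shift L z)"])
      (simp add: bij_plus)
  finally show ?thesis .
qed

lemma per_uniform_limit:
  "uniform_limit (cball 0 R) (\<lambda>n y. \<Sum>i<n. V (y + sh i)) per sequentially"
proof -
  have "uniform_limit (cball 0 R) (\<lambda>n y. \<Sum>i<n. V (y + sh i)) (\<lambda>y. \<Sum>i. V (y + sh i)) sequentially"
  proof (rule Weierstrass_m_test)
    show "summable (\<lambda>i. 4 * C * (1 + R\<^sup>2) * (1 + R\<^sup>2) * lattice_weight L i)"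
      by (intro summable_mult summable_lattice_weight L)
    fix i and y :: "real \<times> real" assume "y \<in> cball 0 R"
    then have y: "norm y \<le> R" by simp
    have R: "R \<ge> 0" using y norm_ge_zero[of y] by linarith
    have "\<bar>fst y\<bar> \<le> \<bar>R\<bar>" "\<bar>snd y\<bar> \<le> \<bar>R\<bar>"
      using abs_components_le_norm[of y] y R by auto
    then have f: "(fst y)\<^sup>2 \<le> R\<^sup>2" "(snd y)\<^sup>2 \<le> R\<^sup>2" by (simp_all only: abs_le_square_iff)
    have w: "lattice_weight L i \<ge> 0" by (simp add: lattice_weight_def Let_def add_nonneg_nonneg)
    have "4 * C * (1 + (fst y)\<^sup>2) * (1 + (snd y)\<^sup>2) * lattice_weight L i
        \<le> 4 * C * (1 + R\<^sup>2) * (1 + R\<^sup>2) * lattice_weight L i"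
      using f w C_nonneg by (intro mult_right_mono mult_mono) auto
    then show "norm (V (y + sh i)) \<le> 4 * C * (1 + R\<^sup>2) * (1 + R\<^sup>2) * lattice_weight L i"
      using shift_bound[of y i] by linarith
  qed
  then show ?thesis by (simp only: per_eq_suminf[abs_def])
qed

lemma V_shift_cont: "continuous_on S (\<lambda>y. V (y + s))"
  by (rule continuous_on_compose2[OF cont]) (auto intro!: continuous_intros)

lemma per_continuous: "continuous_on UNIV per"
proof -
  have c: "continuous_on (cball 0 R) per" for R
    by (rule uniform_limit_theorem[OF _ per_uniform_limit])
      (auto intro!: always_eventually continuous_on_sum V_shift_cont)
  have "isCont per y" for y
  proof -
    have "y \<in> interior (cball 0 (norm y + 1))" by (simp add: interior_cball)
    then show ?thesis using c continuous_on_interior by blast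
  qed
  then show ?thesis by (simp add: continuous_at_imp_continuous_on)
qed

end

lemma negligible_fst_eq: "negligible {y :: real \<times> real. fst y = c}"
  using negligible_standard_hyperplane[of "(1::real, 0::real)" c] by (simp add: Basis_prod_def inner_prod_def)

lemma negligible_snd_eq: "negligible {y :: real \<times> real. snd y = c}"
  using negligible_standard_hyperplane[of "(0::real, 1::real)" c] by (simp add: Basis_prod_def inner_prod_def)

text \<open>Half-open squares tile the plane without overlap, while the integration theorems concern
  closed boxes; the difference lies on two lines.\<close>

lemma set_integral_half_open_square:
  fixes F :: "real \<times> real \<Rightarrow> complex"
  assumes "continuous_on UNIV F"
  shows "(LINT y:({0..<L} \<times> {0..<L})|lborel. F y) = integral (cbox (0, 0) (L, L)) F"
proof -
  let ?H = "{0..<L} \<times> {0..<L}"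
  have c: "continuous_on (cbox (0, 0) (L, L)) F" using assms continuous_on_subset by blast
  have i: "set_integrable lborel (cbox (0, 0) (L, L)) F"
    unfolding set_integrable_def by (rule borel_integrable_compact[OF compact_cbox c])
  have sub: "?H \<subseteq> cbox (0, 0) (L, L)" by (auto simp: cbox_Pair_eq)
  have m: "?H \<in> sets lborel" by (simp add: borel_Times)
  have "set_integrable lborel ?H F" using set_integrable_subset[OF i m sub] .
  then have "(LINT y:?H|lborel. F y) = integral ?H F" by (rule set_borel_integral_eq_integral(2))
  also have "\<dots> = integral (cbox (0, 0) (L, L)) F"
  proof (rule integral_spike_set)
    have neg: "negligible ({y :: real \<times> real. fst y = L} \<union> {y. snd y = L})"
      by (intro negligible_Un negligible_fst_eq negligible_snd_eq)
    show "negligible {x \<in> ?H - cbox (0, 0) (L, L). F x \<noteq> 0}"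
      by (rule negligible_subset[OF neg]) (use sub in auto)
    show "negligible {x \<in> cbox (0, 0) (L, L) - ?H. F x \<noteq> 0}"
      by (rule negligible_subset[OF neg]) (auto simp: cbox_Pair_eq)
  qed
  finally show ?thesis .
qed

context decaying
begin

definition cell :: "nat \<Rightarrow> (real \<times> real) set" where
  "cell i = {y. y - sh i \<in> {0..<L} \<times> {0..<L}}"

lemma mem_cell_iff: "y \<in> cell i \<longleftrightarrow> lattice_enum i = (\<lfloor>fst y / L\<rfloor>, \<lfloor>snd y / L\<rfloor>)"
proof -
  have *: "0 \<le> a - L * of_int m \<and> a - L * of_int m < L \<longleftrightarrow> m = \<lfloor>a / L\<rfloor>" for a m
  proof -
    have "m = \<lfloor>a / L\<rfloor> \<longleftrightarrow> of_int m \<le> a / L \<and> a / L < of_int m + 1"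
      by (metis floor_eq_iff)
    also have "\<dots> \<longleftrightarrow> 0 \<le> a - L * of_int m \<and> a - L * of_int m < L"
      using L by (simp add: pos_le_divide_eq pos_divide_less_eq algebra_simps)
    finally show ?thesis by simp
  qed
  obtain m k where z: "lattice_enum i = (m, k)" by fastforce
  have "y \<in> cell i \<longleftrightarrow> m = \<lfloor>fst y / L\<rfloor> \<and> k = \<lfloor>snd y / L\<rfloor>"
    unfolding *[symmetric] by (auto simp: cell_def lattice_shift_def z mem_Times_iff)
  then show ?thesis by (simp add: z)
qed

lemma cell_disjoint: "i \<noteq> j \<Longrightarrow> cell i \<inter> cell j = {}"
  using bij_lattice_enum by (auto simp: mem_cell_iff bij_def inj_def)

lemma Union_cell: "(\<Union>i. cell i) = UNIV"
proof -
  have "\<exists>i. y \<in> cell i" for y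
    using bij_lattice_enum unfolding mem_cell_iff bij_def by (metis surjD)
  then show ?thesis by blast
qed

lemma cell_sets [measurable]: "cell i \<in> sets borel"
proof -
  have "cell i = (\<lambda>y. y - sh i) -` ({0..<L} \<times> {0..<L}) \<inter> space borel" by (auto simp: cell_def)
  also have "\<dots> \<in> sets borel"
    by (rule measurable_sets[of _ borel borel]) (auto simp: borel_Times)
  finally show ?thesis .
qed

text \<open>The plane is cut into cells and each cell is translated back to the base square, where
  the periodic factor \<open>E\<close> is unchanged. Uniform convergence on that square moves the
  sum inside the integral.\<close>

lemma integral_per_times:
  assumes E: "continuous_on UNIV E" "\<And>y. norm (E y) \<le> 1" "\<And>y z. E (y + lattice_shift L z) = E y"
  shows "integral (cbox (0, 0) (L, L)) (\<lambda>y. per y * E y) = (LINT y|lborel. V y * E y)"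
proof -
  let ?K = "cbox (0, 0) (L, L) :: (real \<times> real) set"
  define a where "a = (\<lambda>i. integral ?K (\<lambda>y. V (y + sh i) * E y))"
  have Em [measurable]: "E \<in> borel_measurable borel" using E(1) by (rule borel_measurable_continuous_onI)
  have iVE: "integrable lborel (\<lambda>y. V y * E y)"
  proof (rule Bochner_Integration.integrable_bound[OF integrable_V])
    show "AE x in lborel. norm (V x * E x) \<le> norm (V x)"
      using E(2) mult_left_mono[OF E(2) norm_ge_zero] by (intro AE_I2) (auto simp: norm_mult)
  qed measurable
  have "(LINT y|lborel. V y * E y) = (LINT y:(\<Union>i. cell i)|lborel. V y * E y)"
    by (simp add: Union_cell set_lebesgue_integral_def)
  also have "\<dots> = (\<Sum>i. (LINT y:cell i|lborel. V y * E y))"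
    by (rule lebesgue_integral_countable_add)
      (use cell_disjoint iVE cell_sets in \<open>auto simp: Union_cell set_integrable_def\<close>)
  also have "\<dots> = (\<Sum>i. a i)"
  proof (intro arg_cong[of _ _ suminf] ext)
    fix i
    let ?F = "\<lambda>y. indicator (cell i) y *\<^sub>R (V y * E y)"
    have "(LINT y:cell i|lborel. V y * E y) = (LINT y|distr lborel borel ((+) (sh i)). ?F y)"
      by (simp add: set_lebesgue_integral_def lborel_distr_plus)
    also have "\<dots> = (LINT y|lborel. ?F (sh i + y))"
      by (rule integral_distr) measurable
    also have "\<dots> = (LINT y:({0..<L} \<times> {0..<L})|lborel. V (y + sh i) * E y)"
      unfolding set_lebesgue_integral_def
      by (intro Bochner_Integration.integral_cong refl) (auto simp: cell_def indicator_def add.commute E(3))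
    also have "\<dots> = a i" unfolding a_def
      by (intro set_integral_half_open_square continuous_on_mult V_shift_cont E)
    finally show "(LINT y:cell i|lborel. V y * E y) = a i" .
  qed
  finally have A: "(LINT y|lborel. V y * E y) = (\<Sum>i. a i)" .
  have K: "?K \<subseteq> cball 0 (2 * L)"
  proof
    fix y assume "y \<in> ?K"
    then have "\<bar>fst y\<bar> \<le> L" "\<bar>snd y\<bar> \<le> L" by (auto simp: cbox_Pair_eq)
    moreover have "norm y \<le> \<bar>fst y\<bar> + \<bar>snd y\<bar>" using norm_Pair_le[of "fst y" "snd y"] by simp
    ultimately show "y \<in> cball 0 (2 * L)" by simp
  qed
  have u: "uniform_limit ?K (\<lambda>n y. (\<Sum>i<n. V (y + sh i)) * E y) (\<lambda>y. per y * E y) sequentially"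
  proof (rule uniform_lim_mult)
    show "uniform_limit ?K (\<lambda>n y. \<Sum>i<n. V (y + sh i)) per sequentially"
      using uniform_limit_on_subset[OF per_uniform_limit K] .
    show "bounded (per ` ?K)"
      by (intro compact_imp_bounded compact_continuous_image compact_cbox) (use per_continuous continuous_on_subset in blast)
    show "bounded (E ` ?K)" using E(2) unfolding bounded_iff by blast
  qed (rule uniform_limit_const)
  have Vc: "continuous_on ?K (\<lambda>y. V (y + sh i) * E y)" for i
    by (intro continuous_on_mult V_shift_cont) (use E(1) continuous_on_subset in blast)
  have c: "continuous_on ?K (\<lambda>y. (\<Sum>i<n. V (y + sh i)) * E y)" for n
    unfolding sum_distrib_right by (intro continuous_on_sum Vc)
  obtain I J where I: "\<And>n. ((\<lambda>y. (\<Sum>i<n. V (y + sh i)) * E y) has_integral I n) ?K"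
    and J: "((\<lambda>y. per y * E y) has_integral J) ?K" and IJ: "(I \<longlongrightarrow> J) sequentially"
    using uniform_limit_integral_cbox[OF u c] by auto
  have "I n = (\<Sum>i<n. a i)" for n
  proof -
    have "((\<lambda>y. \<Sum>i<n. V (y + sh i) * E y) has_integral (\<Sum>i<n. a i)) ?K"
      unfolding a_def by (intro has_integral_sum integrable_integral integrable_continuous Vc) auto
    then show ?thesis using I[of n] has_integral_unique by (auto simp: sum_distrib_right)
  qed
  then have "a sums J" using IJ unfolding sums_def by presburger
  then show ?thesis using A J by (simp add: sums_iff integral_unique)
qed

end

section \<open>Trigonometric polynomials on the torus and uniqueness of Fourier coefficients\<close>

definition torus_char :: "real \<Rightarrow> int \<Rightarrow> int \<Rightarrow> real \<times> real \<Rightarrow> complex" where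
  "torus_char L r s y = cis (2 * pi / L * (of_int r * fst y + of_int s * snd y))"

lemma torus_char_mult: "torus_char L r s y * torus_char L r' s' y = torus_char L (r + r') (s + s') y"
  by (simp add: torus_char_def cis_mult algebra_simps)

lemma torus_char_0 [simp]: "torus_char L 0 0 y = 1"
  by (simp add: torus_char_def)

lemma norm_torus_char [simp]: "norm (torus_char L r s y) = 1"
  by (simp add: torus_char_def)

lemma torus_char_continuous [continuous_intros]: "continuous_on A (torus_char L r s)"
  unfolding torus_char_def[abs_def] cis_conv_exp by (intro continuous_intros)

lemma cis_add_2pi_int: "cis (x + 2 * pi * of_int m) = cis x"
  by (simp add: cis_mult[symmetric])

lemma torus_char_shift:
  assumes "L > 0"
  shows "torus_char L r s (y + lattice_shift L z) = torus_char L r s y"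
proof -
  have "2 * pi / L * (of_int r * fst (y + lattice_shift L z) + of_int s * snd (y + lattice_shift L z))
     = 2 * pi / L * (of_int r * fst y + of_int s * snd y) + 2 * pi * of_int (r * fst z + s * snd z)"
    using assms by (simp add: lattice_shift_def field_simps)
  then show ?thesis by (simp only: torus_char_def cis_add_2pi_int)
qed

lemma integral_cis_period:
  assumes L: "L > 0"
  shows "integral {0..L} (\<lambda>x. cis (2 * pi / L * of_int r * x)) = (if r = 0 then of_real L else 0)"
proof (cases "r = 0")
  case False
  define k where "k = 2 * pi / L * of_int r"
  have k: "k \<noteq> 0" using False L by (simp add: k_def)
  have kL: "cis (k * L) = 1"
    using cis_add_2pi_int[of 0 r] L by (simp add: k_def)
  have "((\<lambda>x. cis (k * x)) has_integral cis (k * L) / (\<i> * k) - cis (k * 0) / (\<i> * k)) {0..L}"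
  proof (rule fundamental_theorem_of_calculus)
    show "((\<lambda>x. cis (k * x) / (\<i> * k)) has_vector_derivative cis (k * x)) (at x within {0..L})" for x
      unfolding cis_conv_exp using k
      by (auto intro!: derivative_eq_intros has_vector_derivative_real_field simp: field_simps)
  qed (use L in simp)
  then show ?thesis using False kL by (simp add: k_def integral_unique)
qed (use L in \<open>simp add: scaleR_conv_of_real\<close>)

lemma integral_torus_char:
  assumes L: "L > 0"
  shows "integral (cbox (0, 0) (L, L)) (torus_char L r s) = (if r = 0 \<and> s = 0 then of_real (L\<^sup>2) else 0)"
proof -
  have "integral (cbox (0, 0) (L, L)) (torus_char L r s)
      = integral (cbox 0 L) (\<lambda>x. integral (cbox 0 L) (\<lambda>y. torus_char L r s (x, y)))"
    by (intro integral_prod_continuous continuous_intros)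
  also have "\<dots> = integral {0..L} (\<lambda>x. cis (2 * pi / L * of_int r * x) * integral {0..L} (\<lambda>y. cis (2 * pi / L * of_int s * y)))"
    by (simp add: torus_char_def distrib_left mult.assoc flip: cis_mult)
  also have "\<dots> = (if r = 0 then of_real L else 0) * (if s = 0 then of_real L else 0)"
    unfolding integral_cis_period[OF L, of s] integral_mult_left integral_cis_period[OF L, of r] ..
  also have "\<dots> = (if r = 0 \<and> s = 0 then of_real (L\<^sup>2) else 0)" by (simp add: power2_eq_square)
  finally show ?thesis .
qed

inductive trig_poly :: "real \<Rightarrow> (real \<times> real \<Rightarrow> complex) \<Rightarrow> bool" for L where
  char: "trig_poly L (\<lambda>y. c * torus_char L r s y)"
| add: "trig_poly L P \<Longrightarrow> trig_poly L Q \<Longrightarrow> trig_poly L (\<lambda>y. P y + Q y)"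

lemma trig_poly_const: "trig_poly L (\<lambda>_. c)"
  using trig_poly.char[of L c 0 0] by simp

lemma trig_poly_torus_char: "trig_poly L (\<lambda>y. torus_char L r s y)"
  using trig_poly.char[of L 1 r s] by simp

lemma trig_poly_mult_char: "trig_poly L P \<Longrightarrow> trig_poly L (\<lambda>y. (c * torus_char L r s y) * P y)"
proof (induction rule: trig_poly.induct)
  case (char c' r' s')
  have "(\<lambda>y. c * torus_char L r s y * (c' * torus_char L r' s' y)) = (\<lambda>y. (c * c') * torus_char L (r + r') (s + s') y)"
    by (simp add: fun_eq_iff mult_ac flip: torus_char_mult)
  then show ?case using trig_poly.char by simp
next
  case (add P Q)
  then show ?case using trig_poly.add[of L "\<lambda>y. c * torus_char L r s y * P y"] by (simp add: distrib_left)
qed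

lemma trig_poly_mult: "trig_poly L Q \<Longrightarrow> trig_poly L P \<Longrightarrow> trig_poly L (\<lambda>y. Q y * P y)"
proof (induction rule: trig_poly.induct)
  case (add Q1 Q2)
  then show ?case using trig_poly.add[of L "\<lambda>y. Q1 y * P y"] by (simp add: distrib_right)
qed (rule trig_poly_mult_char)

lemma trig_poly_continuous: "trig_poly L P \<Longrightarrow> continuous_on A P"
  by (induction rule: trig_poly.induct) (intro continuous_intros)+

definition torus_proj :: "real \<Rightarrow> real \<times> real \<Rightarrow> complex \<times> complex" where
  "torus_proj L y = (cis (2 * pi / L * fst y), cis (2 * pi / L * snd y))"

lemma torus_proj_continuous: "continuous_on A (torus_proj L)"
  unfolding torus_proj_def[abs_def] cis_conv_exp by (intro continuous_intros)

text \<open>The real and imaginary parts of a point on the unit circle are combinations of the point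
  and its conjugate, that is, of two characters.\<close>

lemma trig_poly_real_polynomial:
  assumes "real_polynomial_function f"
  shows "trig_poly L (\<lambda>y. complex_of_real (f (torus_proj L y)))"
  using assms
proof (induction rule: real_polynomial_function.induct)
  case (linear f)
  interpret bounded_linear f by fact
  have f: "f w = Re (fst w) * f (1, 0) + Im (fst w) * f (\<i>, 0) + Re (snd w) * f (0, 1) + Im (snd w) * f (0, \<i>)" for w
  proof -
    have "w = Re (fst w) *\<^sub>R (1, 0) + Im (fst w) *\<^sub>R (\<i>, 0) + Re (snd w) *\<^sub>R (0, 1) + Im (snd w) *\<^sub>R (0, \<i>)"
      by (simp add: complex_eq_iff prod_eq_iff)
    then have "f w = f (Re (fst w) *\<^sub>R (1, 0) + Im (fst w) *\<^sub>R (\<i>, 0) + Re (snd w) *\<^sub>R (0, 1) + Im (snd w) *\<^sub>R (0, \<i>))"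
      by (rule arg_cong)
    then show ?thesis by (simp only: add scale real_scaleR_def)
  qed
  have re: "complex_of_real (Re z) = (1 / 2) * z + (1 / 2) * cnj z" for z by (simp add: complex_eq_iff)
  have im: "complex_of_real (Im z) = (1 / (2 * \<i>)) * z + (- 1 / (2 * \<i>)) * cnj z" for z
    by (simp add: complex_eq_iff)
  have pr: "fst (torus_proj L y) = torus_char L 1 0 y" "cnj (torus_char L 1 0 y) = torus_char L (-1) 0 y"
     "snd (torus_proj L y) = torus_char L 0 1 y" "cnj (torus_char L 0 1 y) = torus_char L 0 (-1) y" for y
    by (simp_all add: torus_char_def torus_proj_def cis_cnj)
  show ?case unfolding f[of "torus_proj L _"] of_real_add of_real_mult re im pr
    by (intro trig_poly.add trig_poly_mult trig_poly_const trig_poly_torus_char)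
qed (auto intro: trig_poly_const trig_poly.add trig_poly_mult)

text \<open>A periodic function descends to the product of two unit circles, a compact set on which
  the Stone-Weierstrass theorem for polynomials applies.\<close>

lemma trig_poly_approx:
  fixes h :: "real \<times> real \<Rightarrow> complex"
  assumes L: "L > 0" and h: "continuous_on UNIV h" "\<And>y z. h (y + lattice_shift L z) = h y" and e: "e > 0"
  shows "\<exists>P. trig_poly L P \<and> (\<forall>y. norm (h y - P y) < e)"
proof -
  let ?K = "cbox (0, 0) (L, L) :: (real \<times> real) set"
  let ?p = "torus_proj L"
  define S where "S = sphere (0::complex) 1 \<times> sphere (0::complex) 1"
  have ex: "\<exists>x\<in>{0..L}. cis (2 * pi / L * x) = z" if nz: "norm z = 1" for z
  proof -
    obtain t where t: "0 \<le> t" "t < 2 * pi" "z = Complex (cos t) (sin t)"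
      using complex_unimodular_polar[OF nz] by auto
    have "L * t / (2 * pi) \<le> L * (2 * pi) / (2 * pi)" using L t by (intro divide_right_mono mult_left_mono) auto
    then have "L * t / (2 * pi) \<in> {0..L}" using L t by auto
    moreover have "cis (2 * pi / L * (L * t / (2 * pi))) = z" using L t by (simp add: complex_eq_iff)
    ultimately show ?thesis by blast
  qed
  have onto: "\<exists>y\<in>?K. ?p y = w" if w: "w \<in> S" for w
  proof -
    obtain a b where ab: "a \<in> {0..L}" "cis (2 * pi / L * a) = fst w" "b \<in> {0..L}" "cis (2 * pi / L * b) = snd w"
      using ex[of "fst w"] ex[of "snd w"] w by (auto simp: S_def)
    then have "(a, b) \<in> ?K" by (simp add: cbox_Pair_eq)
    moreover have "?p (a, b) = w" using ab by (simp add: torus_proj_def)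
    ultimately show ?thesis by blast
  qed
  have inS: "?p y \<in> S" for y by (simp add: torus_proj_def S_def)
  have per: "\<exists>m::int. a = b + L * of_int m" if same: "cis (2 * pi / L * a) = cis (2 * pi / L * b)" for a b
  proof -
    have "sin (2 * pi / L * a) = sin (2 * pi / L * b) \<and> cos (2 * pi / L * a) = cos (2 * pi / L * b)"
      using arg_cong[OF same, of Re] arg_cong[OF same, of Im] by (simp only: cis.sel)
    then obtain m :: int where "2 * pi / L * a = 2 * pi / L * b + 2 * pi * of_int m"
      unfolding sin_cos_eq_iff by blast
    then have "2 * pi / L * a = 2 * pi / L * (b + L * of_int m)" using L by (simp add: field_simps)
    then have "a = b + L * of_int m" using L by simp
    then show ?thesis by blast
  qed
  have fib: "h y = h y'" if "?p y = ?p y'" for y y'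
  proof -
    have same: "cis (2 * pi / L * fst y) = cis (2 * pi / L * fst y')" "cis (2 * pi / L * snd y) = cis (2 * pi / L * snd y')"
      using that by (simp_all only: torus_proj_def prod.inject)
    obtain m :: int where m: "fst y = fst y' + L * of_int m" using per[OF same(1)] by blast
    obtain k :: int where "snd y = snd y' + L * of_int k" using per[OF same(2)] by blast
    with m have "y = y' + lattice_shift L (m, k)" by (simp add: lattice_shift_def prod_eq_iff)
    then show ?thesis using h(2) by simp
  qed
  define G where "G = (\<lambda>w. h (SOME y. y \<in> ?K \<and> ?p y = w))"
  have G: "G (?p y) = h y" for y
  proof -
    have "\<exists>y'. y' \<in> ?K \<and> ?p y' = ?p y" using onto[OF inS] by blast
    then have "?p (SOME y'. y' \<in> ?K \<and> ?p y' = ?p y) = ?p y" by (rule someI2_ex) simp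
    then show ?thesis unfolding G_def by (rule fib)
  qed
  have "compact S" unfolding S_def by (intro compact_Times compact_sphere)
  moreover have "continuous_on S G"
  \<comment> \<open>The projection maps a compact square onto \<open>S\<close>, so the preimage of a
    closed set under \<open>G\<close> is the image of a compact set. This replaces a continuous
    choice of angles, which does not exist on a circle.\<close>
  proof (subst continuous_on_closed_vimage)
    show "closed S" using \<open>compact S\<close> by (rule compact_imp_closed)
    show "\<forall>B. closed B \<longrightarrow> closed (G -` B \<inter> S)"
    proof (intro allI impI)
      fix B :: "complex set" assume B: "closed B"
      have "G -` B \<inter> S = ?p ` (h -` B \<inter> ?K)"
      proof (intro equalityI subsetI)
        fix w assume w: "w \<in> G -` B \<inter> S"
        then obtain y where y: "y \<in> ?K" "?p y = w" using onto[of w] by blast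
        then have "h y \<in> B" using G[of y] w by simp
        then show "w \<in> ?p ` (h -` B \<inter> ?K)" using y by blast
      next
        fix w assume "w \<in> ?p ` (h -` B \<inter> ?K)"
        then obtain y where "h y \<in> B" "w = ?p y" by blast
        then show "w \<in> G -` B \<inter> S" using G[of y] inS[of y] by simp
      qed
      moreover have "compact (?p ` (h -` B \<inter> ?K))"
      proof (intro compact_continuous_image torus_proj_continuous)
        have "closed (h -` B)" using h(1) B by (simp add: continuous_on_closed_vimage)
        then show "compact (h -` B \<inter> ?K)" by (intro closed_Int_compact compact_cbox)
      qed
      ultimately show "closed (G -` B \<inter> S)" by (simp add: compact_imp_closed)
    qed
  qed
  ultimately obtain g where g: "polynomial_function g" "\<And>w. w \<in> S \<Longrightarrow> norm (G w - g w) < e"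
    using Stone_Weierstrass_polynomial_function[of S G e] e by blast
  define P where "P = (\<lambda>y. complex_of_real (Re (g (?p y))) + \<i> * complex_of_real (Im (g (?p y))))"
  have re: "real_polynomial_function (\<lambda>w. Re (g w))" "real_polynomial_function (\<lambda>w. Im (g w))"
    using g(1) bounded_linear_Re bounded_linear_Im unfolding polynomial_function_def comp_def by blast+
  have "trig_poly L P" unfolding P_def
    by (intro trig_poly.add trig_poly_mult trig_poly_const trig_poly_real_polynomial[OF re(1)] trig_poly_real_polynomial[OF re(2)])
  moreover have "norm (h y - P y) < e" for y
  proof -
    have "P y = g (?p y)" unfolding P_def by (rule complex_eq[symmetric])
    then show ?thesis using g(2)[OF inS, of y] by (simp add: G)
  qed
  ultimately show ?thesis by blast
qed

text \<open>The integral of \<open>(norm h)^2\<close> equals that of \<open>h * (cnj h - P)\<close>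
  for every trigonometric polynomial \<open>P\<close>, and \<open>P\<close> may be taken uniformly
  close to \<open>cnj h\<close>.\<close>

lemma fourier_uniqueness:
  fixes h :: "real \<times> real \<Rightarrow> complex"
  assumes L: "L > 0" and h: "continuous_on UNIV h" "\<And>y z. h (y + lattice_shift L z) = h y"
    and z: "\<And>r s. integral (cbox (0, 0) (L, L)) (\<lambda>y. h y * torus_char L r s y) = 0"
  shows "h y = 0"
proof -
  let ?K = "cbox (0, 0) (L, L) :: (real \<times> real) set"
  have hc: "continuous_on A h" for A using h(1) continuous_on_subset by blast
  have P0: "integral ?K (\<lambda>y. h y * P y) = 0" if "trig_poly L P" for P
    using that
  proof (induction rule: trig_poly.induct)
    case (char c r s)
    have "integral ?K (\<lambda>y. h y * (c * torus_char L r s y)) = integral ?K (\<lambda>y. c * (h y * torus_char L r s y))"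
      by (simp add: mult_ac)
    then show ?case using z by simp
  next
    case (add P Q)
    have "integral ?K (\<lambda>y. h y * (P y + Q y)) = integral ?K (\<lambda>y. h y * P y) + integral ?K (\<lambda>y. h y * Q y)"
      unfolding distrib_left
      by (intro integral_add integrable_continuous continuous_on_mult hc trig_poly_continuous[OF add.hyps(1)]
          trig_poly_continuous[OF add.hyps(2)])
    then show ?case using add by simp
  qed
  have cont2: "continuous_on ?K (\<lambda>y. (norm (h y))\<^sup>2)" by (intro continuous_intros hc)
  define A where "A = integral ?K (\<lambda>y. norm (h y))"
  have A: "A \<ge> 0" unfolding A_def
    by (intro integral_nonneg integrable_continuous continuous_on_norm hc) auto
  define I where "I = integral ?K (\<lambda>y. (norm (h y))\<^sup>2)"
  have "I \<le> e * A" if e: "e > 0" for e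
  proof -
    have ch: "continuous_on UNIV (\<lambda>y. cnj (h y))" by (intro continuous_intros hc)
    obtain P where P: "trig_poly L P" "\<And>y. norm (cnj (h y) - P y) < e"
      using trig_poly_approx[OF L ch _ e] h(2) by auto
    have Pc: "continuous_on ?K P" using P(1) by (rule trig_poly_continuous)
    have "complex_of_real I = integral ?K (\<lambda>y. complex_of_real ((norm (h y))\<^sup>2))"
      unfolding I_def
      by (subst integral_linear[OF integrable_continuous[OF cont2] bounded_linear_of_real, symmetric])
        (simp add: comp_def)
    also have "\<dots> = integral ?K (\<lambda>y. h y * cnj (h y))" by (simp only: complex_norm_square)
    also have "\<dots> = integral ?K (\<lambda>y. h y * cnj (h y)) - integral ?K (\<lambda>y. h y * P y)" using P0[OF P(1)] by simp
    also have "\<dots> = integral ?K (\<lambda>y. h y * cnj (h y) - h y * P y)"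
      by (intro integral_diff[symmetric] integrable_continuous continuous_intros hc Pc)
    also have "\<dots> = integral ?K (\<lambda>y. h y * (cnj (h y) - P y))" by (simp add: algebra_simps)
    finally have eq: "complex_of_real I = integral ?K (\<lambda>y. h y * (cnj (h y) - P y))" .
    have "norm (complex_of_real I) \<le> integral ?K (\<lambda>y. e * norm (h y))" unfolding eq
    proof (rule integral_norm_bound_integral)
      show "norm (h y * (cnj (h y) - P y)) \<le> e * norm (h y)" for y
        using P(2)[of y] mult_left_mono[of "norm (cnj (h y) - P y)" e "norm (h y)"] by (simp add: norm_mult mult.commute)
    qed (intro integrable_continuous continuous_intros hc Pc)+
    then show ?thesis by (simp add: A_def)
  qed
  then have "I \<le> 0"
  proof -
    have "I \<le> 0 + e" if "e > 0" for e
    proof -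
      have "I \<le> e / (A + 1) * A" using \<open>\<And>e. e > 0 \<Longrightarrow> I \<le> e * A\<close>[of "e / (A + 1)"] that A by simp
      also have "\<dots> \<le> e" using that A by (simp add: field_simps)
      finally show ?thesis by simp
    qed
    then show ?thesis by (rule field_le_epsilon)
  qed
  moreover have "I \<ge> 0" unfolding I_def by (intro integral_nonneg integrable_continuous cont2) auto
  ultimately have I0: "((\<lambda>y. (norm (h y))\<^sup>2) has_integral 0) ?K"
    using integrable_integral[OF integrable_continuous[OF cont2]] by (simp add: I_def)
  have K0: "h y = 0" if "y \<in> ?K" for y
  proof -
    have "(norm (h y))\<^sup>2 = 0"
    proof (rule has_integral_0_cbox_imp_0[OF cont2 _ I0 _ that])
      show "box (0, 0) (L, L) \<noteq> {}"
        using L unfolding box_ne_empty by (auto simp: Basis_prod_def inner_Pair_0)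
    qed auto
    then show ?thesis by simp
  qed
  define w where "w = (- \<lfloor>fst y / L\<rfloor>, - \<lfloor>snd y / L\<rfloor>)"
  have fl: "0 \<le> a - L * of_int \<lfloor>a / L\<rfloor> \<and> a - L * of_int \<lfloor>a / L\<rfloor> \<le> L" for a
  proof -
    have "of_int \<lfloor>a / L\<rfloor> \<le> a / L" "a / L \<le> of_int \<lfloor>a / L\<rfloor> + 1" by linarith+
    then have "of_int \<lfloor>a / L\<rfloor> * L \<le> a" "a \<le> (of_int \<lfloor>a / L\<rfloor> + 1) * L"
      by (simp_all only: pos_le_divide_eq[OF L] pos_divide_le_eq[OF L])
    then show ?thesis by (auto simp only: algebra_simps)
  qed
  have "y + lattice_shift L w = (fst y - L * of_int \<lfloor>fst y / L\<rfloor>, snd y - L * of_int \<lfloor>snd y / L\<rfloor>)"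
    by (simp add: lattice_shift_def w_def prod_eq_iff)
  then have "y + lattice_shift L w \<in> ?K" using fl[of "fst y"] fl[of "snd y"] by (simp add: cbox_Pair_eq)
  then have "h (y + lattice_shift L w) = 0" by (rule K0)
  then show ?thesis by (simp only: h(2))
qed

lemma complex_of_real_abs_int: "complex_of_real \<bar>real_of_int r\<bar> = complex_of_int \<bar>r\<bar>"
  by (metis of_int_abs of_real_of_int_eq)

definition freq_set :: "nat \<Rightarrow> (int \<times> int) set" where
  "freq_set N = {(r, s). \<bar>r\<bar> + \<bar>s\<bar> \<le> int N}"

lemma freq_set_subset: "freq_set N \<subseteq> {- int N..int N} \<times> {- int N..int N}"
  by (auto simp: freq_set_def)

lemma finite_freq_set [simp]: "finite (freq_set N)"
  by (rule finite_subset[OF freq_set_subset]) simp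

lemma fourier2_torus_char:
  fixes V :: "real \<times> real \<Rightarrow> complex"
  assumes "N > 0"
  shows "fourier2 V (of_int r / real N) (of_int s / real N)
       = 1 / (4 * pi\<^sup>2) * (LINT y|lborel. V y * torus_char (2 * pi * real N) (- r) (- s) y)"
proof -
  have "exp (- \<i> * (complex_of_real (of_int r / real N) * complex_of_real (fst y) + complex_of_real (of_int s / real N) * complex_of_real (snd y)))
      = torus_char (2 * pi * real N) (- r) (- s) y" for y
  proof -
    have "2 * pi / (2 * pi * real N) * (of_int (- r) * fst y + of_int (- s) * snd y)
        = - (of_int r / real N * fst y + of_int s / real N * snd y)"
      using assms by (simp add: field_simps)
    then show ?thesis unfolding torus_char_def cis_conv_exp
      by (simp only:) (rule arg_cong[of _ _ exp], simp add: algebra_simps)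
  qed
  then show ?thesis by (simp add: fourier2_def case_prod_beta)
qed

text \<open>Both sides are continuous, periodic and have the same Fourier coefficients. The support
  condition makes the candidate a finite sum, so no convergence of Fourier series is
  involved.\<close>

lemma poisson_summation2:
  fixes V :: "real \<times> real \<Rightarrow> complex"
  assumes V: "schwartz2 V" and supp: "\<And>\<eta> \<xi>. \<bar>\<eta>\<bar> + \<bar>\<xi>\<bar> > 1 \<Longrightarrow> fourier2 V \<eta> \<xi> = 0"
    and N: "N > 0"
  shows "vper V N t u = 1 / (real N)\<^sup>2 *
    (\<Sum>(r, s)\<in>freq_set N. fourier2 V (of_int r / real N) (of_int s / real N) * cis (of_int r * t + of_int s * u))"
proof -
  define L where "L = 2 * pi * real N"
  have L: "L > 0" using N by (simp add: L_def)
  obtain C where C: "\<And>t u. norm (V (t, u)) \<le> C / ((1 + t\<^sup>2) * (1 + u\<^sup>2))" using schwartz2_decay[OF V] by blast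
  interpret decaying V C L by unfold_locales (use schwartz2_continuous[OF V] C L in auto)
  define F where "F = (\<lambda>z. fourier2 V (of_int (fst z) / real N) (of_int (snd z) / real N))"
  have F: "F (r, s) = 1 / (4 * pi\<^sup>2) * (LINT y|lborel. V y * torus_char L (- r) (- s) y)" for r s
    unfolding F_def L_def fst_conv snd_conv by (rule fourier2_torus_char[OF N])
  have F0: "F z = 0" if "z \<notin> freq_set N" for z
  proof -
    have "real_of_int \<bar>fst z\<bar> + real_of_int \<bar>snd z\<bar> > real N"
      using that by (auto simp: freq_set_def split: prod.splits)
    then have "\<bar>of_int (fst z) / real N\<bar> + \<bar>of_int (snd z) / real N\<bar> > 1"
      using N by (simp add: add_divide_distrib[symmetric])
    then show ?thesis unfolding F_def by (rule supp)
  qed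
  define P where "P = (\<lambda>y. \<Sum>z\<in>freq_set N. (F z / (real N)\<^sup>2) * torus_char L (fst z) (snd z) y)"
  let ?K = "cbox (0, 0) (L, L) :: (real \<times> real) set"
  have Pc: "continuous_on A P" for A unfolding P_def by (intro continuous_intros)
  have "per y - P y = 0" for y
  proof (rule fourier_uniqueness[OF L])
    show "continuous_on UNIV (\<lambda>y. per y - P y)" by (intro continuous_intros per_continuous Pc)
    show "per (y + lattice_shift L z) - P (y + lattice_shift L z) = per y - P y" for y z
      unfolding per_shift P_def torus_char_shift[OF L] ..
    fix r s
    have "integral ?K (\<lambda>y. (per y - P y) * torus_char L r s y)
        = integral ?K (\<lambda>y. per y * torus_char L r s y) - integral ?K (\<lambda>y. P y * torus_char L r s y)"
      unfolding left_diff_distrib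
      by (intro integral_diff integrable_continuous continuous_intros Pc continuous_on_subset[OF per_continuous]) auto
    also have "integral ?K (\<lambda>y. per y * torus_char L r s y) = 4 * pi\<^sup>2 * F (- r, - s)"
    proof -
      have "integral ?K (\<lambda>y. per y * torus_char L r s y) = (LINT y|lborel. V y * torus_char L r s y)"
        by (rule integral_per_times) (auto intro: torus_char_continuous torus_char_shift[OF L])
      then show ?thesis by (simp add: F)
    qed
    also have "integral ?K (\<lambda>y. P y * torus_char L r s y)
        = (\<Sum>z\<in>freq_set N. (F z / (real N)\<^sup>2) * integral ?K (torus_char L (fst z + r) (snd z + s)))"
    proof -
      have "(\<lambda>y. P y * torus_char L r s y) = (\<lambda>y. \<Sum>z\<in>freq_set N. (F z / (real N)\<^sup>2) * torus_char L (fst z + r) (snd z + s) y)"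
        by (simp add: P_def sum_distrib_right mult.assoc torus_char_mult)
      moreover have "((\<lambda>y. \<Sum>z\<in>freq_set N. (F z / (real N)\<^sup>2) * torus_char L (fst z + r) (snd z + s) y) has_integral
          (\<Sum>z\<in>freq_set N. (F z / (real N)\<^sup>2) * integral ?K (torus_char L (fst z + r) (snd z + s)))) ?K"
        by (intro has_integral_sum has_integral_mult_right integrable_integral integrable_continuous torus_char_continuous) simp
      ultimately show ?thesis by (simp only: integral_unique)
    qed
    also have "\<dots> = (\<Sum>z\<in>freq_set N. if z = (- r, - s) then F z / (real N)\<^sup>2 * of_real (L\<^sup>2) else 0)"
      unfolding integral_torus_char[OF L] by (intro sum.cong) (auto simp: prod_eq_iff add_eq_0_iff2)
    \<comment> \<open>Only the opposite frequency survives, and \<open>L^2 / N^2 = 4 * pi^2\<close>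
      matches the integral of \<open>per\<close>. Outside \<open>freq_set N\<close> both sides are 0
      by the support condition.\<close>
    also have "\<dots> = 4 * pi\<^sup>2 * F (- r, - s)"
      using F0[of "(- r, - s)"] N by (auto simp: sum.delta' L_def power_mult_distrib)
    finally show "integral ?K (\<lambda>y. (per y - P y) * torus_char L r s y) = 0" by simp
  qed
  then have perP: "per y = P y" for y by simp
  have "vper V N t u = per (real N * t, real N * u)"
    unfolding vper_def per_def lattice_shift_def
    by (intro infsum_cong) (auto simp: L_def algebra_simps)
  also have "\<dots> = (\<Sum>z\<in>freq_set N. (F z / (real N)\<^sup>2) * cis (of_int (fst z) * t + of_int (snd z) * u))"
  proof -
    have "2 * pi / L * (of_int (fst z) * (real N * t) + of_int (snd z) * (real N * u)) = of_int (fst z) * t + of_int (snd z) * u"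
      for z :: "int \<times> int" using N by (simp add: L_def field_simps)
    then show ?thesis unfolding perP P_def torus_char_def fst_conv snd_conv by (simp only:)
  qed
  finally show ?thesis by (simp add: F_def case_prod_beta sum_distrib_left)
qed

section \<open>The Fejer kernel at scale 1/N and its limit\<close>

definition fejer :: "nat \<Rightarrow> real \<Rightarrow> real" where
  "fejer N x = (norm (\<Sum>j<N. cis (real j * x / real N)))\<^sup>2 / (real N)\<^sup>2"

text \<open>The classical kernel is evaluated at \<open>x / N\<close> and divided by its maximal
  value \<open>N\<close>, which gives bounds independent of \<open>N\<close>, as dominated
  convergence needs.\<close>

lemma fejer_bounds: "0 \<le> fejer N x" "fejer N x \<le> 1"
proof -
  have "norm (\<Sum>j<N. cis (real j * x / real N)) \<le> (\<Sum>j<N. 1)" by (rule sum_norm_le) simp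
  then have "(norm (\<Sum>j<N. cis (real j * x / real N)))\<^sup>2 \<le> (real N)\<^sup>2" by (intro power_mono) auto
  then show "fejer N x \<le> 1" unfolding fejer_def by (cases "N = 0") simp_all
qed (simp add: fejer_def)

text \<open>The difference \<open>r\<close> occurs \<open>N - |r|\<close> times in a square of side
  \<open>N\<close>. Passing to side \<open>N + 1\<close> adds a row, a column and a corner, in which
  each difference of absolute value at most \<open>N\<close> occurs exactly once.\<close>

lemma sum_difference_kernel:
  fixes g :: "int \<Rightarrow> complex"
  shows "(\<Sum>j<N. \<Sum>k<N. g (int j - int k)) = (\<Sum>r\<in>{- int N..int N}. (of_nat N - of_int \<bar>r\<bar>) * g r)"
proof (induction N)
  case (Suc N)
  \<comment> \<open>The two new endpoints carry weight 0, so the range of summation stays the old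
    one.\<close>
  have "{- int (Suc N)..int (Suc N)} = insert (int N + 1) (insert (- int N - 1) {- int N..int N})" by auto
  then have "(\<Sum>r\<in>{- int (Suc N)..int (Suc N)}. (of_nat (Suc N) - of_int \<bar>r\<bar>) * g r)
      = (\<Sum>r\<in>{- int N..int N}. (of_nat (Suc N) - of_int \<bar>r\<bar>) * g r)"
    by simp
  also have "\<dots> = (\<Sum>r\<in>{- int N..int N}. (of_nat N - of_int \<bar>r\<bar>) * g r) + (\<Sum>r\<in>{- int N..int N}. g r)"
    by (simp add: algebra_simps sum.distrib sum_subtractf)
  also have "(\<Sum>r\<in>{- int N..int N}. g r) = (\<Sum>k<N. g (int N - int k)) + (\<Sum>j<N. g (int j - int N)) + g 0"
  proof -
    have "{- int N..int N} = (\<lambda>k. int N - int k) ` {..<N} \<union> ((\<lambda>j. int j - int N) ` {..<N} \<union> {0})"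
    proof (intro equalityI subsetI)
      fix r assume r: "r \<in> {- int N..int N}"
      consider "r > 0" | "r < 0" | "r = 0" by linarith
      then show "r \<in> (\<lambda>k. int N - int k) ` {..<N} \<union> ((\<lambda>j. int j - int N) ` {..<N} \<union> {0})"
      proof cases
        case 1
        then have "r = int N - int (nat (int N - r))" "nat (int N - r) < N" using r by auto
        then show ?thesis by blast
      next
        case 2
        then have "r = int (nat (int N + r)) - int N" "nat (int N + r) < N" using r by auto
        then show ?thesis by blast
      qed auto
    qed auto
    moreover have "(\<Sum>r\<in>(\<lambda>k. int N - int k) ` {..<N} \<union> ((\<lambda>j. int j - int N) ` {..<N} \<union> {0}). g r)
        = (\<Sum>r\<in>(\<lambda>k. int N - int k) ` {..<N}. g r) + ((\<Sum>r\<in>(\<lambda>j. int j - int N) ` {..<N}. g r) + (\<Sum>r\<in>{0}. g r))"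
      by (subst sum.union_disjoint, simp, simp, fastforce) (subst sum.union_disjoint, simp, simp, fastforce, rule refl)
    moreover have "(\<Sum>r\<in>(\<lambda>k. int N - int k) ` {..<N}. g r) = (\<Sum>k<N. g (int N - int k))"
      by (subst sum.reindex) (auto intro: inj_onI)
    moreover have "(\<Sum>r\<in>(\<lambda>j. int j - int N) ` {..<N}. g r) = (\<Sum>j<N. g (int j - int N))"
      by (subst sum.reindex) (auto intro: inj_onI)
    ultimately show ?thesis by simp
  qed
  finally show ?case using Suc.IH by (simp add: sum.distrib algebra_simps)
qed simp

lemma fejer_expand:
  "of_real ((real N)\<^sup>2 * fejer N x) = (\<Sum>r\<in>{- int N..int N}. (of_nat N - of_int \<bar>r\<bar>) * cis (- of_int r * x / real N))"
proof (cases "N = 0")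
  case False
  let ?S = "\<Sum>j<N. cis (real j * x / real N)"
  have "of_real ((real N)\<^sup>2 * fejer N x) = of_real ((norm ?S)\<^sup>2)" using False by (simp add: fejer_def)
  also have "\<dots> = cnj ?S * ?S" by (metis complex_norm_square mult.commute)
  also have "\<dots> = (\<Sum>j<N. \<Sum>k<N. cis (- of_int (int j - int k) * x / real N))"
    unfolding cnj_sum sum_product
    by (intro sum.cong refl) (simp add: cis_cnj cis_mult diff_divide_distrib left_diff_distrib)
  also have "\<dots> = (\<Sum>r\<in>{- int N..int N}. (of_nat N - of_int \<bar>r\<bar>) * cis (- of_int r * x / real N))"
    by (rule sum_difference_kernel)
  finally show ?thesis .
qed (simp add: fejer_def)

text \<open>Summing the geometric series leaves \<open>sin (x / 2)\<close> divided by
  \<open>N * sin (x / (2 * N))\<close>, squared, and that denominator tends to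
  \<open>x / 2\<close>.\<close>

lemma fejer_limit:
  assumes x: "x \<noteq> 0"
  shows "(\<lambda>N. fejer N x) \<longlonglongrightarrow> (sin (x / 2) / (x / 2))\<^sup>2"
proof -
  have n1: "(norm (cis t - 1))\<^sup>2 = 4 * (sin (t / 2))\<^sup>2" for t
  proof -
    have "(norm (cis t - 1))\<^sup>2 = (cos t - 1)\<^sup>2 + (sin t)\<^sup>2" by (simp add: cmod_power2)
    also have "\<dots> = 2 - 2 * cos t" using sin_cos_squared_add[of t] by (simp add: power2_diff)
    also have "\<dots> = 4 * (sin (t / 2))\<^sup>2" using cos_double_sin[of "t / 2"] by simp
    finally show ?thesis .
  qed
  have "((\<lambda>h. (sin (0 + h) - sin 0) / h) \<longlongrightarrow> cos (0::real)) (at 0)"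
    using DERIV_sin[of 0] unfolding DERIV_def .
  then have s0: "((\<lambda>h::real. sin h / h) \<longlongrightarrow> 1) (at 0)" by simp
  define h where "h = (\<lambda>N. x / 2 / real N)"
  have h0: "h \<longlonglongrightarrow> 0" unfolding h_def by (rule lim_const_over_n)
  have "filterlim h (at 0) sequentially"
    unfolding filterlim_at using h0 x by (auto simp: h_def intro: eventually_sequentiallyI[of 1])
  then have lim: "(\<lambda>N. sin (h N) / h N) \<longlonglongrightarrow> 1" by (rule filterlim_compose[OF s0])
  have "(\<lambda>N. (sin (x / 2) / (x / 2))\<^sup>2 / (sin (h N) / h N)\<^sup>2) \<longlonglongrightarrow> (sin (x / 2) / (x / 2))\<^sup>2 / 1\<^sup>2"
    by (intro tendsto_intros lim) simp
  moreover have "eventually (\<lambda>N. sin (h N) / h N > 0) sequentially"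
    using order_tendstoD(1)[OF lim, of 0] by simp
  then have "eventually (\<lambda>N. (sin (x / 2) / (x / 2))\<^sup>2 / (sin (h N) / h N)\<^sup>2 = fejer N x) sequentially"
    using eventually_gt_at_top[of 0]
  proof eventually_elim
    case (elim N)
    let ?z = "cis (x / real N)"
    have sn: "sin (h N) \<noteq> 0" using elim by auto
    have "4 * (sin (h N))\<^sup>2 = (norm (?z - 1))\<^sup>2" using n1[of "x / real N"] by (simp add: h_def mult.commute)
    then have z1: "?z \<noteq> 1" using sn by auto
    have "(\<Sum>j<N. cis (real j * x / real N)) = (\<Sum>j<N. ?z ^ j)"
    proof (intro sum.cong refl)
      fix j
      show "cis (real j * x / real N) = ?z ^ j" using Complex.DeMoivre[of "x / real N" j] by simp
    qed
    also have "\<dots> = (?z ^ N - 1) / (?z - 1)" by (rule geometric_sum[OF z1])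
    also have "?z ^ N = cis x" unfolding Complex.DeMoivre using elim by simp
    finally have "(norm (\<Sum>j<N. cis (real j * x / real N)))\<^sup>2 = (norm (cis x - 1))\<^sup>2 / (norm (?z - 1))\<^sup>2"
      by (simp add: norm_divide power_divide)
    also have "\<dots> = (sin (x / 2))\<^sup>2 / (sin (h N))\<^sup>2"
      using n1[of x] \<open>4 * (sin (h N))\<^sup>2 = (norm (?z - 1))\<^sup>2\<close>[symmetric] by simp
    finally have "fejer N x = (sin (x / 2))\<^sup>2 / (sin (h N))\<^sup>2 / (real N)\<^sup>2" by (simp add: fejer_def)
    also have "\<dots> = (sin (x / 2) / (x / 2))\<^sup>2 / (sin (h N) / h N)\<^sup>2"
      using x elim sn by (simp add: h_def power_divide field_simps)
    finally show ?case by simp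
  qed
  ultimately show ?thesis by (simp add: tendsto_cong)
qed

text \<open>On the diagonal the sine quotient of the limit is \<open>0 / 0 = 0\<close> instead of 1, so the convergence
  below holds only almost everywhere.\<close>

lemma AE_fst_neq_snd: "AE y in lborel. fst y \<noteq> (snd y :: real)"
proof -
  let ?S = "{y :: real \<times> real. fst y = snd y}"
  have "?S = {y. (1, -1) \<bullet> y = 0}" by (auto simp: inner_prod_def)
  then have "negligible ?S" using negligible_hyperplane[of "(1::real, -1::real)" 0]
    by (simp add: prod_eq_iff)
  then have "?S \<in> null_sets lebesgue" by (simp add: negligible_iff_null_sets)
  moreover have "closed ?S" by (intro closed_Collect_eq continuous_intros)
  ultimately have "?S \<in> null_sets lborel" by (simp add: null_sets_completion_iff borel_closed)
  then show ?thesis by (rule AE_I') auto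
qed

lemma fejer_measurable [measurable]: "(\<lambda>y :: real \<times> real. fejer N (fst y - snd y)) \<in> borel_measurable borel"
proof (cases "N = 0")
  case False
  then show ?thesis unfolding fejer_def cis_conv_exp
    by (intro borel_measurable_continuous_onI continuous_intros) auto
qed (simp add: fejer_def)

lemma fejer_integral_limit:
  fixes V :: "real \<times> real \<Rightarrow> complex"
  assumes V: "schwartz2 V"
  shows "(\<lambda>N. LINT y|lborel. V y * of_real (1 - fejer N (fst y - snd y))) \<longlonglongrightarrow>
     (LINT y|lborel. V y * complex_of_real (1 - (sin ((fst y - snd y) / 2) / ((fst y - snd y) / 2))\<^sup>2))"
proof (rule integral_dominated_convergence[where w = "\<lambda>y. norm (V y)"])
  obtain C where C: "\<And>t u. norm (V (t, u)) \<le> C / ((1 + t\<^sup>2) * (1 + u\<^sup>2))" using schwartz2_decay[OF V] by blast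
  interpret decaying V C 1 by unfold_locales (use schwartz2_continuous[OF V] C in auto)
  show "integrable lborel (\<lambda>y. norm (V y))" using integrable_V by simp
  show "(\<lambda>y. V y * of_real (1 - fejer N (fst y - snd y))) \<in> borel_measurable lborel" for N by measurable
  have d: "(\<lambda>y :: real \<times> real. fst y - snd y) \<in> borel_measurable borel"
    by (intro borel_measurable_continuous_onI continuous_intros)
  have "(\<lambda>x. complex_of_real (1 - (sin (x / 2) / (x / 2))\<^sup>2)) \<in> borel_measurable borel" by measurable
  from measurable_compose[OF d this]
  show "(\<lambda>y. V y * complex_of_real (1 - (sin ((fst y - snd y) / 2) / ((fst y - snd y) / 2))\<^sup>2)) \<in> borel_measurable lborel"
    using V_measurable by (simp add: borel_measurable_times)
  show "AE y in lborel. (\<lambda>N. V y * of_real (1 - fejer N (fst y - snd y))) \<longlonglongrightarrow>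
      V y * complex_of_real (1 - (sin ((fst y - snd y) / 2) / ((fst y - snd y) / 2))\<^sup>2)"
    using AE_fst_neq_snd
  proof eventually_elim
    case (elim y)
    then show ?case by (intro tendsto_intros fejer_limit) simp
  qed
  show "AE y in lborel. norm (V y * of_real (1 - fejer N (fst y - snd y))) \<le> norm (V y)" for N
  proof (rule AE_I2)
    fix y
    have "norm (complex_of_real (1 - fejer N (fst y - snd y))) \<le> 1"
      unfolding norm_of_real using fejer_bounds[of N "fst y - snd y"] by simp
    from mult_left_mono[OF this norm_ge_zero[of "V y"]]
    show "norm (V y * of_real (1 - fejer N (fst y - snd y))) \<le> norm (V y)" by (simp only: norm_mult mult_1_right)
  qed
qed

text \<open>The modes of the kernel depend on \<open>fst y - snd y\<close> only, so integrating them
  against \<open>V\<close> samples the transform at pairs of opposite frequencies.\<close>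

lemma fejer_integral_fourier:
  fixes V :: "real \<times> real \<Rightarrow> complex"
  assumes V: "schwartz2 V" and N: "N > 0"
  shows "1 / (4 * pi\<^sup>2) * (LINT y|lborel. V y * of_real (1 - fejer N (fst y - snd y)))
     = fourier2 V 0 0 - 1 / (real N)\<^sup>2 * (\<Sum>r\<in>{- int N..int N}. (of_nat N - of_int \<bar>r\<bar>) * fourier2 V (of_int r / real N) (of_int (- r) / real N))"
proof -
  obtain C where C: "\<And>t u. norm (V (t, u)) \<le> C / ((1 + t\<^sup>2) * (1 + u\<^sup>2))" using schwartz2_decay[OF V] by blast
  interpret decaying V C 1 by unfold_locales (use schwartz2_continuous[OF V] C in auto)
  let ?e = "\<lambda>r. torus_char (2 * pi * real N) (- r) (- (- r))"
  have iVe: "integrable lborel (\<lambda>y. V y * torus_char L r s y)" for L r s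
  proof (rule Bochner_Integration.integrable_bound[OF integrable_V])
    have [measurable]: "torus_char L r s \<in> borel_measurable borel"
      by (rule borel_measurable_continuous_onI) (rule torus_char_continuous)
    show "(\<lambda>y. V y * torus_char L r s y) \<in> borel_measurable lborel" by measurable
  qed (simp add: norm_mult)
  have e: "cis (- of_int r * (fst y - snd y) / real N) = ?e r y" for r y
  proof -
    have "2 * pi / (2 * pi * real N) * (of_int (- r) * fst y + of_int (- (- r)) * snd y)
        = - of_int r * (fst y - snd y) / real N"
      using N by (simp add: field_simps)
    then show ?thesis unfolding torus_char_def by (simp only:)
  qed
  have "(LINT y|lborel. V y * of_real (1 - fejer N (fst y - snd y)))
      = (LINT y|lborel. V y - (\<Sum>r\<in>{- int N..int N}. ((of_nat N - of_int \<bar>r\<bar>) / (real N)\<^sup>2) * (V y * ?e r y)))"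
  proof (intro Bochner_Integration.integral_cong refl)
    fix y
    have "complex_of_real (fejer N (fst y - snd y)) = complex_of_real ((real N)\<^sup>2 * fejer N (fst y - snd y)) / complex_of_real ((real N)\<^sup>2)"
      using N by simp
    also have "\<dots> = (\<Sum>r\<in>{- int N..int N}. (of_nat N - of_int \<bar>r\<bar>) * ?e r y) / (real N)\<^sup>2"
      unfolding fejer_expand e ..
    finally have f: "complex_of_real (fejer N (fst y - snd y)) = (\<Sum>r\<in>{- int N..int N}. (of_nat N - of_int \<bar>r\<bar>) * ?e r y) / (real N)\<^sup>2" .
    have "V y * of_real (1 - fejer N (fst y - snd y)) = V y - V y * of_real (fejer N (fst y - snd y))"
      by (simp add: right_diff_distrib)
    then show "V y * of_real (1 - fejer N (fst y - snd y))
        = V y - (\<Sum>r\<in>{- int N..int N}. ((of_nat N - of_int \<bar>r\<bar>) / (real N)\<^sup>2) * (V y * ?e r y))"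
      unfolding f sum_divide_distrib sum_distrib_left by (simp add: mult_ac complex_of_real_abs_int)
  qed
  also have "\<dots> = (LINT y|lborel. V y) - (\<Sum>r\<in>{- int N..int N}. ((of_nat N - of_int \<bar>r\<bar>) / (real N)\<^sup>2) * (LINT y|lborel. V y * ?e r y))"
    using integrable_V iVe by simp
  finally have int: "(LINT y|lborel. V y * of_real (1 - fejer N (fst y - snd y)))
     = (LINT y|lborel. V y) - (\<Sum>r\<in>{- int N..int N}. ((of_nat N - of_int \<bar>r\<bar>) / (real N)\<^sup>2) * (LINT y|lborel. V y * ?e r y))" .
  have i0: "(LINT y|lborel. V y) = 4 * pi\<^sup>2 * fourier2 V 0 0" by (simp add: fourier2_def)
  have ie: "(LINT y|lborel. V y * ?e r y) = 4 * pi\<^sup>2 * fourier2 V (of_int r / real N) (of_int (- r) / real N)" for r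
    unfolding fourier2_torus_char[OF N] by simp
  have "(LINT y|lborel. V y * of_real (1 - fejer N (fst y - snd y)))
     = 4 * pi\<^sup>2 * (fourier2 V 0 0 - 1 / (real N)\<^sup>2 * (\<Sum>r\<in>{- int N..int N}. (of_nat N - of_int \<bar>r\<bar>) * fourier2 V (of_int r / real N) (of_int (- r) / real N)))"
    unfolding int i0 ie by (simp add: right_diff_distrib sum_distrib_left mult_ac complex_of_real_abs_int)
  then show ?thesis by simp
qed

lemma fourier2_bound:
  fixes V :: "real \<times> real \<Rightarrow> complex"
  shows "norm (fourier2 V \<eta> \<xi>) \<le> (LINT y|lborel. norm (V y))"
proof -
  define G where "G = (\<lambda>y. V y * exp (- \<i> * (complex_of_real \<eta> * complex_of_real (fst y) + complex_of_real \<xi> * complex_of_real (snd y))))"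
  have nG: "norm (G y) = norm (V y)" for y by (simp add: G_def norm_mult)
  have "norm (fourier2 V \<eta> \<xi>) = 1 / (4 * pi\<^sup>2) * norm (LINT y|lborel. G y)"
    by (simp add: fourier2_def G_def norm_mult norm_divide norm_power case_prod_beta)
  also have "\<dots> \<le> 1 * norm (LINT y|lborel. G y)"
  proof (rule mult_right_mono)
    have "1 \<le> pi\<^sup>2" using pi_ge_two by (intro one_le_power) simp
    then show "1 / (4 * pi\<^sup>2) \<le> 1" by simp
  qed simp
  also have "\<dots> \<le> (LINT y|lborel. norm (G y))" using integral_norm_bound[of lborel G] by simp
  finally show ?thesis by (simp only: nG)
qed

section \<open>The pair correlation average\<close>

lemma geometric_int_sum_le:
  fixes x :: real
  assumes x: "0 \<le> x" "x < 1" and S: "finite S"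
  shows "(\<Sum>k\<in>S. x ^ nat \<bar>k\<bar>) \<le> 2 / (1 - x)"
proof -
  obtain m where m: "\<And>k. k \<in> S \<Longrightarrow> nat \<bar>k\<bar> < m"
  proof
    show "nat \<bar>k\<bar> < Suc (Max ((\<lambda>k. nat \<bar>k\<bar>) ` S))" if "k \<in> S" for k
      using S that by (intro le_imp_less_Suc Max_ge) auto
  qed
  have g: "(\<Sum>n<m. x ^ n) \<le> 1 / (1 - x)"
  proof -
    have "(\<Sum>n<m. x ^ n) \<le> (\<Sum>n. x ^ n)"
      using x by (intro sum_le_suminf summable_geometric) auto
    then show ?thesis using x by (simp add: suminf_geometric)
  qed
  have "S \<subseteq> int ` {..<m} \<union> (\<lambda>n. - int n) ` {..<m}"
  proof
    fix k assume k: "k \<in> S"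
    have "k = int (nat \<bar>k\<bar>) \<or> k = - int (nat \<bar>k\<bar>)" by auto
    then show "k \<in> int ` {..<m} \<union> (\<lambda>n. - int n) ` {..<m}" using m[OF k] by blast
  qed
  then have "(\<Sum>k\<in>S. x ^ nat \<bar>k\<bar>) \<le> (\<Sum>k\<in>int ` {..<m} \<union> (\<lambda>n. - int n) ` {..<m}. x ^ nat \<bar>k\<bar>)"
    using x by (intro sum_mono2) auto
  also have "\<dots> \<le> (\<Sum>k\<in>int ` {..<m}. x ^ nat \<bar>k\<bar>) + (\<Sum>k\<in>(\<lambda>n. - int n) ` {..<m}. x ^ nat \<bar>k\<bar>)"
    using x by (subst sum.union_inter[symmetric]) (auto intro!: sum_nonneg)
  also have "\<dots> = (\<Sum>n<m. x ^ n) + (\<Sum>n<m. x ^ n)"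
    by (simp add: sum.reindex inj_on_def)
  finally show ?thesis using g by simp
qed

text \<open>Each term sums to order \<open>N\<close> over the square. The two with a factor
  \<open>N\<close> are confined to an axis and decay along it; the other two decay geometrically
  across \<open>2 * N + 1\<close> parallel lines. The constant 16 comes from
  \<open>6 * N + 2 \<le> 8 * N\<close> and the geometric bound \<open>2 / (1 - x)\<close>.\<close>

lemma sum_error_terms_le:
  fixes x C :: real
  assumes x: "0 \<le> x" "x < 1" and C: "C \<ge> 0" and N: "N \<ge> 1"
  defines "I \<equiv> {- int N..int N}"
  shows "(\<Sum>r\<in>I. \<Sum>s\<in>I. C * N * (if r = 0 then x ^ nat \<bar>s\<bar> else 0) + C * N * (if s = 0 then x ^ nat \<bar>r\<bar> else 0)
      + C * x ^ nat \<bar>r\<bar> + C * x ^ nat \<bar>r + s\<bar>) \<le> 16 * C / (1 - x) * N"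
proof -
  define X where "X = 2 / (1 - x)"
  have X: "X \<ge> 0" using x by (simp add: X_def)
  have I: "finite I" "card I = 2 * N + 1" by (simp_all add: I_def)
  have zero: "0 \<in> I" by (simp add: I_def)
  have g: "(\<Sum>s\<in>I. x ^ nat \<bar>s\<bar>) \<le> X" unfolding X_def by (rule geometric_int_sum_le) (use x I in auto)
  have g': "(\<Sum>s\<in>I. x ^ nat \<bar>r + s\<bar>) \<le> X" for r
  proof -
    have "(\<Sum>s\<in>I. x ^ nat \<bar>r + s\<bar>) = (\<Sum>k\<in>(\<lambda>s. r + s) ` I. x ^ nat \<bar>k\<bar>)"
      by (simp add: sum.reindex)
    also have "\<dots> \<le> X" unfolding X_def by (rule geometric_int_sum_le) (use x I in auto)
    finally show ?thesis .
  qed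
  have "(\<Sum>r\<in>I. \<Sum>s\<in>I. if r = 0 then x ^ nat \<bar>s\<bar> else 0) = (\<Sum>s\<in>I. x ^ nat \<bar>s\<bar>)"
  proof -
    have "(\<Sum>s\<in>I. if r = 0 then x ^ nat \<bar>s\<bar> else 0) = (if r = 0 then (\<Sum>s\<in>I. x ^ nat \<bar>s\<bar>) else 0)" for r :: int by simp
    then have "(\<Sum>r\<in>I. \<Sum>s\<in>I. if r = 0 then x ^ nat \<bar>s\<bar> else 0) = (\<Sum>r\<in>I. if r = 0 then (\<Sum>s\<in>I. x ^ nat \<bar>s\<bar>) else 0)"
      by (simp only:)
    then show ?thesis using I zero by (simp add: sum.delta)
  qed
  then have a: "(\<Sum>r\<in>I. \<Sum>s\<in>I. C * N * (if r = 0 then x ^ nat \<bar>s\<bar> else 0)) \<le> C * N * X"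
    unfolding sum_distrib_left[symmetric] using C g by (simp add: mult_left_mono)
  have "(\<Sum>r\<in>I. \<Sum>s\<in>I. if s = 0 then x ^ nat \<bar>r\<bar> else 0) = (\<Sum>r\<in>I. x ^ nat \<bar>r\<bar>)"
    using I zero by (simp add: sum.delta)
  then have b: "(\<Sum>r\<in>I. \<Sum>s\<in>I. C * N * (if s = 0 then x ^ nat \<bar>r\<bar> else 0)) \<le> C * N * X"
    unfolding sum_distrib_left[symmetric] using C g by (simp add: mult_left_mono)
  have c: "(\<Sum>r\<in>I. \<Sum>s\<in>I. C * x ^ nat \<bar>r\<bar>) \<le> C * (2 * N + 1) * X"
  proof -
    have "(\<Sum>r\<in>I. \<Sum>s\<in>I. C * x ^ nat \<bar>r\<bar>) = C * (2 * N + 1) * (\<Sum>r\<in>I. x ^ nat \<bar>r\<bar>)"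
      by (simp add: I(2) sum_distrib_left mult_ac)
    also have "\<dots> \<le> C * (2 * N + 1) * X" using C g by (intro mult_left_mono) auto
    finally show ?thesis .
  qed
  have d: "(\<Sum>r\<in>I. \<Sum>s\<in>I. C * x ^ nat \<bar>r + s\<bar>) \<le> C * (2 * N + 1) * X"
  proof -
    have "(\<Sum>r\<in>I. \<Sum>s\<in>I. C * x ^ nat \<bar>r + s\<bar>) \<le> (\<Sum>r\<in>I. C * X)"
      unfolding sum_distrib_left[symmetric] using C g' by (intro mult_left_mono sum_mono) auto
    then show ?thesis by (simp add: I(2) mult_ac)
  qed
  have "(\<Sum>r\<in>I. \<Sum>s\<in>I. C * N * (if r = 0 then x ^ nat \<bar>s\<bar> else 0) + C * N * (if s = 0 then x ^ nat \<bar>r\<bar> else 0)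
      + C * x ^ nat \<bar>r\<bar> + C * x ^ nat \<bar>r + s\<bar>) \<le> C * N * X + C * N * X + C * (2 * N + 1) * X + C * (2 * N + 1) * X"
    unfolding sum.distrib using a b c d by linarith
  also have "\<dots> = C * X * (6 * N + 2)" by (simp add: algebra_simps)
  also have "\<dots> \<le> C * X * (8 * N)" using C X N by (intro mult_left_mono) auto
  also have "\<dots> = 16 * C / (1 - x) * N" by (simp add: X_def)
  finally show ?thesis .
qed

context add_char
begin

text \<open>Absolute value 1 is what allows the zeros to be recovered from their arguments, which
  alone enter \<open>S2\<close>.\<close>

lemma zsum_list:
  assumes f: "f \<in> family p n d" and d: "coprime d p" "d > 0"
  shows "zsum f r = (\<Sum>j<d - 1. cis (of_int r * zero_angle p n \<psi> f j))"
    and "\<And>j. j < d - 1 \<Longrightarrow> norm (zero_list p n \<psi> f ! j) = 1"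
proof -
  let ?xs = "zero_list p n \<psi> f"
  have len: "length ?xs = d - 1"
    using norm_zeros_props(1)[OF f d] mset_zero_list[of f] by (metis size_mset)
  show nrm: "norm (?xs ! j) = 1" if "j < d - 1" for j
    using norm_zeros_props(2)[OF f d, of "?xs ! j"] that len by (simp flip: mset_zero_list)
  have "zsum f r = (\<Sum>x\<leftarrow>?xs. x powi r)"
    unfolding zsum_def mset_zero_list[symmetric] by (metis mset_map sum_mset_sum_list)
  also have "\<dots> = (\<Sum>j<d - 1. ?xs ! j powi r)"
    by (simp add: sum_list_sum_nth len atLeast0LessThan)
  also have "\<dots> = (\<Sum>j<d - 1. cis (of_int r * zero_angle p n \<psi> f j))"
  proof (intro sum.cong refl)
    fix j assume "j \<in> {..<d - 1}"
    then have "norm (?xs ! j) = 1" using nrm by simp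
    then have "?xs ! j = cis (zero_angle p n \<psi> f j)"
      using rcis_cmod_Arg[of "?xs ! j"] by (simp add: rcis_def zero_angle_def)
    then show "?xs ! j powi r = cis (of_int r * zero_angle p n \<psi> f j)" by (simp add: cis_power_int)
  qed
  finally show "zsum f r = (\<Sum>j<d - 1. cis (of_int r * zero_angle p n \<psi> f j))" .
qed

text \<open>The excluded diagonal \<open>j = k\<close> is put back and subtracted. On it the product
  of exponentials depends on \<open>r + s\<close> only, and it sums to
  \<open>zsum f (r + s)\<close>.\<close>

lemma S2_expand:
  fixes V :: "real \<times> real \<Rightarrow> complex"
  assumes V: "schwartz2 V" and supp: "\<And>\<eta> \<xi>. \<bar>\<eta>\<bar> + \<bar>\<xi>\<bar> > 1 \<Longrightarrow> fourier2 V \<eta> \<xi> = 0"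
    and f: "f \<in> family p n d" and d: "coprime d p" "d > 1"
  shows "S2 p n \<psi> V \<theta> f = (\<Sum>(r, s)\<in>freq_set (d - 1).
      (1 / (real (d - 1))\<^sup>2 * fourier2 V (of_int r / real (d - 1)) (of_int s / real (d - 1)) * cis (- of_int (r + s) * \<theta>))
        * (zsum f r * zsum f s - zsum f (r + s)))"
proof -
  define N where "N = d - 1"
  have N: "N > 0" using d by (simp add: N_def)
  have d0: "d > 0" using d by simp
  note fc = family_coeffs[OF f]
  define \<alpha> where "\<alpha> = zero_angle p n \<psi> f"
  define F where "F = (\<lambda>r s. 1 / (real N)\<^sup>2 * fourier2 V (of_int r / real N) (of_int s / real N))"
  have z: "zsum f r = (\<Sum>j<N. cis (of_int r * \<alpha> j))" for r
    unfolding N_def \<alpha>_def by (rule zsum_list(1)[OF f d(1) d0])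
  have "S2 p n \<psi> V \<theta> f = (\<Sum>j\<in>{1..N}. \<Sum>k\<in>{1..N}. if j \<noteq> k then vper V N (\<alpha> (j - 1) - \<theta>) (\<alpha> (k - 1) - \<theta>) else 0)"
    unfolding S2_def Let_def fc(3) N_def \<alpha>_def ..
  also have "\<dots> = (\<Sum>j<N. \<Sum>k<N. if j \<noteq> k then vper V N (\<alpha> j - \<theta>) (\<alpha> k - \<theta>) else 0)"
    by (simp add: sum.atLeast1_atMost_eq cong: if_cong)
  also have "\<dots> = (\<Sum>j<N. \<Sum>k<N. \<Sum>(r, s)\<in>freq_set N. F r s * cis (- of_int (r + s) * \<theta>) *
      (cis (of_int r * \<alpha> j) * cis (of_int s * \<alpha> k) - (if j = k then cis (of_int (r + s) * \<alpha> j) else 0)))"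
  proof (intro sum.cong refl)
    fix j k
    show "(if j \<noteq> k then vper V N (\<alpha> j - \<theta>) (\<alpha> k - \<theta>) else 0)
      = (\<Sum>(r, s)\<in>freq_set N. F r s * cis (- of_int (r + s) * \<theta>) *
      (cis (of_int r * \<alpha> j) * cis (of_int s * \<alpha> k) - (if j = k then cis (of_int (r + s) * \<alpha> j) else 0)))"
    proof (cases "j = k")
      case True
      then show ?thesis by (simp add: cis_mult distrib_right)
    next
      case False
      have "cis (of_int r * (\<alpha> j - \<theta>) + of_int s * (\<alpha> k - \<theta>))
          = cis (- of_int (r + s) * \<theta>) * (cis (of_int r * \<alpha> j) * cis (of_int s * \<alpha> k))" for r s
        unfolding cis_mult by (rule arg_cong[of _ _ cis]) (simp add: algebra_simps)
      then show ?thesis using False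
        by (simp add: poisson_summation2[OF V supp N] F_def sum_distrib_left case_prod_beta mult.assoc)
    qed
  qed
  also have "\<dots> = (\<Sum>(r, s)\<in>freq_set N. F r s * cis (- of_int (r + s) * \<theta>) *
      (\<Sum>j<N. \<Sum>k<N. cis (of_int r * \<alpha> j) * cis (of_int s * \<alpha> k) - (if j = k then cis (of_int (r + s) * \<alpha> j) else 0)))"
  proof -
    have sw: "(\<Sum>j<N. \<Sum>k<N. \<Sum>z\<in>A. h z j k) = (\<Sum>z\<in>A. \<Sum>j<N. \<Sum>k<N. h z j k)" for A and h :: "int \<times> int \<Rightarrow> nat \<Rightarrow> nat \<Rightarrow> complex"
    proof -
      have "(\<Sum>j<N. \<Sum>k<N. \<Sum>z\<in>A. h z j k) = (\<Sum>j<N. \<Sum>z\<in>A. \<Sum>k<N. h z j k)"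
        by (intro sum.cong refl) (rule sum.swap)
      also have "\<dots> = (\<Sum>z\<in>A. \<Sum>j<N. \<Sum>k<N. h z j k)" by (rule sum.swap)
      finally show ?thesis .
    qed
    show ?thesis unfolding case_prod_beta sw by (simp only: sum_distrib_left)
  qed
  also have "\<dots> = (\<Sum>(r, s)\<in>freq_set N. F r s * cis (- of_int (r + s) * \<theta>) * (zsum f r * zsum f s - zsum f (r + s)))"
  proof (intro sum.cong refl, clarify)
    fix r s
    have "(\<Sum>j<N. \<Sum>k<N. cis (of_int r * \<alpha> j) * cis (of_int s * \<alpha> k) - (if j = k then cis (of_int (r + s) * \<alpha> j) else 0))
        = zsum f r * zsum f s - zsum f (r + s)"
      unfolding z sum_subtractf sum_product by (simp add: sum.delta)
    then show "F r s * cis (- of_int (r + s) * \<theta>) *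
        (\<Sum>j<N. \<Sum>k<N. cis (of_int r * \<alpha> j) * cis (of_int s * \<alpha> k) - (if j = k then cis (of_int (r + s) * \<alpha> j) else 0))
        = F r s * cis (- of_int (r + s) * \<theta>) * (zsum f r * zsum f s - zsum f (r + s))" by (simp only:)
  qed
  finally show ?thesis by (simp only: F_def N_def)
qed

text \<open>The average of \<open>zsum f r * zsum f s - zsum f (r + s)\<close> without its error
  terms: \<open>N^2 - N\<close> at the origin, and \<open>|r| - N\<close> elsewhere on the line
  \<open>r + s = 0\<close>. The factor \<open>N - |r|\<close> is the Fejer coefficient.\<close>

definition main_weight :: "nat \<Rightarrow> int \<Rightarrow> int \<Rightarrow> complex" where
  "main_weight N r s = (if r = 0 \<and> s = 0 then (of_nat N)\<^sup>2 else 0) - (if r + s = 0 then of_nat N - of_int \<bar>r\<bar> else 0)"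

lemma main_weight_sum:
  fixes V :: "real \<times> real \<Rightarrow> complex"
  assumes V: "schwartz2 V" and supp: "\<And>\<eta> \<xi>. \<bar>\<eta>\<bar> + \<bar>\<xi>\<bar> > 1 \<Longrightarrow> fourier2 V \<eta> \<xi> = 0"
    and N: "N > 0"
  shows "(\<Sum>(r, s)\<in>freq_set N.
      (1 / (real N)\<^sup>2 * fourier2 V (of_int r / real N) (of_int s / real N) * cis (- of_int (r + s) * \<theta>)) * main_weight N r s)
    = 1 / (4 * pi\<^sup>2) * (LINT y|lborel. V y * of_real (1 - fejer N (fst y - snd y)))"
proof -
  define F where "F = (\<lambda>r s. fourier2 V (of_int r / real N) (of_int s / real N))"
  define w where "w = (\<lambda>r. (of_nat N - of_int \<bar>r\<bar>) * F r (- r))"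
  \<comment> \<open>On the line \<open>s = - r\<close> the frequency set stops at
    \<open>2 * |r| \<le> N\<close>, whereas the Fejer sum runs to \<open>N\<close>; the surplus
    terms vanish by the support condition.\<close>
  have F0: "F r (- r) = 0" if "2 * \<bar>r\<bar> > int N" for r
  proof -
    have "2 * real_of_int \<bar>r\<bar> > real N" using that by linarith
    then have "\<bar>of_int r / real N\<bar> + \<bar>of_int (- r) / real N\<bar> > 1" using N by simp
    then show ?thesis unfolding F_def by (rule supp)
  qed
  have "(\<Sum>(r, s)\<in>freq_set N. (1 / (real N)\<^sup>2 * F r s * cis (- of_int (r + s) * \<theta>)) * main_weight N r s)
     = (\<Sum>z\<in>freq_set N. if z = (0, 0) then F 0 0 else 0)
      - (\<Sum>z\<in>freq_set N. if fst z + snd z = 0 then 1 / (real N)\<^sup>2 * w (fst z) else 0)"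
    unfolding sum_subtractf[symmetric]
  proof (intro sum.cong refl)
    fix z assume "z \<in> freq_set N"
    obtain r s where z: "z = (r, s)" by fastforce
    have "(1 / (real N)\<^sup>2 * F r s * cis (- of_int (r + s) * \<theta>)) * main_weight N r s
       = (if (r, s) = (0, 0) then F 0 0 else 0) - (if r + s = 0 then 1 / (real N)\<^sup>2 * w r else 0)"
    proof (cases "r + s = 0")
      case True
      then have "s = - r" by simp
      then show ?thesis using N by (simp add: main_weight_def w_def right_diff_distrib diff_divide_distrib mult_ac)
    next
      case False
      then show ?thesis by (auto simp: main_weight_def)
    qed
    then show "(case z of (r, s) \<Rightarrow> (1 / (real N)\<^sup>2 * F r s * cis (- of_int (r + s) * \<theta>)) * main_weight N r s)
        = (if z = (0, 0) then F 0 0 else 0) - (if fst z + snd z = 0 then 1 / (real N)\<^sup>2 * w (fst z) else 0)"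
      by (simp only: z prod.case fst_conv snd_conv)
  qed
  also have "(\<Sum>z\<in>freq_set N. if z = (0, 0) then F 0 0 else 0) = F 0 0"
  proof -
    have "(0, 0) \<in> freq_set N" by (simp add: freq_set_def)
    then show ?thesis by (simp add: sum.delta)
  qed
  also have "(\<Sum>z\<in>freq_set N. if fst z + snd z = 0 then 1 / (real N)\<^sup>2 * w (fst z) else 0)
      = 1 / (real N)\<^sup>2 * (\<Sum>r\<in>{- int N..int N}. w r)"
  proof -
    have "(\<Sum>z\<in>freq_set N. if fst z + snd z = 0 then 1 / (real N)\<^sup>2 * w (fst z) else 0)
        = (\<Sum>z\<in>{z\<in>freq_set N. fst z + snd z = 0}. 1 / (real N)\<^sup>2 * w (fst z))"
      by (simp add: sum.If_cases Int_def)
    also have "\<dots> = (\<Sum>r\<in>{r. 2 * \<bar>r\<bar> \<le> int N}. 1 / (real N)\<^sup>2 * w r)"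
      by (rule sum.reindex_bij_witness[where i = "\<lambda>r. (r, - r)" and j = fst]) (auto simp: freq_set_def add_eq_0_iff)
    also have "\<dots> = (\<Sum>r\<in>{- int N..int N}. 1 / (real N)\<^sup>2 * w r)"
      by (rule sum.mono_neutral_left) (use F0 in \<open>auto simp: w_def\<close>)
    finally show ?thesis by (simp only: sum_distrib_left)
  qed
  also have "F 0 0 - 1 / (real N)\<^sup>2 * (\<Sum>r\<in>{- int N..int N}. w r)
      = 1 / (4 * pi\<^sup>2) * (LINT y|lborel. V y * of_real (1 - fejer N (fst y - snd y)))"
    unfolding fejer_integral_fourier[OF V N] w_def F_def by simp
  finally show ?thesis by (simp only: F_def)
qed

lemma avg_S2_eq: "avg_S2 TYPE('k) p n \<psi> V \<theta> d = avg d (S2 p n \<psi> V \<theta>)"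
  by (simp add: avg_S2_def avg_def)

text \<open>Each frequency carries a coefficient of order \<open>1 / N^2\<close>, by the uniform
  bound on the transform, and all errors together are of order \<open>N\<close>.\<close>

lemma avg_S2_close:
  fixes V :: "real \<times> real \<Rightarrow> complex"
  assumes V: "schwartz2 V" and supp: "\<And>\<eta> \<xi>. \<bar>\<eta>\<bar> + \<bar>\<xi>\<bar> > 1 \<Longrightarrow> fourier2 V \<eta> \<xi> = 0"
  shows "\<exists>K. \<forall>d>1. coprime d p \<longrightarrow>
    norm (avg_S2 TYPE('k) p n \<psi> V \<theta> d
      - 1 / (4 * pi\<^sup>2) * (LINT y|lborel. V y * of_real (1 - fejer (d - 1) (fst y - snd y)))) \<le> K / real (d - 1)"
proof -
  obtain C x where x: "0 \<le> x" "x < 1" and C: "0 \<le> C"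
    and E1: "\<And>d r. coprime d p \<Longrightarrow> r \<noteq> 0 \<Longrightarrow> \<bar>r\<bar> < int d \<Longrightarrow> norm (avg d (\<lambda>f. zsum f r)) \<le> C * x ^ nat \<bar>r\<bar>"
    and E2: "\<And>d r s. coprime d p \<Longrightarrow> r \<noteq> 0 \<Longrightarrow> s \<noteq> 0 \<Longrightarrow> \<bar>r\<bar> + \<bar>s\<bar> < int d \<Longrightarrow>
       norm (avg d (\<lambda>f. zsum f r * zsum f s) - (if r + s = 0 then of_int \<bar>r\<bar> else 0)) \<le> C * x ^ nat (\<bar>r\<bar> + \<bar>s\<bar>)"
    by (rule avg_zsum_bounds, rule that)
  define B where "B = (LINT y|lborel. norm (V y))"
  have B: "B \<ge> 0" by (simp add: B_def)
  define K where "K = B * (16 * C / (1 - x))"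
  have "norm (avg_S2 TYPE('k) p n \<psi> V \<theta> d
      - 1 / (4 * pi\<^sup>2) * (LINT y|lborel. V y * of_real (1 - fejer (d - 1) (fst y - snd y)))) \<le> K / real (d - 1)"
    if d: "d > 1" "coprime d p" for d
  proof -
    define N where "N = d - 1"
    have N: "N \<ge> 1" "N > 0" "int N < int d" "d > 0" using d by (auto simp: N_def)
    define G where "G = (\<lambda>r s. 1 / (real N)\<^sup>2 * fourier2 V (of_int r / real N) (of_int s / real N) * cis (- of_int (r + s) * \<theta>))"
    define W where "W = (\<lambda>r s. avg d (\<lambda>f. zsum f r * zsum f s) - avg d (\<lambda>f. zsum f (r + s)) - main_weight N r s)"
    \<comment> \<open>In order: the two axes, where \<open>zsum f 0\<close> supplies the factor
      \<open>N\<close>, then the error of the product, then the average of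
      \<open>zsum f (r + s)\<close>.\<close>
    define g where "g = (\<lambda>r s. C * N * (if r = 0 then x ^ nat \<bar>s\<bar> else 0) + C * N * (if s = 0 then x ^ nat \<bar>r\<bar> else 0)
      + C * x ^ nat \<bar>r\<bar> + C * x ^ nat \<bar>r + s\<bar>)"
    have g0: "g r s \<ge> 0" for r s using C x by (auto simp: g_def intro!: add_nonneg_nonneg mult_nonneg_nonneg)
    have z0: "avg d (\<lambda>f. zsum f 0) = of_nat N"
      using avg_cong[of d "\<lambda>f. zsum f 0" "\<lambda>_. of_nat N"] zsum_0 d N avg_const[of d] by (simp add: N_def)
    have z0m: "avg d (\<lambda>f. zsum f 0 * zsum f s) = of_nat N * avg d (\<lambda>f. zsum f s)"
      "avg d (\<lambda>f. zsum f s * zsum f 0) = of_nat N * avg d (\<lambda>f. zsum f s)" for s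
      unfolding avg_cmult[symmetric] by (rule avg_cong; use zsum_0 d N in \<open>simp add: N_def\<close>)+
    have Wg: "norm (W r s) \<le> g r s" if A: "(r, s) \<in> freq_set N" for r s
    proof -
      \<comment> \<open>As \<open>N = d - 1\<close>, the support condition yields precisely the
        strict inequality under which orthogonality over the family holds.\<close>
      have rs: "\<bar>r\<bar> + \<bar>s\<bar> < int d" using A N by (auto simp: freq_set_def)
      consider "r = 0" "s = 0" | "r = 0" "s \<noteq> 0" | "r \<noteq> 0" "s = 0" | "r \<noteq> 0" "s \<noteq> 0" by blast
      then show ?thesis
      proof cases
        case 1
        then have "W r s = 0" by (simp add: W_def z0m z0 main_weight_def power2_eq_square)
        then show ?thesis using g0[of r s] by simp
      next
        case 2
        then have "W r s = of_nat (N - 1) * avg d (\<lambda>f. zsum f s)"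
          using N by (simp add: W_def z0m main_weight_def of_nat_diff algebra_simps)
        then have "norm (W r s) \<le> real (N - 1) * (C * x ^ nat \<bar>s\<bar>)"
          using E1[OF d(2), of s] 2 rs by (simp add: norm_mult mult_left_mono)
        also have "\<dots> \<le> real N * (C * x ^ nat \<bar>s\<bar>)" using C x by (intro mult_right_mono) auto
        also have "\<dots> \<le> g r s" using 2 C x by (simp add: g_def mult_ac)
        finally show ?thesis .
      next
        case 3
        then have "W r s = of_nat (N - 1) * avg d (\<lambda>f. zsum f r)"
          using N by (simp add: W_def z0m main_weight_def of_nat_diff algebra_simps)
        then have "norm (W r s) \<le> real (N - 1) * (C * x ^ nat \<bar>r\<bar>)"
          using E1[OF d(2), of r] 3 rs by (simp add: norm_mult mult_left_mono)
        also have "\<dots> \<le> real N * (C * x ^ nat \<bar>r\<bar>)" using C x by (intro mult_right_mono) auto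
        also have "\<dots> \<le> g r s" using 3 C x by (simp add: g_def mult_ac)
        finally show ?thesis .
      next
        case 4
        have xx: "x ^ nat (\<bar>r\<bar> + \<bar>s\<bar>) \<le> x ^ nat \<bar>r\<bar>" using x by (intro power_decreasing) auto
        have e2: "norm (avg d (\<lambda>f. zsum f r * zsum f s) - (if r + s = 0 then of_int \<bar>r\<bar> else 0)) \<le> C * x ^ nat \<bar>r\<bar>"
          using E2[OF d(2) 4 rs] mult_left_mono[OF xx C] by linarith
        have gr: "C * x ^ nat \<bar>r\<bar> + C * x ^ nat \<bar>r + s\<bar> \<le> g r s" using 4 by (simp add: g_def)
        show ?thesis
        proof (cases "r + s = 0")
          case True
          then have "W r s = avg d (\<lambda>f. zsum f r * zsum f s) - (if r + s = 0 then of_int \<bar>r\<bar> else 0)"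
            using 4 by (simp add: W_def main_weight_def z0)
          moreover have "0 \<le> C * x ^ nat \<bar>r + s\<bar>" using C x by simp
          ultimately show ?thesis using e2 gr by simp
        next
          case False
          have "W r s = (avg d (\<lambda>f. zsum f r * zsum f s) - (if r + s = 0 then of_int \<bar>r\<bar> else 0)) - avg d (\<lambda>f. zsum f (r + s))"
            using 4 False by (simp add: W_def main_weight_def)
          moreover have "norm (avg d (\<lambda>f. zsum f (r + s))) \<le> C * x ^ nat \<bar>r + s\<bar>"
            using E1[OF d(2) False] rs by simp
          ultimately show ?thesis using e2 gr norm_triangle_ineq4 by (smt (verit))
        qed
      qed
    qed
    have "avg_S2 TYPE('k) p n \<psi> V \<theta> d = avg d (\<lambda>f. \<Sum>z\<in>freq_set N. G (fst z) (snd z) * (zsum f (fst z) * zsum f (snd z) - zsum f (fst z + snd z)))"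
      unfolding avg_S2_eq
      by (rule avg_cong) (simp only: S2_expand[OF V supp _ d(2,1)] G_def N_def case_prod_unfold)
    also have "\<dots> = (\<Sum>z\<in>freq_set N. G (fst z) (snd z) * (W (fst z) (snd z) + main_weight N (fst z) (snd z)))"
      unfolding avg_sum avg_cmult avg_diff W_def by simp
    also have "\<dots> = (\<Sum>z\<in>freq_set N. G (fst z) (snd z) * W (fst z) (snd z)) + (\<Sum>z\<in>freq_set N. G (fst z) (snd z) * main_weight N (fst z) (snd z))"
      by (simp add: distrib_left sum.distrib)
    also have "(\<Sum>z\<in>freq_set N. G (fst z) (snd z) * main_weight N (fst z) (snd z))
        = 1 / (4 * pi\<^sup>2) * (LINT y|lborel. V y * of_real (1 - fejer N (fst y - snd y)))"
      using main_weight_sum[OF V supp N(2), of \<theta>] by (simp only: G_def case_prod_unfold)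
    finally have "avg_S2 TYPE('k) p n \<psi> V \<theta> d - 1 / (4 * pi\<^sup>2) * (LINT y|lborel. V y * of_real (1 - fejer N (fst y - snd y)))
        = (\<Sum>z\<in>freq_set N. G (fst z) (snd z) * W (fst z) (snd z))" by simp
    also have "norm \<dots> \<le> (\<Sum>z\<in>freq_set N. B / (real N)\<^sup>2 * g (fst z) (snd z))"
    proof (rule sum_norm_le)
      fix z assume z: "z \<in> freq_set N"
      have "norm (G (fst z) (snd z)) = norm (fourier2 V (of_int (fst z) / real N) (of_int (snd z) / real N)) / (real N)\<^sup>2"
        by (simp add: G_def norm_mult norm_divide norm_power)
      also have "\<dots> \<le> B / (real N)\<^sup>2" unfolding B_def by (intro divide_right_mono fourier2_bound) simp
      finally have "norm (G (fst z) (snd z)) \<le> B / (real N)\<^sup>2" .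
      moreover have "norm (W (fst z) (snd z)) \<le> g (fst z) (snd z)" using Wg z by simp
      ultimately show "norm (G (fst z) (snd z) * W (fst z) (snd z)) \<le> B / (real N)\<^sup>2 * g (fst z) (snd z)"
        unfolding norm_mult using B by (intro mult_mono) auto
    qed
    also have "\<dots> = B / (real N)\<^sup>2 * (\<Sum>z\<in>freq_set N. g (fst z) (snd z))" by (simp only: sum_distrib_left)
    also have "\<dots> \<le> B / (real N)\<^sup>2 * (\<Sum>z\<in>{- int N..int N} \<times> {- int N..int N}. g (fst z) (snd z))"
      using B g0 freq_set_subset by (intro mult_left_mono sum_mono2) auto
    also have "\<dots> = B / (real N)\<^sup>2 * (\<Sum>r\<in>{- int N..int N}. \<Sum>s\<in>{- int N..int N}. g r s)"
      by (simp add: sum.cartesian_product case_prod_beta)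
    also have "\<dots> \<le> B / (real N)\<^sup>2 * (16 * C / (1 - x) * N)"
      unfolding g_def using B by (intro mult_left_mono sum_error_terms_le[OF x C N(1)]) auto
    also have "\<dots> = K / real N" using N by (simp add: K_def power2_eq_square)
    finally show ?thesis by (simp only: N_def)
  qed
  then show ?thesis by blast
qed

end

theorem theorem3:
  fixes p n :: nat and \<psi> :: "'k::alg_closed_field \<Rightarrow> complex"
    and V :: "real \<times> real \<Rightarrow> complex"
  assumes "prime p" and "p > 2" and "n \<ge> 1" and "CHAR('k) = p"
    and "nontriv_add_char p \<psi>"
    and "schwartz2 V"
    and "\<And>\<eta> \<xi>. \<bar>\<eta>\<bar> + \<bar>\<xi>\<bar> > 1 \<Longrightarrow> fourier2 V \<eta> \<xi> = 0"
  shows "\<forall>\<theta>::real. filterlim (avg_S2 TYPE('k) p n \<psi> V \<theta>)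
           (nhds (1 / (4 * pi\<^sup>2) * (LINT x|lborel. V x * complex_of_real
              (1 - (sin ((fst x - snd x) / 2) / ((fst x - snd x) / 2))\<^sup>2))))
           (inf at_top (principal {d. coprime d p}))"
proof
  fix \<theta> :: real
  interpret add_char p n \<psi> by unfold_locales (use assms in auto)
  let ?F = "inf at_top (principal {d. coprime d p}) :: nat filter"
  define M where "M = (\<lambda>N. 1 / (4 * pi\<^sup>2) * (LINT y|lborel. V y * complex_of_real (1 - fejer N (fst y - snd y))))"
  obtain K where K: "\<And>d. d > 1 \<Longrightarrow> coprime d p \<Longrightarrow>
      norm (avg_S2 TYPE('k) p n \<psi> V \<theta> d - M (d - 1)) \<le> K / real (d - 1)"
    using avg_S2_close[OF assms(6,7), of \<theta>] unfolding M_def by blast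
  have F: "?F \<le> at_top" by (rule inf_le1)
  have shift: "filterlim (\<lambda>d::nat. d - 1) at_top ?F"
    by (rule filterlim_mono[OF _ order_refl F]) (rule filterlim_minus_const_nat_at_top)
  have M: "(M \<longlonglongrightarrow> 1 / (4 * pi\<^sup>2) * (LINT x|lborel. V x * complex_of_real
              (1 - (sin ((fst x - snd x) / 2) / ((fst x - snd x) / 2))\<^sup>2)))"
    unfolding M_def by (intro tendsto_mult tendsto_const fejer_integral_limit assms)
  have "((\<lambda>d. avg_S2 TYPE('k) p n \<psi> V \<theta> d - M (d - 1)) \<longlongrightarrow> 0) ?F"
  proof (rule Lim_null_comparison)
    show "\<forall>\<^sub>F d in ?F. norm (avg_S2 TYPE('k) p n \<psi> V \<theta> d - M (d - 1)) \<le> K / real (d - 1)"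
      unfolding eventually_inf_principal
      using eventually_gt_at_top[of "1::nat"] by eventually_elim (use K in auto)
    show "((\<lambda>d. K / real (d - 1)) \<longlongrightarrow> 0) ?F"
      by (rule filterlim_compose[OF lim_const_over_n shift])
  qed
  from tendsto_add[OF this filterlim_compose[OF M shift]]
  show "filterlim (avg_S2 TYPE('k) p n \<psi> V \<theta>)
           (nhds (1 / (4 * pi\<^sup>2) * (LINT x|lborel. V x * complex_of_real
              (1 - (sin ((fst x - snd x) / 2) / ((fst x - snd x) / 2))\<^sup>2)))) ?F"
    by simp
qed

end
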